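(* Let $k$ be an algebraically closed field of characteristic zero, let $m,p,d,n$ be positive integers with $m=pd$, let $\xi\in k$ be a primitive $m$th root of unity and $\delta=(\delta_0,\delta_p,\dots,\delta_{(d-1)p})\in k^d$. Let $\lambda\in\Lambda(m,1,n)$ with $\operatorname{Stab}_{\mathbb{Z}/p\mathbb{Z}}(\lambda)=\langle\sigma^t\rangle$. Then the restriction to $B_{m,p,n}$ of the standard $B_{m,1,n}$-module $\overline{\Delta_n(\lambda)}$ is a direct sum of $p/t$ standard modules for $B_{m,p,n}$, namely the modules $\Delta_n(\lambda^r)$, $0\le r<p/t$, and for each such $r$ $$\Delta_n(\lambda^r)\cong\ker\big(\sigma^t-\xi^{dtr}\ \big|\ \overline{\Delta_n(\lambda)}\big)$$ as $B_{m,p,n}$-modules.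
   Context: Diagrams and algebras. A reduced diagram has $n$ northern and $n$ southern nodes, each node joined to precisely one other by a strand, each strand labelled by an element of $\mathbb{Z}/m\mathbb{Z}$. Strands joining north to south are through-strands; the others are (northern or southern) arcs. $B_{m,p,n}(\delta)$ has $k$-basis the reduced diagrams whose labels sum to a multiple of $p$; the product $x\cdot y$ is obtained by placing $x$ above $y$, adding labels along composed strands, and removing each closed loop with label $ip$ at the cost of the factor $\delta_{ip}$ (the product is $0$ if some loop has label not divisible by $p$). $B_{m,1,n}$ is the same with no restriction on the label sum, with parameter $\delta$ extended by $\delta_i=0$ for $p\nmid i$; so $B_{m,p,n}\subseteq B_{m,1,n}$ is a subalgebra. The diagrams with no arcs span the group algebras $kG(m,p,n)\subseteq kG(m,1,n)$. Let $t_1$ be the identity diagram with label $1$ on its first strand, and $s_{i,i+1}$ the unlabelled diagram transposing $i,i+1$. Combinatorics. An $m$-partition of $N$ is an $m$-tuple $\lambda=(\lambda^0,\dots,\lambda^{m-1})$ of partitions of total size $N$. $\Lambda(m,1,n)$ is the set of $m$-partitions of $n-2l$, $0\le l\le n/2$. A standard $\lambda$-tableau is a tuple $\mathfrak t=(\mathfrak t^0,\dots,\mathfrak t^{m-1})$ filling the boxes of $\lambda$ bijectively with $1,\dots,N$, increasing along rows and columns of each component; $\mathfrak t(i)=s$ if $i$ lies in $\mathfrak t^s$. Let $\sigma$ be the generator of $\mathbb{Z}/p\mathbb{Z}$ acting on $m$-partitions and tableaux by $\sigma(\mathfrak t^0,\dots,\mathfrak t^{m-1})=(\mathfrak t^{d},\mathfrak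 t^{1+d},\dots,\mathfrak t^{m-1+d})$ (indices mod $m$). Write $\operatorname{Stab}_{\mathbb{Z}/p\mathbb{Z}}(\lambda)=\langle\sigma^t\rangle$ with $t\mid p$. Group modules. For $\lambda$ an $m$-partition of $N$, the simple $kG(m,1,N)$-module $\overline{\mathbf S(\lambda)}$ has basis the standard $\lambda$-tableaux, with $t_1\mathfrak t=\xi^{\mathfrak t(1)}\mathfrak t$ and $s_{i,i+1}\mathfrak t=\frac1{a}\mathfrak t+(1+\frac1{a})\mathfrak t_{i\leftrightarrow i+1}$. Here $\mathfrak t_{i\leftrightarrow i+1}$ is $\mathfrak t$ with $i,i+1$ exchanged if this is standard, and $0$ otherwise; $1/a=0$ if $\mathfrak t(i)\ne\mathfrak t(i+1)$, and otherwise $a=(i_0-i_1)-(j_0-j_1)$ with $i$ in row $i_0$, column $i_1$ and $i+1$ in row $j_0$, column $j_1$. For $0\le r<p/t$, $\mathbf S(\lambda^r)=\ker(\sigma^t-\xi^{dtr})\subseteq\overline{\mathbf S(\lambda)}$, a $kG(m,p,N)$-module. (For $\lambda=\emptyset$, $\overline{\mathbf S(\emptyset)}=k$, $t=1$ and $\sigma$ acts trivially.) Standard modules of $B_{m,1,n}$. $V_l$ is the $k$-span of $(m,n,l)$-dangles: $n$ nodes on a line, $l$ arcs each joining two nodes and labelled by an element of $\mathbb{Z}/m\mathbb{Z}$, and $n-2l$ unlabelled, non-crossing free lines from the remaining nodes to $n-2l$ bottom nodes. For $\lambda$ an $m$-partition of $n-2l$, $\overline{\Delta_n(\lambda)}=V_l\otimes_k\overline{\mathbf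 S(\lambda)}$, with action: place a diagram $X$ above a dangle $v$. If more than $l$ arcs result, or a closed loop with label not divisible by $p$, then $X(v\otimes x)=0$. Otherwise the concatenation equals a scalar (the product of the $\delta_{ip}$ of the removed loops) times a dangle $v'$ with an element $w\in G(m,1,n-2l)$ placed below it on the free lines, and $X(v\otimes x)$ is that scalar times $v'\otimes wx$. The map $\sigma$ is extended to these modules by $\sigma(v\otimes\mathfrak t)=\xi^{dq}\,v\otimes\sigma(\mathfrak t)$, where $q$ is the sum of the labels of the dangle $v$; thus $\sigma^t$ is an endomorphism of the vector space $\overline{\Delta_n(\lambda)}$. Standard modules of $B_{m,p,n}$. For $n-2l\ge1$, let $M_l$ be the $k$-span of the labelled diagrams with $n$ northern and $n-2l$ southern nodes, exactly $l$ northern arcs and $n-2l$ through-strands (possibly crossing and labelled), with label sum a multiple of $p$. It is a left $B_{m,p,n}$-module by concatenation (setting diagrams with fewer than $n-2l$ through-strands to $0$, with the loop rule above) and a right $kG(m,p,n-2l)$-module. The standard module is $\Delta_n(\lambda^r)=M_l\otimes_{kG(m,p,n-2l)}\mathbf S(\lambda^r)$. For $n=2l$ and $\lambda=\emptyset$, $\Delta_n(\emptyset^r)$, $0\le r<p$, is the span in $V_l$ of the dangles with label sum congruent to $r$ modulo $p$, with action by concatenation. *)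

theory Defs
  imports Complex_Main
    "HOL-Computational_Algebra.Polynomial"
    "HOL-Combinatorics.Transposition"
    "HOL-Algebra.Ring"
    "HOL-Library.Function_Algebras"
    "HOL-Library.Set_Algebras"
begin

section \<open>Free vector spaces\<close>

text \<open>
  The vector space with finite basis \<open>X\<close> is the space of functions supported on \<open>X\<close>.
  A map given on basis vectors is extended linearly by \<open>lin_ext\<close>; all vectors that
  occur below have finite support, so the sum in \<open>lin_ext\<close> is finite.
\<close>

definition fscale :: "'k::field \<Rightarrow> ('x \<Rightarrow> 'k) \<Rightarrow> 'x \<Rightarrow> 'k"
  where "fscale c f = (\<lambda>x. c * f x)"

interpretation fspace: vector_space fscale
  by standard (auto simp: fscale_def fun_eq_iff algebra_simps)

definition bas :: "'x \<Rightarrow> 'x \<Rightarrow> 'k::field"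
  where "bas x = (\<lambda>y. if y = x then 1 else 0)"

definition span_on :: "'x set \<Rightarrow> ('x \<Rightarrow> 'k::field) set"
  where "span_on X = {f. \<forall>x. x \<notin> X \<longrightarrow> f x = 0}"

definition lin_ext :: "('x \<Rightarrow> 'y \<Rightarrow> 'k::field) \<Rightarrow> ('x \<Rightarrow> 'k) \<Rightarrow> 'y \<Rightarrow> 'k"
  where "lin_ext f v = (\<lambda>y. \<Sum>x | v x \<noteq> 0. v x * f x y)"

definition tensor :: "('x \<Rightarrow> 'k::field) \<Rightarrow> ('y \<Rightarrow> 'k) \<Rightarrow> 'x \<times> 'y \<Rightarrow> 'k"
  where "tensor f g = (\<lambda>(x, y). f x * g y)"


section \<open>Modules over a (noncommutative) algebra\<close>

text \<open>
  The locale \<^locale>\<open>module\<close> is restricted to commutative rings, hence the record below.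
  Restricting a module to a subalgebra does not change the record: it only shrinks the
  carrier of the algebra in \<open>mod_iso\<close>.
\<close>

record ('a, 'k, 'v) amod =
  vecs :: "'v set"
  vadd :: "'v \<Rightarrow> 'v \<Rightarrow> 'v"
  vscale :: "'k \<Rightarrow> 'v \<Rightarrow> 'v"
  vact :: "'a \<Rightarrow> 'v \<Rightarrow> 'v"

definition mod_closed :: "('a, 'c) ring_scheme \<Rightarrow> ('a, 'k, 'v) amod \<Rightarrow> bool" where
  "mod_closed R M \<longleftrightarrow>
     vecs M \<noteq> {} \<and>
     (\<forall>x\<in>vecs M. \<forall>y\<in>vecs M. vadd M x y \<in> vecs M) \<and>
     (\<forall>c. \<forall>x\<in>vecs M. vscale M c x \<in> vecs M) \<and>
     (\<forall>b\<in>carrier R. \<forall>x\<in>vecs M. vact M b x \<in> vecs M)"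

definition mod_iso ::
    "('a, 'c) ring_scheme \<Rightarrow> ('a, 'k, 'v) amod \<Rightarrow> ('a, 'k, 'w) amod \<Rightarrow> bool" where
  "mod_iso R M M' \<longleftrightarrow> mod_closed R M \<and> mod_closed R M' \<and>
     (\<exists>\<phi>. bij_betw \<phi> (vecs M) (vecs M') \<and>
       (\<forall>x\<in>vecs M. \<forall>y\<in>vecs M. \<phi> (vadd M x y) = vadd M' (\<phi> x) (\<phi> y)) \<and>
       (\<forall>c. \<forall>x\<in>vecs M. \<phi> (vscale M c x) = vscale M' c (\<phi> x)) \<and>
       (\<forall>b\<in>carrier R. \<forall>x\<in>vecs M. \<phi> (vact M b x) = vact M' b (\<phi> x)))"

definition mod_sum :: "nat \<Rightarrow> (nat \<Rightarrow> ('a, 'k, 'v) amod) \<Rightarrow> ('a, 'k, nat \<Rightarrow> 'v) amod" where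
  "mod_sum q M =
     \<lparr> vecs = (\<Pi>\<^sub>E r\<in>{..<q}. vecs (M r)),
       vadd = (\<lambda>x y. \<lambda>r\<in>{..<q}. vadd (M r) (x r) (y r)),
       vscale = (\<lambda>c x. \<lambda>r\<in>{..<q}. vscale (M r) c (x r)),
       vact = (\<lambda>b x. \<lambda>r\<in>{..<q}. vact (M r) b (x r)) \<rparr>"


section \<open>Labelled diagrams\<close>

text \<open>
  A labelled strand is an unordered pair of nodes with a label, an element of
  \<open>\<int>/m\<int>\<close> represented in \<open>{0..<m}\<close>; an \<open>(a,b)\<close>-diagram has \<open>a\<close> northern and \<open>b\<close> southern nodes.
\<close>

datatype node = North nat | South nat

type_synonym diagram = "(node set \<times> nat) set"

definition nodes :: "nat \<Rightarrow> nat \<Rightarrow> node set"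
  where "nodes a b = North ` {1..a} \<union> South ` {1..b}"

definition diagrams :: "nat \<Rightarrow> nat \<Rightarrow> nat \<Rightarrow> diagram set" where
  "diagrams m a b = {D. (\<forall>(e, c)\<in>D. e \<subseteq> nodes a b \<and> card e = 2 \<and> c < m) \<and>
                        (\<forall>u\<in>nodes a b. \<exists>!s. s \<in> D \<and> u \<in> fst s)}"

definition label_sum :: "diagram \<Rightarrow> nat"
  where "label_sum D = (\<Sum>s\<in>D. snd s)"

definition north_arcs :: "diagram \<Rightarrow> diagram"
  where "north_arcs D = {s \<in> D. fst s \<subseteq> range North}"

definition south_arcs :: "diagram \<Rightarrow> diagram"
  where "south_arcs D = {s \<in> D. fst s \<subseteq> range South}"

definition through_strands :: "diagram \<Rightarrow> diagram"
  where "through_strands D = {s \<in> D. \<exists>i j. fst s = {North i, South j}}"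

subsection \<open>Concatenation\<close>

text \<open>
  Placing \<open>X\<close> above \<open>Y\<close> identifies the southern nodes of \<open>X\<close> with the northern nodes of
  \<open>Y\<close>. The strands of the product are the connected components of the resulting graph
  that reach the top or bottom line, and the closed loops are the other components;
  either carries the sum of the labels of its pieces.
\<close>

datatype vertex = Top nat | Mid nat | Bot nat

fun upper :: "node \<Rightarrow> vertex" where
  "upper (North i) = Top i"
| "upper (South i) = Mid i"

fun lower :: "node \<Rightarrow> vertex" where
  "lower (North i) = Mid i"
| "lower (South i) = Bot i"

definition glued_edges :: "diagram \<Rightarrow> diagram \<Rightarrow> vertex set set"
  where "glued_edges X Y = (\<lambda>s. upper ` fst s) ` X \<union> (\<lambda>s. lower ` fst s) ` Y"

definition components :: "diagram \<Rightarrow> diagram \<Rightarrow> vertex set set" where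
  "components X Y =
     \<Union>(glued_edges X Y) // {(u, w). \<exists>e\<in>glued_edges X Y. u \<in> e \<and> w \<in> e}\<^sup>*"

definition comp_label :: "nat \<Rightarrow> diagram \<Rightarrow> diagram \<Rightarrow> vertex set \<Rightarrow> nat" where
  "comp_label m X Y C =
     ((\<Sum>s | s \<in> X \<and> upper ` fst s \<subseteq> C. snd s) +
      (\<Sum>s | s \<in> Y \<and> lower ` fst s \<subseteq> C. snd s)) mod m"

definition ends :: "vertex set \<Rightarrow> node set"
  where "ends C = {North i | i. Top i \<in> C} \<union> {South i | i. Bot i \<in> C}"

definition compose :: "nat \<Rightarrow> diagram \<Rightarrow> diagram \<Rightarrow> diagram" where
  "compose m X Y = {(ends C, comp_label m X Y C) | C. C \<in> components X Y \<and> ends C \<noteq> {}}"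

text \<open>\<open>\<delta> i\<close> is the parameter \<open>\<delta>\<^sub>i\<close>; only its values at multiples of \<open>p\<close> below \<open>m\<close> matter.\<close>

definition loop_coeff ::
    "nat \<Rightarrow> nat \<Rightarrow> (nat \<Rightarrow> 'k::field) \<Rightarrow> diagram \<Rightarrow> diagram \<Rightarrow> 'k" where
  "loop_coeff m p \<delta> X Y =
     (\<Prod>C | C \<in> components X Y \<and> ends C = {}.
        if p dvd comp_label m X Y C then \<delta> (comp_label m X Y C) else 0)"

subsection \<open>The algebras and the groups\<close>

definition idd :: "nat \<Rightarrow> diagram"
  where "idd n = {({North i, South i}, 0) | i. i \<in> {1..n}}"

text \<open>
  \<open>Balg m p s \<delta> n\<close> is spanned by the diagrams with label sum in \<open>s\<int>\<close>, and loops are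
  evaluated by \<open>\<delta>\<^sub>i\<close> if \<open>p\<close> divides \<open>i\<close> and by 0 otherwise. Thus \<open>s = p\<close> gives
  \<open>B\<^bsub>m,p,n\<^esub>\<close>, and \<open>s = 1\<close> gives \<open>B\<^bsub>m,1,n\<^esub>\<close> with the extended parameter.
\<close>

definition Balg ::
    "nat \<Rightarrow> nat \<Rightarrow> nat \<Rightarrow> (nat \<Rightarrow> 'k::field) \<Rightarrow> nat \<Rightarrow> (diagram \<Rightarrow> 'k) ring" where
  "Balg m p s \<delta> n =
     \<lparr> carrier = span_on {X \<in> diagrams m n n. s dvd label_sum X},
       mult = (\<lambda>x y. lin_ext (\<lambda>X. lin_ext (\<lambda>Y.
                 fscale (loop_coeff m p \<delta> X Y) (bas (compose m X Y))) y) x),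
       one = bas (idd n), zero = 0, add = (+) \<rparr>"

definition Ggrp :: "nat \<Rightarrow> nat \<Rightarrow> nat \<Rightarrow> diagram set" where
  "Ggrp m p n = {g \<in> diagrams m n n. through_strands g = g \<and> p dvd label_sum g}"

definition t_gen :: "nat \<Rightarrow> nat \<Rightarrow> diagram" where
  "t_gen m n = {({North i, South i}, if i = 1 then 1 mod m else 0) | i. i \<in> {1..n}}"

definition s_gen :: "nat \<Rightarrow> nat \<Rightarrow> diagram" where
  "s_gen n i = {({North j, South (transpose i (Suc i) j)}, 0) | j. j \<in> {1..n}}"


section \<open>Multipartitions and tableaux\<close>

type_synonym mpart = "nat list list"

text \<open>A tableau is the list of its components, each given by the list of its rows.\<close>

type_synonym tableau = "nat list list list"

definition mpartitions :: "nat \<Rightarrow> nat \<Rightarrow> mpart set" where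
  "mpartitions m N = {lam. length lam = m \<and>
     (\<forall>\<mu>\<in>set lam. sorted_wrt (\<ge>) \<mu> \<and> 0 \<notin> set \<mu>) \<and> sum_list (map sum_list lam) = N}"

definition std_tableaux :: "mpart \<Rightarrow> tableau set" where
  "std_tableaux lam = {T. map (map length) T = lam \<and>
     distinct (concat (concat T)) \<and>
     set (concat (concat T)) = {1..sum_list (map sum_list lam)} \<and>
     (\<forall>U\<in>set T. (\<forall>row\<in>set U. sorted_wrt (<) row) \<and>
        (\<forall>i j. Suc i < length U \<and> j < length (U ! Suc i) \<longrightarrow> U ! i ! j < U ! Suc i ! j))}"

text \<open>
  As \<open>rotate d xs ! i = xs ! ((i + d) mod length xs)\<close>, the generator \<open>\<sigma>\<close> of
  \<open>\<int>/p\<int>\<close> is \<open>rotate d\<close>, on multipartitions as well as on tableaux.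
\<close>

definition sigma :: "nat \<Rightarrow> 'a list \<Rightarrow> 'a list"
  where "sigma d = rotate d"

definition stab :: "nat \<Rightarrow> nat \<Rightarrow> mpart \<Rightarrow> nat set"
  where "stab p d lam = {j \<in> {..<p}. (sigma d ^^ j) lam = lam}"

text \<open>Component, row and column of an entry (counted from 0).\<close>

definition box_of :: "tableau \<Rightarrow> nat \<Rightarrow> nat \<times> nat \<times> nat" where
  "box_of T i = (THE (s, r, c). s < length T \<and> r < length (T ! s) \<and>
                   c < length (T ! s ! r) \<and> T ! s ! r ! c = i)"

definition tcomp :: "tableau \<Rightarrow> nat \<Rightarrow> nat"
  where "tcomp T i = fst (box_of T i)"

definition trow :: "tableau \<Rightarrow> nat \<Rightarrow> nat"
  where "trow T i = fst (snd (box_of T i))"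

definition tcol :: "tableau \<Rightarrow> nat \<Rightarrow> nat"
  where "tcol T i = snd (snd (box_of T i))"

definition inv_axial :: "tableau \<Rightarrow> nat \<Rightarrow> 'k::field_char_0" where
  "inv_axial T i = (if tcomp T i \<noteq> tcomp T (Suc i) then 0
     else 1 / of_int ((int (trow T i) - int (tcol T i))
                    - (int (trow T (Suc i)) - int (tcol T (Suc i)))))"

definition tswap :: "nat \<Rightarrow> tableau \<Rightarrow> tableau"
  where "tswap i T = map (map (map (transpose i (Suc i)))) T"


section \<open>Group modules\<close>

text \<open>
  \<open>Sbar_action m \<xi> lam \<rho>\<close> says that \<open>\<rho>\<close>, extended linearly from tableaux, makes the span of
  the standard tableaux the module \<open>\<^bold>S(\<lambda>)\<close> of the group \<open>G(m,1,N)\<close> with the seminormal action of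
  the generators; \<open>\<rho> g T\<close> is the vector \<open>g T\<close>. As the generators generate \<open>G(m,1,N)\<close>,
  such a \<open>\<rho>\<close> is determined on \<open>G(m,1,N)\<close> and standard tableaux; it exists by Young's
  seminormal form.
\<close>

definition Sbar_action ::
    "nat \<Rightarrow> 'k::field_char_0 \<Rightarrow> mpart \<Rightarrow> (diagram \<Rightarrow> tableau \<Rightarrow> tableau \<Rightarrow> 'k) \<Rightarrow> bool" where
  "Sbar_action m \<xi> lam \<rho> \<longleftrightarrow>
     (let N = sum_list (map sum_list lam) in
       (\<forall>g\<in>Ggrp m 1 N. \<forall>T\<in>std_tableaux lam. \<rho> g T \<in> span_on (std_tableaux lam)) \<and>
       (\<forall>T\<in>std_tableaux lam. \<rho> (idd N) T = bas T) \<and>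
       (\<forall>g\<in>Ggrp m 1 N. \<forall>h\<in>Ggrp m 1 N. \<forall>T\<in>std_tableaux lam.
          \<rho> (compose m g h) T = lin_ext (\<rho> g) (\<rho> h T)) \<and>
       (1 \<le> N \<longrightarrow> (\<forall>T\<in>std_tableaux lam. \<rho> (t_gen m N) T = fscale (\<xi> ^ tcomp T 1) (bas T))) \<and>
       (\<forall>i. 1 \<le> i \<and> i < N \<longrightarrow> (\<forall>T\<in>std_tableaux lam. \<rho> (s_gen N i) T =
          fscale (inv_axial T i) (bas T) +
          (if tswap i T \<in> std_tableaux lam
           then fscale (1 + inv_axial T i) (bas (tswap i T)) else 0))))"

definition S_sub :: "'k::field \<Rightarrow> nat \<Rightarrow> mpart \<Rightarrow> nat \<Rightarrow> nat \<Rightarrow> (tableau \<Rightarrow> 'k) set" where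
  "S_sub \<xi> d lam t r = {x \<in> span_on (std_tableaux lam).
     ((lin_ext (\<lambda>T. bas (sigma d T))) ^^ t) x = fscale (\<xi> ^ (d * t * r)) x}"


section \<open>Standard modules\<close>

text \<open>
  An \<open>(m,n,l)\<close>-dangle is the diagram with \<open>n\<close> northern and \<open>n - 2l\<close> southern nodes
  whose through-strands are the free lines, unlabelled meaning label 0.
\<close>

definition dangles :: "nat \<Rightarrow> nat \<Rightarrow> nat \<Rightarrow> diagram set" where
  "dangles m n l = {v \<in> diagrams m n (n - 2 * l).
     card (north_arcs v) = l \<and> south_arcs v = {} \<and>
     (\<forall>s\<in>through_strands v. snd s = 0) \<and>
     (\<forall>i j i' j'. ({North i, South j}, 0) \<in> v \<and> ({North i', South j'}, 0) \<in> v \<and> i < i'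
        \<longrightarrow> j < j')}"

text \<open>
  A concatenation of a diagram and a dangle, with still only \<open>l\<close> northern arcs, is uniquely
  a dangle with a group element placed below it.
\<close>

definition dangle_split :: "nat \<Rightarrow> nat \<Rightarrow> nat \<Rightarrow> diagram \<Rightarrow> diagram \<times> diagram" where
  "dangle_split m n l D = (THE (v, w). v \<in> dangles m n l \<and> w \<in> Ggrp m 1 (n - 2 * l) \<and>
                             compose m v w = D)"

definition Delta_bar ::
    "nat \<Rightarrow> nat \<Rightarrow> (nat \<Rightarrow> 'k::field) \<Rightarrow> nat \<Rightarrow> nat \<Rightarrow> mpart \<Rightarrow>
     (diagram \<Rightarrow> tableau \<Rightarrow> tableau \<Rightarrow> 'k) \<Rightarrow>
     (diagram \<Rightarrow> 'k, 'k, diagram \<times> tableau \<Rightarrow> 'k) amod" where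
  "Delta_bar m p \<delta> n l lam \<rho> =
     \<lparr> vecs = span_on (dangles m n l \<times> std_tableaux lam),
       vadd = (+), vscale = fscale,
       vact = (\<lambda>b y. lin_ext (\<lambda>X. lin_ext (\<lambda>(v, T).
         if l < card (north_arcs (compose m X v)) then 0
         else (case dangle_split m n l (compose m X v) of (v', w) \<Rightarrow>
                 fscale (loop_coeff m p \<delta> X v) (tensor (bas v') (\<rho> w T)))) y) b) \<rparr>"

definition sigma_Delta ::
    "'k::field \<Rightarrow> nat \<Rightarrow> (diagram \<times> tableau \<Rightarrow> 'k) \<Rightarrow> diagram \<times> tableau \<Rightarrow> 'k" where
  "sigma_Delta \<xi> d =
     lin_ext (\<lambda>(v, T). fscale (\<xi> ^ (d * label_sum v)) (bas (v, sigma d T)))"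

definition Ker_mod ::
    "'k::field \<Rightarrow> nat \<Rightarrow> nat \<Rightarrow> nat \<Rightarrow> (diagram \<Rightarrow> 'k, 'k, diagram \<times> tableau \<Rightarrow> 'k) amod \<Rightarrow>
     (diagram \<Rightarrow> 'k, 'k, diagram \<times> tableau \<Rightarrow> 'k) amod" where
  "Ker_mod \<xi> d t r M =
     M \<lparr> vecs := {y \<in> vecs M. (sigma_Delta \<xi> d ^^ t) y = fscale (\<xi> ^ (d * t * r)) y} \<rparr>"

subsection \<open>Standard modules for \<open>n - 2l \<ge> 1\<close>\<close>

definition M_basis :: "nat \<Rightarrow> nat \<Rightarrow> nat \<Rightarrow> nat \<Rightarrow> diagram set" where
  "M_basis m p n l = {D \<in> diagrams m n (n - 2 * l).
     card (north_arcs D) = l \<and> card (through_strands D) = n - 2 * l \<and> p dvd label_sum D}"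

text \<open>
  The tensor product of \<open>M\<^sub>l\<close> and \<open>S\<close> over \<open>k\<close> is the space of those functions on pairs
  (diagram, tableau) all of whose sections in the tableau lie in \<open>S\<close>.
  The tensor product over the group algebra is the quotient by the subspace \<open>M_rel\<close>,
  whose elements are cosets.
\<close>

definition M_tensor :: "diagram set \<Rightarrow> mpart \<Rightarrow> (tableau \<Rightarrow> 'k::field) set \<Rightarrow>
    (diagram \<times> tableau \<Rightarrow> 'k) set" where
  "M_tensor MB lam S = {f \<in> span_on (MB \<times> std_tableaux lam). \<forall>D. (\<lambda>T. f (D, T)) \<in> S}"

definition M_rel :: "nat \<Rightarrow> diagram set \<Rightarrow> diagram set \<Rightarrow> (tableau \<Rightarrow> 'k::field) set \<Rightarrow>
    (diagram \<Rightarrow> tableau \<Rightarrow> tableau \<Rightarrow> 'k) \<Rightarrow> (diagram \<times> tableau \<Rightarrow> 'k) set" where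
  "M_rel m MB G S \<rho> = fspace.span
     {tensor (bas (compose m D g)) x - tensor (bas D) (lin_ext (\<rho> g) x) | D g x.
        D \<in> MB \<and> g \<in> G \<and> x \<in> S}"

definition M_act :: "nat \<Rightarrow> nat \<Rightarrow> (nat \<Rightarrow> 'k::field) \<Rightarrow> nat \<Rightarrow> (diagram \<Rightarrow> 'k) \<Rightarrow>
    (diagram \<times> tableau \<Rightarrow> 'k) \<Rightarrow> diagram \<times> tableau \<Rightarrow> 'k" where
  "M_act m p \<delta> N b f = lin_ext (\<lambda>X. lin_ext (\<lambda>(D, T).
     if card (through_strands (compose m X D)) < N then 0
     else fscale (loop_coeff m p \<delta> X D) (bas (compose m X D, T))) f) b"

text \<open>
  The summand \<open>R\<close> in \<open>vscale\<close> and \<open>vact\<close> makes the images of a coset of \<open>R\<close> a coset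
  again, also when the map is not surjective.
\<close>

definition Delta ::
    "nat \<Rightarrow> nat \<Rightarrow> nat \<Rightarrow> 'k::field \<Rightarrow> (nat \<Rightarrow> 'k) \<Rightarrow> nat \<Rightarrow> nat \<Rightarrow> mpart \<Rightarrow>
     (diagram \<Rightarrow> tableau \<Rightarrow> tableau \<Rightarrow> 'k) \<Rightarrow> nat \<Rightarrow> nat \<Rightarrow>
     (diagram \<Rightarrow> 'k, 'k, (diagram \<times> tableau \<Rightarrow> 'k) set) amod" where
  "Delta m p d \<xi> \<delta> n l lam \<rho> t r =
     (let MB = M_basis m p n l;
          S = S_sub \<xi> d lam t r;
          R = M_rel m MB (Ggrp m p (n - 2 * l)) S \<rho>
      in \<lparr> vecs = {f +o R | f. f \<in> M_tensor MB lam S},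
           vadd = (+),
           vscale = (\<lambda>c C. fscale c ` C + R),
           vact = (\<lambda>b C. M_act m p \<delta> (n - 2 * l) b ` C + R) \<rparr>)"

subsection \<open>Standard modules for \<open>n = 2l\<close>\<close>

definition Delta_empty ::
    "nat \<Rightarrow> nat \<Rightarrow> (nat \<Rightarrow> 'k::field) \<Rightarrow> nat \<Rightarrow> nat \<Rightarrow> nat \<Rightarrow>
     (diagram \<Rightarrow> 'k, 'k, diagram \<Rightarrow> 'k) amod" where
  "Delta_empty m p \<delta> n l r =
     \<lparr> vecs = span_on {v \<in> dangles m n l. label_sum v mod p = r mod p},
       vadd = (+), vscale = fscale,
       vact = (\<lambda>b y. lin_ext (\<lambda>X. lin_ext (\<lambda>v.
         fscale (loop_coeff m p \<delta> X v) (bas (compose m X v))) y) b) \<rparr>"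

end

theory Submission
  imports Defs "HOL-Combinatorics.Permutations"
begin

text \<open>
  Let \<open>k = dt\<close>. Rotation of tableaux by \<open>k\<close> intertwines the \<open>G(m,1,N)\<close>-module with its twist by the
  character \<open>g \<mapsto> \<xi>\<^sup>k\<^sup>|\<^sup>g\<^sup>|\<close>, where \<open>|g|\<close> is the label sum; the factor \<open>\<xi>\<^sup>d\<^sup>q\<close> in the definition of
  \<open>\<sigma>\<close> on dangles compensates for this, because concatenation adds label sums modulo \<open>p\<close> unless
  a loop makes the product vanish. So \<open>\<sigma>\<^sup>t\<close> commutes with \<open>B\<^bsub>m,p,n\<^esub>\<close>, has order dividing \<open>p/t\<close>, and the
  restricted module is the direct sum of its eigenspaces.
  A diagram with \<open>N\<close> through-strands is uniquely \<open>D = v w\<close> with a dangle \<open>v\<close> and a group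
  element \<open>w\<close>, and \<open>D \<otimes> x \<mapsto> v \<otimes> w x\<close> maps \<open>M\<^sub>l \<otimes> S(\<lambda>\<^sup>r)\<close> onto the eigenspace. An inverse modulo the
  tensor relations sends \<open>v \<otimes> x\<close> to \<open>v u \<otimes> u\<inverse> x\<close>, where \<open>u\<close> is any group element with
  \<open>|u| = -|v|\<close>; such a \<open>u\<close> exists when there is a free line.
\<close>

section \<open>Free vector spaces and modules\<close>

text \<open>Associativity of concatenation enters only with a group element as the lowest factor.
  There no path has to be followed: such a factor permutes the bottom row and adds labels along it,
  so the glued graph is transported along a bijection of its vertices. All operators live on one
  space, spanned by the pairs of a diagram with n - 2l through-strands, of arbitrary label sum, and
  a tableau. It contains both the dangles and the basis of M_l. The B_{m,1,n}-module is its image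
  under the map from \<open>D\<close> and \<open>x\<close> to \<open>v\<close> and
  \<open>w x\<close>, and acts by concatenation followed by that map; so comparing the two kinds of
  standard modules means checking that concatenation and \<sigma> descend along this one map. Label
  sums survive concatenation only modulo p. This suffices because \<omega> =
  \<open>\<xi> ^ (d * t)\<close> satisfies \<omega>^p = 1. For n = 2l there is no strand on which a
  label could be corrected. But then the multipartition is empty and fixed by every rotation, so t =
  1, and \<sigma> is diagonal on dangles, with eigenvalues that separate the label sums modulo
  p.\<close>

lemma span_onI: "(\<And>x. x \<notin> X \<Longrightarrow> f x = 0) \<Longrightarrow> f \<in> span_on X"
  by (auto simp: span_on_def)

lemma span_onD: "f \<in> span_on X \<Longrightarrow> x \<notin> X \<Longrightarrow> f x = 0"
  by (auto simp: span_on_def)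

lemma span_on_zero [simp]: "0 \<in> span_on X"
  by (auto simp: span_on_def)

lemma span_on_add: "f \<in> span_on X \<Longrightarrow> g \<in> span_on X \<Longrightarrow> f + g \<in> span_on X"
  by (auto simp: span_on_def)

lemma span_on_diff: "f \<in> span_on X \<Longrightarrow> g \<in> span_on X \<Longrightarrow> f - g \<in> span_on X"
  by (auto simp: span_on_def)

lemma span_on_fscale: "f \<in> span_on X \<Longrightarrow> fscale c f \<in> span_on X"
  by (auto simp: span_on_def fscale_def)

lemma span_on_mono: "f \<in> span_on X \<Longrightarrow> X \<subseteq> Y \<Longrightarrow> f \<in> span_on Y"
  by (auto simp: span_on_def)

lemma span_on_sum: "(\<And>i. i \<in> I \<Longrightarrow> f i \<in> span_on X) \<Longrightarrow> (\<Sum>i\<in>I. f i) \<in> span_on X"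
  by (induction I rule: infinite_finite_induct) (auto intro: span_on_add)

lemma bas_in_span_on: "x \<in> X \<Longrightarrow> bas x \<in> span_on X"
  by (auto simp: span_on_def bas_def)

lemma bas_in_span_on_iff [simp]: "bas x \<in> span_on X \<longleftrightarrow> x \<in> X"
  by (auto simp: span_on_def bas_def)

lemma tensor_in_span_on:
  "f \<in> span_on X \<Longrightarrow> g \<in> span_on Y \<Longrightarrow> tensor f g \<in> span_on (X \<times> Y)"
  by (auto simp: span_on_def tensor_def)

lemma sum_fun_apply: "(\<Sum>i\<in>I. f i) x = (\<Sum>i\<in>I. f i x)"
  for f :: "'i \<Rightarrow> 'a \<Rightarrow> 'b :: comm_monoid_add"
  by (induction I rule: infinite_finite_induct) auto

lemma fscale_sum: "fscale c (\<Sum>i\<in>I. f i) = (\<Sum>i\<in>I. fscale c (f i))"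
  by (rule ext) (simp add: fscale_def sum_fun_apply sum_distrib_left)

lemma fscale_one [simp]: "fscale 1 f = f"
  by (simp add: fscale_def)

lemma fscale_0 [simp]: "fscale 0 f = 0" "fscale c 0 = 0"
  by (simp_all add: fscale_def fun_eq_iff)

lemma fscale_add: "fscale c (f + g) = fscale c f + fscale c g"
  by (simp add: fscale_def fun_eq_iff algebra_simps)

lemma fscale_diff: "fscale c (f - g) = fscale c f - fscale c g"
  by (simp add: fscale_def fun_eq_iff algebra_simps)

lemma tensor_fscale: "tensor f (fscale c g) = fscale c (tensor f g)"
  by (auto simp: tensor_def fscale_def fun_eq_iff algebra_simps)

lemma tensor_bas_bas: "tensor (bas x) (bas y) = bas (x, y)"
  by (auto simp: tensor_def bas_def fun_eq_iff)

text \<open>The support in the definition of \<open>lin_ext\<close> varies with the vector. Summing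
  over a fixed finite set instead reduces linearity to rules for finite sums.\<close>

lemma lin_ext_eq_sum:
  assumes "finite A" "v \<in> span_on A"
  shows "lin_ext f v = (\<Sum>x\<in>A. fscale (v x) (f x))"
proof (rule ext)
  fix y
  have "(\<Sum>x | v x \<noteq> 0. v x * f x y) = (\<Sum>x\<in>A. v x * f x y)"
    using assms by (intro sum.mono_neutral_left) (auto simp: span_on_def)
  then show "lin_ext f v y = (\<Sum>x\<in>A. fscale (v x) (f x)) y"
    by (simp add: lin_ext_def fscale_def sum_fun_apply)
qed

lemma lin_ext_apply:
  assumes "finite A" "v \<in> span_on A"
  shows "lin_ext f v y = (\<Sum>x\<in>A. v x * f x y)"
  by (simp add: lin_ext_eq_sum[OF assms] sum_fun_apply fscale_def)

lemma lin_ext_cong: "v \<in> span_on A \<Longrightarrow> (\<And>x. x \<in> A \<Longrightarrow> f x = g x) \<Longrightarrow> lin_ext f v = lin_ext g v"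
  unfolding lin_ext_def by (rule ext, rule sum.cong) (auto, metis span_onD)

lemma lin_ext_bas [simp]: "lin_ext f (bas x) = f x"
proof -
  have "lin_ext f (bas x) = fscale (bas x x) (f x)"
    by (subst lin_ext_eq_sum[of "{x}"]) simp_all
  then show ?thesis by (simp add: bas_def)
qed

lemma lin_ext_zero [simp]: "lin_ext f 0 = 0"
  by (subst lin_ext_eq_sum[of "{}"]) auto

text \<open>Sums over infinite sets are 0 by convention, so additivity is stated for two vectors
  carried by a common finite set.\<close>

lemma lin_ext_add:
  assumes "finite A" "v \<in> span_on A" "w \<in> span_on A"
  shows "lin_ext f (v + w) = lin_ext f v + lin_ext f w"
  using assms
  by (simp add: lin_ext_eq_sum[OF assms(1)] span_on_add sum.distrib fspace.scale_left_distrib)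

lemma lin_ext_diff:
  assumes "finite A" "v \<in> span_on A" "w \<in> span_on A"
  shows "lin_ext f (v - w) = lin_ext f v - lin_ext f w"
  using assms
  by (simp add: lin_ext_eq_sum[OF assms(1)] span_on_diff sum_subtractf fspace.scale_left_diff_distrib)

lemma lin_ext_fscale: "lin_ext f (fscale c v) = fscale c (lin_ext f v)"
proof (cases "c = 0")
  \<comment> \<open>For nonzero \<open>c\<close> the supports of \<open>v\<close> and
    \<open>c v\<close> agree, whether finite or not; for \<open>c = 0\<close> the support
    collapses.\<close>
  case False
  then show ?thesis
    by (simp add: lin_ext_def fscale_def fun_eq_iff sum_distrib_left mult.assoc)
qed auto

lemma lin_ext_sum:
  assumes "finite A" "\<And>i. i \<in> I \<Longrightarrow> v i \<in> span_on A"
  shows "lin_ext f (\<Sum>i\<in>I. v i) = (\<Sum>i\<in>I. lin_ext f (v i))"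
  using assms(2)
proof (induction I rule: infinite_finite_induct)
  case (insert x F)
  then have "lin_ext f (v x + (\<Sum>i\<in>F. v i)) = lin_ext f (v x) + (\<Sum>i\<in>F. lin_ext f (v i))"
    by (subst lin_ext_add[OF assms(1)]) (auto simp: span_on_sum)
  then show ?case
    unfolding sum.insert[OF insert(1,2)] .
qed auto

lemma lin_ext_in_span_on:
  assumes "v \<in> span_on A" "\<And>x. x \<in> A \<Longrightarrow> f x \<in> span_on B"
  shows "lin_ext f v \<in> span_on B"
proof (rule span_onI)
  fix y assume "y \<notin> B"
  then have "f x y = 0" if "v x \<noteq> 0" for x
    using that assms by (meson span_onD)
  then show "lin_ext f v y = 0"
    by (simp add: lin_ext_def)
qed

text \<open>Composites of linear extensions are determined on basis vectors. The finite set
  \<open>B\<close> carries all intermediate values, which makes the outer map additive on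
  them.\<close>

lemma lin_ext_lin_ext:
  assumes "finite A" "v \<in> span_on A" "finite B" "\<And>x. x \<in> A \<Longrightarrow> g x \<in> span_on B"
  shows "lin_ext f (lin_ext g v) = lin_ext (\<lambda>x. lin_ext f (g x)) v"
proof -
  have "lin_ext f (lin_ext g v) = lin_ext f (\<Sum>x\<in>A. fscale (v x) (g x))"
    by (simp add: lin_ext_eq_sum[OF assms(1,2)])
  also have "\<dots> = (\<Sum>x\<in>A. lin_ext f (fscale (v x) (g x)))"
    using assms(3,4) by (intro lin_ext_sum) (auto intro: span_on_fscale)
  also have "\<dots> = lin_ext (\<lambda>x. lin_ext f (g x)) v"
    by (simp add: lin_ext_eq_sum[OF assms(1,2)] lin_ext_fscale)
  finally show ?thesis .
qed

lemma lin_ext_bas_id: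
  assumes "finite A" "v \<in> span_on A"
  shows "lin_ext bas v = v"
proof (rule ext)
  fix y
  have "(\<Sum>x\<in>A. v x * bas x y) = (if y \<in> A then v y else 0)"
    using assms(1) by (simp add: bas_def sum.delta if_distrib[of "(*) _"] cong: if_cong)
  then show "lin_ext bas v y = v y"
    using assms by (auto simp: lin_ext_apply[OF assms] span_onD)
qed

text \<open>Evaluates an operator on a pure tensor with a single diagram on the left, the shape to
  which all later verifications are reduced.\<close>

lemma lin_ext_tensor_bas:
  assumes "finite B" "x \<in> span_on B"
  shows "lin_ext f (tensor (bas D) x) = lin_ext (\<lambda>T. f (D, T)) x"
proof -
  have "tensor (bas D) x = lin_ext (\<lambda>T. bas (D, T)) x"
  proof -
    have "tensor (bas D) (lin_ext bas x) = lin_ext (\<lambda>T. bas (D, T)) x"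
      unfolding tensor_def lin_ext_apply[OF assms] fun_eq_iff
      by (auto simp: bas_def sum_distrib_left intro!: sum.cong)
    then show ?thesis by (simp add: lin_ext_bas_id[OF assms])
  qed
  moreover have "lin_ext f (lin_ext (\<lambda>T. bas (D, T)) x) = lin_ext (\<lambda>T. lin_ext f (bas (D, T))) x"
    by (rule lin_ext_lin_ext[OF assms, of "{D} \<times> B"]) (use assms in auto)
  ultimately show ?thesis by simp
qed

lemma lin_ext_tensor:
  assumes "finite A" "x \<in> span_on A"
  shows "lin_ext (\<lambda>T. tensor f (g T)) x = tensor f (lin_ext g x)"
  unfolding fun_eq_iff
  by (auto simp: tensor_def lin_ext_apply[OF assms] sum_distrib_left mult.left_commute intro!: sum.cong)

lemma tensor_decompose:
  assumes "finite A" "finite B" "f \<in> span_on (A \<times> B)"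
  shows "f = (\<Sum>D\<in>A. tensor (bas D) (\<lambda>T. f (D, T)))"
proof (rule ext, clarify)
  fix D T
  have "(\<Sum>D'\<in>A. bas D' D * f (D', T)) = (\<Sum>D'\<in>A. if D' = D then f (D, T) else 0)"
    by (rule sum.cong) (auto simp: bas_def)
  also have "\<dots> = f (D, T)"
    using assms by (auto simp: span_onD)
  finally show "f (D, T) = (\<Sum>D\<in>A. tensor (bas D) (\<lambda>T. f (D, T))) (D, T)"
    by (simp add: sum_fun_apply tensor_def)
qed

section \<open>Isomorphisms and direct sums of modules\<close>

lemma mod_iso_sym:
  assumes "mod_iso R M M'" shows "mod_iso R M' M"
proof -
  from assms obtain \<phi> where cl: "mod_closed R M" "mod_closed R M'"
    and bij: "bij_betw \<phi> (vecs M) (vecs M')"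
    and add: "\<forall>x\<in>vecs M. \<forall>y\<in>vecs M. \<phi> (vadd M x y) = vadd M' (\<phi> x) (\<phi> y)"
    and scale: "\<forall>c. \<forall>x\<in>vecs M. \<phi> (vscale M c x) = vscale M' c (\<phi> x)"
    and act: "\<forall>b\<in>carrier R. \<forall>x\<in>vecs M. \<phi> (vact M b x) = vact M' b (\<phi> x)"
    by (auto simp: mod_iso_def)
  define \<psi> where "\<psi> = inv_into (vecs M) \<phi>"
  have bij': "bij_betw \<psi> (vecs M') (vecs M)"
    unfolding \<psi>_def by (rule bij_betw_inv_into[OF bij])
  have inM: "\<psi> x \<in> vecs M" if "x \<in> vecs M'" for x
    using bij' that by (auto simp: bij_betw_def)
  have right: "\<phi> (\<psi> x) = x" if "x \<in> vecs M'" for x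
    unfolding \<psi>_def using bij that by (simp add: bij_betw_inv_into_right)
  have left: "\<psi> (\<phi> x) = x" if "x \<in> vecs M" for x
    unfolding \<psi>_def using bij that by (simp add: bij_betw_inv_into_left)
  have "\<psi> (vadd M' x y) = vadd M (\<psi> x) (\<psi> y)" if "x \<in> vecs M'" "y \<in> vecs M'" for x y
  proof -
    have "\<phi> (vadd M (\<psi> x) (\<psi> y)) = vadd M' x y"
      using add that by (simp add: inM right)
    \<comment> \<open>Closedness puts the result back into the set on which the inverse is known to
      undo \<phi>.\<close>
    moreover have "vadd M (\<psi> x) (\<psi> y) \<in> vecs M"
      using cl(1) that inM by (auto simp: mod_closed_def)
    ultimately show ?thesis using left by metis
  qed
  moreover have "\<psi> (vscale M' c x) = vscale M c (\<psi> x)" if "x \<in> vecs M'" for x c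
  proof -
    have "\<phi> (vscale M c (\<psi> x)) = vscale M' c x"
      using scale that by (simp add: inM right)
    moreover have "vscale M c (\<psi> x) \<in> vecs M"
      using cl(1) that inM by (auto simp: mod_closed_def)
    ultimately show ?thesis using left by metis
  qed
  moreover have "\<psi> (vact M' b x) = vact M b (\<psi> x)" if "x \<in> vecs M'" "b \<in> carrier R" for x b
  proof -
    have "\<phi> (vact M b (\<psi> x)) = vact M' b x"
      using act that by (simp add: inM right)
    moreover have "vact M b (\<psi> x) \<in> vecs M"
      using cl(1) that inM by (auto simp: mod_closed_def)
    ultimately show ?thesis using left by metis
  qed
  ultimately show ?thesis
    using cl bij' by (auto simp: mod_iso_def)
qed

lemma mod_iso_trans:
  assumes "mod_iso R M M'" "mod_iso R M' M''" shows "mod_iso R M M''"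
proof -
  from assms(1) obtain \<phi> where 1: "mod_closed R M"
    "bij_betw \<phi> (vecs M) (vecs M')"
    "\<forall>x\<in>vecs M. \<forall>y\<in>vecs M. \<phi> (vadd M x y) = vadd M' (\<phi> x) (\<phi> y)"
    "\<forall>c. \<forall>x\<in>vecs M. \<phi> (vscale M c x) = vscale M' c (\<phi> x)"
    "\<forall>b\<in>carrier R. \<forall>x\<in>vecs M. \<phi> (vact M b x) = vact M' b (\<phi> x)"
    by (auto simp: mod_iso_def)
  from assms(2) obtain \<psi> where 2: "mod_closed R M''"
    "bij_betw \<psi> (vecs M') (vecs M'')"
    "\<forall>x\<in>vecs M'. \<forall>y\<in>vecs M'. \<psi> (vadd M' x y) = vadd M'' (\<psi> x) (\<psi> y)"
    "\<forall>c. \<forall>x\<in>vecs M'. \<psi> (vscale M' c x) = vscale M'' c (\<psi> x)"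
    "\<forall>b\<in>carrier R. \<forall>x\<in>vecs M'. \<psi> (vact M' b x) = vact M'' b (\<psi> x)"
    by (auto simp: mod_iso_def)
  have "\<phi> x \<in> vecs M'" if "x \<in> vecs M" for x
    using 1(2) that by (auto simp: bij_betw_def)
  then show ?thesis
    unfolding mod_iso_def using 1 2 bij_betw_trans[OF 1(2) 2(2)]
    by (intro conjI exI[of _ "\<psi> \<circ> \<phi>"]) auto
qed

lemma mod_closed_mod_sum:
  assumes "\<And>r. r < q \<Longrightarrow> mod_closed R (M r)"
  shows "mod_closed R (mod_sum q M)"
proof -
  have "\<forall>r\<in>{..<q}. vecs (M r) \<noteq> {}"
    using assms by (auto simp: mod_closed_def)
  then have "(\<Pi>\<^sub>E r\<in>{..<q}. vecs (M r)) \<noteq> {}"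
    by (simp add: PiE_eq_empty_iff)
  then show ?thesis
    using assms by (auto simp: mod_closed_def mod_sum_def PiE_iff)
qed

lemma mod_iso_mod_sum:
  assumes "\<And>r. r < q \<Longrightarrow> mod_iso R (M r) (M' r)"
  shows "mod_iso R (mod_sum q M) (mod_sum q M')"
proof -
  have "\<forall>r\<in>{..<q}. \<exists>\<phi>. bij_betw \<phi> (vecs (M r)) (vecs (M' r)) \<and>
       (\<forall>x\<in>vecs (M r). \<forall>y\<in>vecs (M r). \<phi> (vadd (M r) x y) = vadd (M' r) (\<phi> x) (\<phi> y)) \<and>
       (\<forall>c. \<forall>x\<in>vecs (M r). \<phi> (vscale (M r) c x) = vscale (M' r) c (\<phi> x)) \<and>
       (\<forall>b\<in>carrier R. \<forall>x\<in>vecs (M r). \<phi> (vact (M r) b x) = vact (M' r) b (\<phi> x))"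
    using assms by (auto simp: mod_iso_def)
  then obtain \<phi> where \<phi>: "\<forall>r\<in>{..<q}. bij_betw (\<phi> r) (vecs (M r)) (vecs (M' r)) \<and>
       (\<forall>x\<in>vecs (M r). \<forall>y\<in>vecs (M r). \<phi> r (vadd (M r) x y) = vadd (M' r) (\<phi> r x) (\<phi> r y)) \<and>
       (\<forall>c. \<forall>x\<in>vecs (M r). \<phi> r (vscale (M r) c x) = vscale (M' r) c (\<phi> r x)) \<and>
       (\<forall>b\<in>carrier R. \<forall>x\<in>vecs (M r). \<phi> r (vact (M r) b x) = vact (M' r) b (\<phi> r x))"
    by (rule bchoice[THEN exE]) blast
  \<comment> \<open>Vectors of a direct sum are extensional functions, so the componentwise map is
    restricted to the index set.\<close>
  define \<Phi> where "\<Phi> = (\<lambda>x. \<lambda>r\<in>{..<q}. \<phi> r (x r))"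
  have im: "\<phi> r x \<in> vecs (M' r)" if "r < q" "x \<in> vecs (M r)" for r x
    using \<phi> that by (fastforce simp: bij_betw_def)
  have "bij_betw \<Phi> (vecs (mod_sum q M)) (vecs (mod_sum q M'))"
  proof (rule bij_betwI)
    let ?g = "\<lambda>y. \<lambda>r\<in>{..<q}. inv_into (vecs (M r)) (\<phi> r) (y r)"
    show "\<Phi> \<in> vecs (mod_sum q M) \<rightarrow> vecs (mod_sum q M')"
      using im by (auto simp: mod_sum_def \<Phi>_def PiE_iff)
    show "?g \<in> vecs (mod_sum q M') \<rightarrow> vecs (mod_sum q M)"
      using \<phi> by (auto simp: mod_sum_def PiE_iff intro!: inv_into_into simp: bij_betw_def)
    have left: "inv_into (vecs (M r)) (\<phi> r) (\<phi> r y) = y" if "r < q" "y \<in> vecs (M r)" for r y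
      using \<phi> that by (auto intro: bij_betw_inv_into_left)
    have right: "\<phi> r (inv_into (vecs (M r)) (\<phi> r) y) = y" if "r < q" "y \<in> vecs (M' r)" for r y
      using \<phi> that by (auto intro: bij_betw_inv_into_right)
    show "?g (\<Phi> x) = x" if "x \<in> vecs (mod_sum q M)" for x
      using that by (intro ext) (auto simp: mod_sum_def \<Phi>_def PiE_iff left extensional_def restrict_def)
    show "\<Phi> (?g y) = y" if "y \<in> vecs (mod_sum q M')" for y
      using that by (intro ext) (auto simp: mod_sum_def \<Phi>_def PiE_iff right extensional_def restrict_def)
  qed
  moreover have "mod_closed R (mod_sum q M)" "mod_closed R (mod_sum q M')"
    using assms by (auto intro!: mod_closed_mod_sum simp: mod_iso_def)
  ultimately show ?thesis
    unfolding mod_iso_def using \<phi>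
    by (intro conjI exI[of _ \<Phi>])
       (auto simp: \<Phi>_def mod_sum_def PiE_iff fun_eq_iff restrict_def)
qed

section \<open>Eigenspaces of an operator of finite order\<close>

lemma sum_powers_root_of_unity:
  fixes \<omega> :: "'k :: field_char_0"
  assumes "\<omega> ^ q = 1" "\<And>j. 0 < j \<Longrightarrow> j < q \<Longrightarrow> \<omega> ^ j \<noteq> 1" "j < q"
  shows "(\<Sum>r<q. (\<omega> ^ j) ^ r) = (if j = 0 then of_nat q else 0)"
proof (cases "j = 0")
  case False
  then have ne: "\<omega> ^ j \<noteq> 1" using assms by auto
  have "(\<omega> ^ j) ^ q = 1"
    by (metis assms(1) mult.commute power_mult power_one)
  then show ?thesis using ne False by (simp add: geometric_sum)
qed simp

text \<open>An operator of order \<open>q\<close> splits a module into its eigenspaces: the projections are the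
  averages \<open>q\<inverse> \<Sum>\<^sub>j \<omega>\<^sup>-\<^sup>r\<^sup>j A\<^sup>j\<close>.\<close>

lemma mod_iso_eigenspaces:
  fixes \<omega> :: "'k :: field_char_0" and M :: "('a, 'k, 'x \<Rightarrow> 'k) amod"
  assumes q: "0 < q" and \<omega>: "\<omega> ^ q = 1" "\<And>j. 0 < j \<Longrightarrow> j < q \<Longrightarrow> \<omega> ^ j \<noteq> 1"
    and M: "mod_closed R M" "vadd M = (+)" "vscale M = fscale"
    and A: "\<And>y. y \<in> vecs M \<Longrightarrow> A y \<in> vecs M"
    and Aadd: "\<And>x y. x \<in> vecs M \<Longrightarrow> y \<in> vecs M \<Longrightarrow> A (x + y) = A x + A y"
    and Ascale: "\<And>c y. y \<in> vecs M \<Longrightarrow> A (fscale c y) = fscale c (A y)"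
    and Aq: "\<And>y. y \<in> vecs M \<Longrightarrow> (A ^^ q) y = y"
    and actadd: "\<And>b x y. b \<in> carrier R \<Longrightarrow> x \<in> vecs M \<Longrightarrow> y \<in> vecs M \<Longrightarrow>
       vact M b (x + y) = vact M b x + vact M b y"
    and actscale: "\<And>b c y. b \<in> carrier R \<Longrightarrow> y \<in> vecs M \<Longrightarrow>
       vact M b (fscale c y) = fscale c (vact M b y)"
    and Aact: "\<And>b y. b \<in> carrier R \<Longrightarrow> y \<in> vecs M \<Longrightarrow> A (vact M b y) = vact M b (A y)"
  defines "K \<equiv> \<lambda>r. M \<lparr> vecs := {y \<in> vecs M. A y = fscale (\<omega> ^ r) y} \<rparr>"
  shows "mod_iso R M (mod_sum q K)" "\<And>r. mod_closed R (K r)"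
proof -
  have add: "x + y \<in> vecs M" if "x \<in> vecs M" "y \<in> vecs M" for x y
    using M that by (auto simp: mod_closed_def)
  have scale: "fscale c x \<in> vecs M" if "x \<in> vecs M" for x c
    using M that by (auto simp: mod_closed_def)
  have act: "vact M b x \<in> vecs M" if "x \<in> vecs M" "b \<in> carrier R" for x b
    using M that by (auto simp: mod_closed_def)
  have zero: "0 \<in> vecs M"
  proof -
    obtain x where "x \<in> vecs M" using M by (auto simp: mod_closed_def)
    from scale[OF this, of 0] show ?thesis by simp
  qed
  have A0: "A 0 = 0" using Ascale[OF zero, of 0] by simp
  have act0: "vact M b 0 = 0" if "b \<in> carrier R" for b using actscale[OF that zero, of 0] by simp
  have sum: "(\<Sum>i\<in>I. f i) \<in> vecs M" if "\<And>i. i \<in> I \<Longrightarrow> f i \<in> vecs M" for I :: "nat set" and f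
    using that by (induction I rule: infinite_finite_induct) (auto simp: zero intro!: add)
  have Asum: "A (\<Sum>i\<in>I. f i) = (\<Sum>i\<in>I. A (f i))" if "\<And>i. i \<in> I \<Longrightarrow> f i \<in> vecs M"
    for I :: "nat set" and f
    using that by (induction I rule: infinite_finite_induct) (auto simp: A0 Aadd sum)
  have actsum: "vact M b (\<Sum>i\<in>I. f i) = (\<Sum>i\<in>I. vact M b (f i))"
    if "\<And>i. i \<in> I \<Longrightarrow> f i \<in> vecs M" "b \<in> carrier R" for I :: "nat set" and f b
    using that by (induction I rule: infinite_finite_induct) (auto simp: act0 actadd sum)
  have Aj: "(A ^^ j) y \<in> vecs M" if "y \<in> vecs M" for j y
    using that by (induction j) (auto intro: A)
  have Ajadd: "(A ^^ j) (x + y) = (A ^^ j) x + (A ^^ j) y" if "x \<in> vecs M" "y \<in> vecs M" for j x y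
    using that by (induction j) (auto simp: Aadd Aj)
  have Ajscale: "(A ^^ j) (fscale c y) = fscale c ((A ^^ j) y)" if "y \<in> vecs M" for j c y
    using that by (induction j) (auto simp: Ascale Aj)
  have Ajact: "(A ^^ j) (vact M b y) = vact M b ((A ^^ j) y)"
    if "y \<in> vecs M" "b \<in> carrier R" for j b y
    using that by (induction j) (auto simp: Aact Aj)
  have \<omega>0: "\<omega> \<noteq> 0" using \<omega>(1) q by (metis power_0_left zero_neq_one less_numeral_extra(3))
  define P where "P = (\<lambda>r y. fscale (1 / of_nat q) (\<Sum>j<q. fscale (inverse \<omega> ^ (r * j)) ((A ^^ j) y)))"
  show clK: "mod_closed R (K r)" for r
    unfolding mod_closed_def
    by (auto simp: K_def M add scale act Aadd Ascale Aact actscale fscale_add mult.commute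
             intro!: exI[of _ 0] zero A0)
  have vecsK: "vecs (K r) = {y \<in> vecs M. A y = fscale (\<omega> ^ r) y}" for r
    by (simp add: K_def)
  have PM: "P r y \<in> vecs M" if "y \<in> vecs M" for r y
    unfolding P_def using that by (intro scale sum Aj)
  have PK: "P r y \<in> vecs (K r)" if y: "y \<in> vecs M" for r y
  proof -
    let ?g = "\<lambda>j. fscale (inverse \<omega> ^ (r * j)) ((A ^^ j) y)"
    have "A (P r y) = fscale (1 / of_nat q) (\<Sum>j<q. A (?g j))"
      unfolding P_def using y by (simp add: Ascale Asum sum scale Aj)
    also have "(\<Sum>j<q. A (?g j)) = (\<Sum>j<q. fscale (\<omega> ^ r) (?g (Suc j)))"
    proof (rule sum.cong[OF refl])
      fix j
      have "\<omega> ^ r * inverse \<omega> ^ (r * Suc j) = inverse \<omega> ^ (r * j)"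
        using \<omega>0 by (simp add: power_add field_simps power_inverse)
      then show "A (?g j) = fscale (\<omega> ^ r) (?g (Suc j))"
        using y by (simp add: Ascale Aj)
    qed
    also have "\<dots> = fscale (\<omega> ^ r) (\<Sum>j<q. ?g (Suc j))"
      by (simp add: fscale_sum)
    \<comment> \<open>The summands are periodic: the one at \<open>q\<close> equals the one at 0, as
      both \<omega> and \<open>A\<close> have order dividing \<open>q\<close>. So the shift permutes
      them cyclically.\<close>
    also have "(\<Sum>j<q. ?g (Suc j)) = (\<Sum>j<q. ?g j)"
    proof -
      have "?g q = ?g 0"
        using y Aq \<omega>(1) by (simp add: mult.commute[of r] power_mult power_inverse)
      moreover have "(\<Sum>j<Suc q. ?g j) = ?g 0 + (\<Sum>j<q. ?g (Suc j))"
        by (rule sum.lessThan_Suc_shift)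
      ultimately show ?thesis by simp
    qed
    finally have "A (P r y) = fscale (\<omega> ^ r) (P r y)"
      unfolding P_def by (simp add: mult.commute)
    then show ?thesis using PM[OF y] by (simp add: vecsK)
  qed
  have root: "(\<Sum>r<q. inverse \<omega> ^ (r * j)) = (if j = 0 then of_nat q else 0)" if "j < q" for j
  proof -
    have "(\<Sum>r<q. (inverse \<omega> ^ j) ^ r) = (if j = 0 then of_nat q else 0)"
      using \<omega> that by (intro sum_powers_root_of_unity) (auto simp: power_inverse)
    then show ?thesis by (simp add: power_mult[symmetric] mult.commute)
  qed
  have sumP: "(\<Sum>r<q. P r y) = y" if y: "y \<in> vecs M" for y
  proof (rule ext)
    fix x
    have "(\<Sum>r<q. P r y) x
        = (\<Sum>r<q. \<Sum>j<q. 1 / of_nat q * (inverse \<omega> ^ (r * j) * (A ^^ j) y x))"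
      by (simp add: P_def sum_fun_apply fscale_def sum_distrib_left)
    also have "\<dots> = (\<Sum>j<q. \<Sum>r<q. 1 / of_nat q * (inverse \<omega> ^ (r * j) * (A ^^ j) y x))"
      by (rule sum.swap)
    also have "\<dots> = (\<Sum>j<q. 1 / of_nat q * (A ^^ j) y x * (\<Sum>r<q. inverse \<omega> ^ (r * j)))"
      by (simp add: sum_distrib_left mult_ac)
    also have "\<dots> = (\<Sum>j<q. if j = 0 then y x else 0)"
      using q by (intro sum.cong) (auto simp: root)
    finally show "(\<Sum>r<q. P r y) x = y x" using q by simp
  qed
  \<comment> \<open>On the eigenspace of index \<open>s\<close> the projection of index
    \<open>r\<close> is the mean of the powers of \<omega>^(s - r), hence 1 or 0.\<close>
  have Peig: "P r y = (if r = s then y else 0)" if y: "y \<in> vecs (K s)" and rs: "r < q" "s < q" for r s y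
  proof (rule ext)
    fix x
    have yM: "y \<in> vecs M" and Ay: "A y = fscale (\<omega> ^ s) y" using y by (auto simp: vecsK)
    have Ajy: "(A ^^ j) y = fscale (\<omega> ^ (s * j)) y" for j
      by (induction j) (auto simp: Ascale yM Ay power_add mult.commute)
    have "P r y x = (\<Sum>j<q. inverse \<omega> ^ (r * j) * \<omega> ^ (s * j)) / of_nat q * y x"
      by (simp add: P_def sum_fun_apply fscale_def Ajy sum_distrib_right mult.assoc)
    also have "(\<Sum>j<q. inverse \<omega> ^ (r * j) * \<omega> ^ (s * j)) = (if r = s then of_nat q else 0)"
    proof (cases "r = s")
      case True
      then show ?thesis using \<omega>0 by (simp add: power_inverse)
    next
      case False
      define z where "z = inverse \<omega> ^ r * \<omega> ^ s"
      have "z \<noteq> 1"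
      \<comment> \<open>Exponents are natural numbers, so primitivity of \<omega> is applied to
        \<open>s - r\<close> or, through the inverse of \<open>z\<close>, to
        \<open>r - s\<close>.\<close>
      proof (cases "r < s")
        case True
        then have "z = \<omega> ^ (s - r)"
          using \<omega>0 by (simp add: z_def power_inverse power_diff field_simps)
        then show ?thesis using \<omega>(2)[of "s - r"] True rs by simp
      next
        case nlt: False
        then have "inverse z = \<omega> ^ (r - s)"
          using \<omega>0 by (simp add: z_def power_inverse power_diff field_simps)
        then show ?thesis using \<omega>(2)[of "r - s"] nlt False rs by auto
      qed
      moreover have "z ^ q = 1"
        using \<omega>(1) by (simp add: z_def power_mult_distrib power_inverse flip: power_mult)
           (simp add: mult.commute[of _ q] power_mult)
      ultimately have "(\<Sum>j<q. z ^ j) = 0" by (simp add: geometric_sum)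
      then show ?thesis using False by (simp add: z_def power_mult_distrib power_mult)
    qed
    finally show "P r y x = (if r = s then y else 0) x" using q by simp
  qed
  have Padd: "P r (x + y) = P r x + P r y" if "x \<in> vecs M" "y \<in> vecs M" for r x y
    using that by (simp add: P_def Ajadd fscale_add sum.distrib)
  have Pscale: "P r (fscale c y) = fscale c (P r y)" if "y \<in> vecs M" for r c y
    using that by (simp add: P_def Ajscale fscale_sum mult_ac)
  have P0: "P r 0 = 0" for r
    using Pscale[OF zero, of r 0] by simp
  have Pact: "P r (vact M b y) = vact M b (P r y)" if "y \<in> vecs M" "b \<in> carrier R" for r b y
    using that by (simp add: P_def Ajact actscale actsum sum scale Aj)
  have Psum: "P r (\<Sum>i\<in>I. f i) = (\<Sum>i\<in>I. P r (f i))" if "\<And>i. i \<in> I \<Longrightarrow> f i \<in> vecs M"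
    for I :: "nat set" and f r
    using that by (induction I rule: infinite_finite_induct) (auto simp: P0 Padd sum)
  define \<phi> where "\<phi> = (\<lambda>y. \<lambda>r\<in>{..<q}. P r y)"
  \<comment> \<open>The inverse of the family of projections is summation of the components.\<close>
  have "bij_betw \<phi> (vecs M) (vecs (mod_sum q K))"
  proof (rule bij_betwI)
    show "\<phi> \<in> vecs M \<rightarrow> vecs (mod_sum q K)"
      using PK by (auto simp: \<phi>_def mod_sum_def)
    show "(\<lambda>x. \<Sum>r<q. x r) \<in> vecs (mod_sum q K) \<rightarrow> vecs M"
      by (auto simp: mod_sum_def PiE_iff vecsK intro!: sum)
    show "(\<Sum>r<q. \<phi> y r) = y" if "y \<in> vecs M" for y
      using sumP[OF that] by (simp add: \<phi>_def)
    show "\<phi> (\<Sum>r<q. x r) = x" if x: "x \<in> vecs (mod_sum q K)" for x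
    proof (rule ext)
      fix r
      have xK: "x s \<in> vecs (K s)" if "s < q" for s
        using x that by (auto simp: mod_sum_def)
      then have xM: "x s \<in> vecs M" if "s < q" for s
        using that by (auto simp: vecsK)
      show "\<phi> (\<Sum>r<q. x r) r = x r"
      proof (cases "r < q")
        case True
        have "P r (\<Sum>s<q. x s) = (\<Sum>s<q. P r (x s))"
          by (rule Psum) (use xM in auto)
        also have "\<dots> = (\<Sum>s<q. if r = s then x s else 0)"
          using xK True by (intro sum.cong) (auto simp: Peig)
        finally show ?thesis using True by (simp add: \<phi>_def)
      next
        case False
        then show ?thesis using x by (auto simp: \<phi>_def mod_sum_def PiE_iff extensional_def)
      qed
    qed
  qed
  moreover have "mod_closed R (mod_sum q K)"
    by (intro mod_closed_mod_sum clK)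
  moreover have "vadd (K r) = (+)" "vscale (K r) = fscale" "vact (K r) = vact M" for r
    by (simp_all add: K_def M)
  ultimately show "mod_iso R M (mod_sum q K)"
    unfolding mod_iso_def using M
    by (intro conjI exI[of _ \<phi>])
       (auto simp: mod_sum_def \<phi>_def Padd Pscale Pact)
qed

section \<open>Connected components of a graph\<close>

text \<open>This is the relation in \<open>components\<close>, detached from diagrams so that graphs
  can be moved by arbitrary maps of vertices.\<close>

definition edge_conn :: "'a set set \<Rightarrow> ('a \<times> 'a) set"
  where "edge_conn E = {(u, w). \<exists>e\<in>E. u \<in> e \<and> w \<in> e}\<^sup>*"

lemma edge_conn_refl [simp]: "(u, u) \<in> edge_conn E"
  by (simp add: edge_conn_def)

lemma edge_conn_sym: "(u, w) \<in> edge_conn E \<Longrightarrow> (w, u) \<in> edge_conn E"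
  unfolding edge_conn_def by (rule symD[OF sym_rtrancl]) (auto simp: sym_def)

lemma edge_conn_trans: "(u, v) \<in> edge_conn E \<Longrightarrow> (v, w) \<in> edge_conn E \<Longrightarrow> (u, w) \<in> edge_conn E"
  unfolding edge_conn_def by (rule rtrancl_trans)

lemma edge_conn_edge: "e \<in> E \<Longrightarrow> u \<in> e \<Longrightarrow> w \<in> e \<Longrightarrow> (u, w) \<in> edge_conn E"
  unfolding edge_conn_def by (rule r_into_rtrancl) auto

lemma edge_conn_closed:
  assumes "(u, w) \<in> edge_conn E" "u \<in> S" "\<And>e. e \<in> E \<Longrightarrow> e \<inter> S \<noteq> {} \<Longrightarrow> e \<subseteq> S"
  shows "w \<in> S"
  using assms(1,2) unfolding edge_conn_def
  by (induction rule: rtrancl_induct) (use assms(3) in blast)+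

lemma edge_conn_Image_eq: "(u, w) \<in> edge_conn E \<Longrightarrow> edge_conn E `` {u} = edge_conn E `` {w}"
  by (metis (no_types, lifting) Image_singleton_iff edge_conn_sym edge_conn_trans subsetI subset_antisym)

definition graph_comps :: "'a set set \<Rightarrow> 'a set set"
  where "graph_comps E = \<Union>E // edge_conn E"

lemma graph_compsE:
  assumes "C \<in> graph_comps E" obtains u where "u \<in> \<Union>E" "C = edge_conn E `` {u}"
  using assms by (auto simp: graph_comps_def quotient_def)

lemma graph_comps_eq_Image: "C \<in> graph_comps E \<Longrightarrow> u \<in> C \<Longrightarrow> C = edge_conn E `` {u}"
  by (metis graph_compsE edge_conn_Image_eq Image_singleton_iff)

lemma graph_comps_disjoint:
  "C \<in> graph_comps E \<Longrightarrow> C' \<in> graph_comps E \<Longrightarrow> u \<in> C \<Longrightarrow> u \<in> C' \<Longrightarrow> C = C'"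
  by (metis graph_comps_eq_Image)

lemma graph_comps_subset: "C \<in> graph_comps E \<Longrightarrow> C \<subseteq> \<Union>E"
proof
  fix w assume "C \<in> graph_comps E" "w \<in> C"
  then obtain u where "u \<in> \<Union>E" "(u, w) \<in> edge_conn E" by (auto elim!: graph_compsE)
  then show "w \<in> \<Union>E" using edge_conn_closed[of u w E "\<Union>E"] by blast
qed

lemma graph_comps_nonempty: "C \<in> graph_comps E \<Longrightarrow> C \<noteq> {}"
  by (metis edge_conn_refl Image_singleton_iff empty_iff graph_compsE)

lemma graph_comps_edge: "C \<in> graph_comps E \<Longrightarrow> e \<in> E \<Longrightarrow> e \<inter> C \<noteq> {} \<Longrightarrow> e \<subseteq> C"
proof
  fix w assume C: "C \<in> graph_comps E" and e: "e \<in> E" "e \<inter> C \<noteq> {}" "w \<in> e"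
  then obtain v where v: "v \<in> e" "v \<in> C" by blast
  then have "C = edge_conn E `` {v}" using C by (intro graph_comps_eq_Image)
  then show "w \<in> C" using edge_conn_edge[OF e(1) v(1) e(3)] by blast
qed

lemma graph_comps_cover: "u \<in> \<Union>E \<Longrightarrow> \<exists>C\<in>graph_comps E. u \<in> C"
  by (rule bexI[of _ "edge_conn E `` {u}"]) (auto simp: graph_comps_def quotient_def)

text \<open>A cover by nonempty sets that no edge leaves and that are internally connected must
  consist of the components: each set is the full class of any of its vertices. This determines
  components without describing paths.\<close>

lemma graph_comps_eqI:
  assumes ne: "\<And>C. C \<in> P \<Longrightarrow> C \<noteq> {}" and un: "\<Union>P = \<Union>E"
    and edge: "\<And>e C. e \<in> E \<Longrightarrow> C \<in> P \<Longrightarrow> e \<inter> C \<noteq> {} \<Longrightarrow> e \<subseteq> C"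
    and conn: "\<And>C u w. C \<in> P \<Longrightarrow> u \<in> C \<Longrightarrow> w \<in> C \<Longrightarrow> (u, w) \<in> edge_conn E"
  shows "graph_comps E = P"
proof -
  have cl: "edge_conn E `` {u} = C" if "C \<in> P" "u \<in> C" for C u
  proof
    show "edge_conn E `` {u} \<subseteq> C"
      using edge_conn_closed[of u _ E C] that edge by blast
  qed (use conn that in blast)
  show ?thesis
  proof
    show "graph_comps E \<subseteq> P"
    proof
      fix C assume "C \<in> graph_comps E"
      then obtain u where u: "u \<in> \<Union>P" "C = edge_conn E `` {u}"
        unfolding un by (rule graph_compsE)
      from u(1) obtain C' where "C' \<in> P" "u \<in> C'" by blast
      then show "C \<in> P" using cl[of C' u] u(2) by simp
    qed
    show "P \<subseteq> graph_comps E"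
    proof
      fix C assume C: "C \<in> P"
      then obtain u where u: "u \<in> C" using ne by blast
      then have "u \<in> \<Union>E" using C un by blast
      then show "C \<in> graph_comps E"
        using cl[OF C u] by (auto simp: graph_comps_def quotient_def)
    qed
  qed
qed

lemma edge_conn_imageI:
  "(u, w) \<in> edge_conn E \<Longrightarrow> (\<theta> u, \<theta> w) \<in> edge_conn ((`) \<theta> ` E)"
  unfolding edge_conn_def
  by (induction rule: rtrancl_induct) (auto intro: rtrancl_into_rtrancl)

lemma edge_conn_image:
  assumes "bij \<theta>"
  shows "(\<theta> u, \<theta> w) \<in> edge_conn ((`) \<theta> ` E) \<longleftrightarrow> (u, w) \<in> edge_conn E"
proof
  assume "(\<theta> u, \<theta> w) \<in> edge_conn ((`) \<theta> ` E)"
  then have "(inv_into UNIV \<theta> (\<theta> u), inv_into UNIV \<theta> (\<theta> w)) \<in> edge_conn ((`) (inv_into UNIV \<theta>) ` (`) \<theta> ` E)"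
    by (rule edge_conn_imageI)
  then show "(u, w) \<in> edge_conn E"
    using assms by (simp add: image_comp o_def bij_is_inj)
qed (rule edge_conn_imageI)

text \<open>A bijection of vertices carries paths to paths in both directions. It is the device by
  which a group element passes through a concatenation.\<close>

lemma graph_comps_image:
  assumes "bij \<theta>" shows "graph_comps ((`) \<theta> ` E) = (`) \<theta> ` graph_comps E"
proof (rule graph_comps_eqI)
  have inj: "inj \<theta>" using assms by (rule bij_is_inj)
  show "C \<noteq> {}" if "C \<in> (`) \<theta> ` graph_comps E" for C
    using that graph_comps_nonempty by blast
  show "\<Union> ((`) \<theta> ` graph_comps E) = \<Union> ((`) \<theta> ` E)"
  proof -
    have "\<Union> (graph_comps E) = \<Union>E"
    proof
      show "\<Union> (graph_comps E) \<subseteq> \<Union>E" by (rule Union_least) (rule graph_comps_subset)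
      show "\<Union>E \<subseteq> \<Union> (graph_comps E)" using graph_comps_cover by (metis UnionI subsetI)
    qed
    then show ?thesis by (simp only: image_Union[symmetric])
  qed
  show "e \<subseteq> C" if "e \<in> (`) \<theta> ` E" "C \<in> (`) \<theta> ` graph_comps E" "e \<inter> C \<noteq> {}" for e C
  proof -
    from that obtain e' C' where e': "e' \<in> E" "e = \<theta> ` e'" and C': "C' \<in> graph_comps E" "C = \<theta> ` C'"
      by blast
    have "e' \<inter> C' \<noteq> {}" using that(3) inj by (auto simp: e' C' dest: injD)
    then show ?thesis using graph_comps_edge[OF C'(1) e'(1)] by (auto simp: e' C')
  qed
  show "(u, w) \<in> edge_conn ((`) \<theta> ` E)" if "C \<in> (`) \<theta> ` graph_comps E" "u \<in> C" "w \<in> C" for C u w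
  proof -
    from that obtain C' u' w' where C': "C' \<in> graph_comps E" "u' \<in> C'" "w' \<in> C'" "u = \<theta> u'" "w = \<theta> w'"
      by blast
    have "(u', w') \<in> edge_conn E" using graph_comps_eq_Image[OF C'(1,2)] C'(3) by blast
    then show ?thesis by (simp add: C' edge_conn_image[OF assms])
  qed
qed

text \<open>Each vertex other than a root is assigned an edge leading closer to the root.\<close>

lemma card_graph_comp_le:
  assumes "finite E" "\<And>e. e \<in> E \<Longrightarrow> card e = 2" "C \<in> graph_comps E"
  shows "card C \<le> card {e \<in> E. e \<subseteq> C} + 1"
proof -
  let ?r = "{(u, w). \<exists>e\<in>E. u \<in> e \<and> w \<in> e}"
  obtain u where u: "C = edge_conn E `` {u}" using assms(3) by (auto elim: graph_compsE)
  define ds where "ds v = (LEAST n. (u, v) \<in> ?r ^^ n)" for v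
  have ds: "(u, v) \<in> ?r ^^ ds v" if "v \<in> C" for v
  proof -
    from that have "(u, v) \<in> ?r\<^sup>*" by (simp add: u edge_conn_def)
    then have "\<exists>n. (u, v) \<in> ?r ^^ n" by (rule rtrancl_imp_relpow)
    then show ?thesis unfolding ds_def by (rule LeastI_ex)
  qed
  \<comment> \<open>The edge is the last one on a shortest path from the root \<open>u\<close> to
    \<open>v\<close>.\<close>
  have ex: "\<exists>e w. e \<in> E \<and> e \<subseteq> C \<and> e = {w, v} \<and> ds w < ds v" if v: "v \<in> C" "v \<noteq> u" for v
  proof -
    have "ds v \<noteq> 0"
    proof
      assume "ds v = 0"
      then have "(u, v) \<in> ?r ^^ 0" using ds[OF v(1)] by metis
      then show False using v(2) by simp
    qed
    then obtain k where k: "ds v = Suc k" using not0_implies_Suc by blast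
    then have "(u, v) \<in> ?r ^^ Suc k" using ds[OF v(1)] by metis
    then obtain w where w: "(u, w) \<in> ?r ^^ k" "(w, v) \<in> ?r" by (rule relpow_Suc_E)
    from w(2) obtain e where e: "e \<in> E" "w \<in> e" "v \<in> e" by blast
    have "ds w \<le> k" unfolding ds_def using w(1) by (rule Least_le)
    then have lt: "ds w < ds v" by (simp add: k)
    then have "w \<noteq> v" by auto
    moreover have "card e = 2" using assms(2) e(1) .
    ultimately have "e = {w, v}"
      using e(2,3) by (auto simp: card_2_iff)
    moreover have "e \<subseteq> C" using graph_comps_edge[OF assms(3) e(1)] e(3) v(1) by blast
    ultimately show ?thesis using e(1) lt by blast
  qed
  have "\<forall>v\<in>C - {u}. \<exists>e w. e \<in> E \<and> e \<subseteq> C \<and> e = {w, v} \<and> ds w < ds v"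
    using ex by blast
  then obtain f where f: "\<forall>v\<in>C - {u}. \<exists>w. f v \<in> E \<and> f v \<subseteq> C \<and> f v = {w, v} \<and> ds w < ds v"
    by (rule bchoice[THEN exE])
  \<comment> \<open>If two vertices were assigned the same edge, they would be its two endpoints,
    and each would be closer to the root than the other.\<close>
  have "inj_on f (C - {u})"
  proof (rule inj_onI, rule ccontr)
    fix v v' assume vv: "v \<in> C - {u}" "v' \<in> C - {u}" "f v = f v'" "v \<noteq> v'"
    obtain w w' where "f v = {w, v}" "ds w < ds v" "f v' = {w', v'}" "ds w' < ds v'"
      using f vv(1,2) by meson
    then show False using vv(3,4) by (metis doubleton_eq_iff less_asym)
  qed
  moreover have "f ` (C - {u}) \<subseteq> {e \<in> E. e \<subseteq> C}"
    using f by fastforce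
  ultimately have "card (C - {u}) \<le> card {e \<in> E. e \<subseteq> C}"
    using assms(1) by (intro card_inj_on_le[of f]) auto
  moreover have "finite C"
  proof (rule finite_subset[OF graph_comps_subset[OF assms(3)]])
    have "finite e" if "e \<in> E" for e
      using assms(2)[OF that] by (intro card_ge_0_finite) simp
    then show "finite (\<Union>E)" using assms(1) by (intro finite_Union)
  qed
  moreover have "u \<in> C" by (simp add: u)
  ultimately show ?thesis by (simp add: card_Diff_singleton)
qed

section \<open>Diagrams\<close>

lemma card_North_Un_South:
  assumes "finite A" "finite B" shows "card (North ` A \<union> South ` B) = card A + card B"
proof -
  have "card (North ` A \<union> South ` B) = card (North ` A) + card (South ` B)"
    using assms by (intro card_Un_disjoint) auto
  then show ?thesis by (simp add: card_image inj_on_def)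
qed

lemma finite_nodes [simp]: "finite (nodes a b)"
  by (simp add: nodes_def)

lemma diagrams_strand:
  assumes "X \<in> diagrams m a b" "s \<in> X"
  shows "fst s \<subseteq> nodes a b" "card (fst s) = 2" "snd s < m" "finite (fst s)" "fst s \<noteq> {}"
proof -
  obtain e c where s: "s = (e, c)" by (cases s)
  then have *: "e \<subseteq> nodes a b" "card e = 2" "c < m" using assms by (auto simp: diagrams_def)
  then show "fst s \<subseteq> nodes a b" "card (fst s) = 2" "snd s < m" "finite (fst s)" "fst s \<noteq> {}"
    using finite_subset[OF *(1)] by (auto simp: s)
qed

lemma diagrams_ex1: "X \<in> diagrams m a b \<Longrightarrow> u \<in> nodes a b \<Longrightarrow> \<exists>!s. s \<in> X \<and> u \<in> fst s"
  by (auto simp: diagrams_def)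

lemma diagrams_unique:
  "X \<in> diagrams m a b \<Longrightarrow> s \<in> X \<Longrightarrow> s' \<in> X \<Longrightarrow> u \<in> fst s \<Longrightarrow> u \<in> fst s' \<Longrightarrow> s = s'"
  using diagrams_ex1 diagrams_strand(1) by (metis subsetD)

lemma diagrams_inj_fst: "X \<in> diagrams m a b \<Longrightarrow> s \<in> X \<Longrightarrow> s' \<in> X \<Longrightarrow> fst s = fst s' \<Longrightarrow> s = s'"
  using diagrams_unique diagrams_strand(5) by (metis ex_in_conv)

lemma finite_diagrams [simp]: "finite (diagrams m a b)"
proof (rule finite_subset)
  show "diagrams m a b \<subseteq> Pow (Pow (nodes a b) \<times> {..<m})"
    by (auto simp: diagrams_def)
qed simp

lemma finite_diagram: "X \<in> diagrams m a b \<Longrightarrow> finite X"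
  by (rule finite_subset[of _ "Pow (nodes a b) \<times> {..<m}"]) (auto simp: diagrams_def)

lemma Union_diagram: "X \<in> diagrams m a b \<Longrightarrow> \<Union>(fst ` X) = nodes a b"
proof
  assume X: "X \<in> diagrams m a b"
  show "\<Union>(fst ` X) \<subseteq> nodes a b"
    using diagrams_strand(1)[OF X] by (rule UN_least)
  show "nodes a b \<subseteq> \<Union>(fst ` X)"
  proof
    fix u assume "u \<in> nodes a b"
    from diagrams_ex1[OF X this] show "u \<in> \<Union>(fst ` X)" by auto
  qed
qed

text \<open>A set of nodes that no strand leaves is the disjoint union of the strands inside it,
  each with two nodes.\<close>

lemma card_closed_nodes:
  assumes X: "X \<in> diagrams m a b" and U: "U \<subseteq> nodes a b"
    and cl: "\<And>s. s \<in> X \<Longrightarrow> fst s \<inter> U \<noteq> {} \<Longrightarrow> fst s \<subseteq> U"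
  shows "card U = 2 * card {s \<in> X. fst s \<subseteq> U}"
proof -
  let ?S = "{s \<in> X. fst s \<subseteq> U}"
  have "U = (\<Union>s\<in>?S. fst s)"
  proof
    show "U \<subseteq> (\<Union>s\<in>?S. fst s)"
    proof
      fix u assume u: "u \<in> U"
      with U have "u \<in> nodes a b" by blast
      from diagrams_ex1[OF X this] obtain s where "s \<in> X" "u \<in> fst s" by auto
      then show "u \<in> (\<Union>s\<in>?S. fst s)" using cl[of s] u by blast
    qed
  qed blast
  moreover have "card (\<Union>s\<in>?S. fst s) = (\<Sum>s\<in>?S. card (fst s))"
  proof (rule card_UN_disjoint)
    show "\<forall>s\<in>?S. \<forall>s'\<in>?S. s \<noteq> s' \<longrightarrow> fst s \<inter> fst s' = {}"
      using diagrams_unique[OF X] by (metis (no_types, lifting) disjoint_iff mem_Collect_eq)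
  qed (use finite_diagram[OF X] diagrams_strand(4)[OF X] in auto)
  moreover have "\<dots> = (\<Sum>s\<in>?S. 2)"
    using diagrams_strand(2)[OF X] by (intro sum.cong) auto
  ultimately show ?thesis by simp
qed

section \<open>Components of a concatenation\<close>

lemma components_eq: "components X Y = graph_comps (glued_edges X Y)"
  by (simp add: components_def graph_comps_def edge_conn_def)

lemma inj_upper: "inj upper" and inj_lower: "inj lower"
proof -
  show "inj upper"
    by (rule injI, rename_tac u v, case_tac u; case_tac v) auto
  show "inj lower"
    by (rule injI, rename_tac u v, case_tac u; case_tac v) auto
qed

lemma Union_glued_edges:
  assumes "X \<in> diagrams m a b" "Y \<in> diagrams m b c"
  shows "\<Union>(glued_edges X Y) = Top ` {1..a} \<union> Mid ` {1..b} \<union> Bot ` {1..c}"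
proof -
  have "\<Union>(glued_edges X Y) = upper ` \<Union>(fst ` X) \<union> lower ` \<Union>(fst ` Y)"
    by (auto simp: glued_edges_def)
  also have "\<dots> = Top ` {1..a} \<union> Mid ` {1..b} \<union> Bot ` {1..c}"
    by (auto simp: Union_diagram[OF assms(1)] Union_diagram[OF assms(2)] nodes_def image_Un image_image)
  finally show ?thesis .
qed

lemma finite_glued_edges:
  "X \<in> diagrams m a b \<Longrightarrow> Y \<in> diagrams m b c \<Longrightarrow> finite (glued_edges X Y)"
  by (auto simp: glued_edges_def finite_diagram)

lemma card_glued_edge:
  "X \<in> diagrams m a b \<Longrightarrow> Y \<in> diagrams m b c \<Longrightarrow> e \<in> glued_edges X Y \<Longrightarrow> card e = 2"
proof -
  assume X: "X \<in> diagrams m a b" and Y: "Y \<in> diagrams m b c" and "e \<in> glued_edges X Y"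
  then consider s where "s \<in> X" "e = upper ` fst s" | s where "s \<in> Y" "e = lower ` fst s"
    unfolding glued_edges_def by blast
  then show "card e = 2"
  proof cases
    case 1
    then show ?thesis
      using diagrams_strand(2)[OF X] by (simp add: card_image inj_on_subset[OF inj_upper])
  next
    case 2
    then show ?thesis
      using diagrams_strand(2)[OF Y] by (simp add: card_image inj_on_subset[OF inj_lower])
  qed
qed

lemma finite_components:
  assumes "X \<in> diagrams m a b" "Y \<in> diagrams m b c" shows "finite (components X Y)"
  unfolding components_eq
proof (rule finite_subset)
  show "graph_comps (glued_edges X Y) \<subseteq> Pow (\<Union>(glued_edges X Y))"
    using graph_comps_subset by blast
  show "finite (Pow (\<Union>(glued_edges X Y)))"
    unfolding Union_glued_edges[OF assms] by simp
qed

lemma component_upper: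
  "C \<in> components X Y \<Longrightarrow> s \<in> X \<Longrightarrow> u \<in> fst s \<Longrightarrow> upper u \<in> C \<Longrightarrow> upper ` fst s \<subseteq> C"
  unfolding components_eq by (rule graph_comps_edge) (auto simp: glued_edges_def)

lemma component_lower:
  "C \<in> components X Y \<Longrightarrow> s \<in> Y \<Longrightarrow> u \<in> fst s \<Longrightarrow> lower u \<in> C \<Longrightarrow> lower ` fst s \<subseteq> C"
  unfolding components_eq by (rule graph_comps_edge) (auto simp: glued_edges_def)

lemma components_disjoint:
  "C \<in> components X Y \<Longrightarrow> C' \<in> components X Y \<Longrightarrow> u \<in> C \<Longrightarrow> u \<in> C' \<Longrightarrow> C = C'"
  unfolding components_eq by (rule graph_comps_disjoint)

lemma component_upper_ex: "s \<in> X \<Longrightarrow> fst s \<noteq> {} \<Longrightarrow> \<exists>C\<in>components X Y. upper ` fst s \<subseteq> C"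
  and component_lower_ex: "s' \<in> Y \<Longrightarrow> fst s' \<noteq> {} \<Longrightarrow> \<exists>C\<in>components X Y. lower ` fst s' \<subseteq> C"
proof -
  assume s: "s \<in> X" "fst s \<noteq> {}"
  then obtain u where u: "u \<in> fst s" by blast
  then have "upper u \<in> \<Union>(glued_edges X Y)" using s by (auto simp: glued_edges_def)
  then obtain C where "C \<in> components X Y" "upper u \<in> C"
    using graph_comps_cover unfolding components_eq by metis
  then show "\<exists>C\<in>components X Y. upper ` fst s \<subseteq> C" using component_upper s u by metis
next
  assume s: "s' \<in> Y" "fst s' \<noteq> {}"
  then obtain u where u: "u \<in> fst s'" by blast
  then have "lower u \<in> \<Union>(glued_edges X Y)" using s by (auto simp: glued_edges_def)
  then obtain C where "C \<in> components X Y" "lower u \<in> C"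
    using graph_comps_cover unfolding components_eq by metis
  then show "\<exists>C\<in>components X Y. lower ` fst s' \<subseteq> C" using component_lower s u by metis
qed

lemma North_in_ends [simp]: "North i \<in> ends C \<longleftrightarrow> Top i \<in> C"
  and South_in_ends [simp]: "South i \<in> ends C \<longleftrightarrow> Bot i \<in> C"
  by (auto simp: ends_def)

lemma ends_inj:
  assumes "C \<in> components X Y" "C' \<in> components X Y" "u \<in> ends C" "u \<in> ends C'"
  shows "C = C'"
  by (cases u) (use assms components_disjoint in auto)

text \<open>A component with \<open>V\<close> vertices, \<open>E\<close> edges and \<open>k\<close> ends satisfies \<open>k + 2 (V - k) = 2 E\<close>
  by counting degrees, and \<open>V \<le> E + 1\<close> since it is connected; so \<open>k\<close> is 0 or 2.\<close>

lemma card_ends: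
  assumes X: "X \<in> diagrams m a b" and Y: "Y \<in> diagrams m b c" and C: "C \<in> components X Y"
    and ne: "ends C \<noteq> {}"
  shows "card (ends C) = 2"
proof -
  have Csub: "C \<subseteq> Top ` {1..a} \<union> Mid ` {1..b} \<union> Bot ` {1..c}"
    using graph_comps_subset[of C "glued_edges X Y"] C
    unfolding components_eq Union_glued_edges[OF X Y] .
  then have fin: "finite C" by (rule finite_subset) simp
  define T where "T = {i. Top i \<in> C}"
  define M where "M = {i. Mid i \<in> C}"
  define B where "B = {i. Bot i \<in> C}"
  have "finite T" "finite M" "finite B"
    unfolding T_def M_def B_def by (auto intro!: finite_subset[OF _ finite_vimageI[OF fin, unfolded vimage_def]] injI)
  note fin' = this
  have Ceq: "C = Top ` T \<union> Mid ` M \<union> Bot ` B"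
    using Csub by (auto simp: T_def M_def B_def)
  have cardC: "card C = card T + card M + card B"
  proof -
    have "card C = card (Top ` T \<union> Mid ` M) + card (Bot ` B)"
      unfolding Ceq using fin' by (intro card_Un_disjoint) auto
    also have "card (Top ` T \<union> Mid ` M) = card (Top ` T) + card (Mid ` M)"
      using fin' by (intro card_Un_disjoint) auto
    finally show ?thesis by (simp add: card_image inj_on_def)
  qed
  have "ends C = North ` T \<union> South ` B"
    by (auto simp: ends_def T_def B_def)
  then have cardE: "card (ends C) = card T + card B"
    using fin' by (simp add: card_North_Un_South)
  \<comment> \<open>The nodes of \<open>X\<close> and of \<open>Y\<close> that lie in
    \<open>C\<close>. A middle vertex is southern for \<open>X\<close> and northern for
    \<open>Y\<close>, so it occurs in both sets: its degree is two.\<close>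
  let ?U = "North ` T \<union> South ` M" and ?L = "North ` M \<union> South ` B"
  have upU: "upper u \<in> C \<longleftrightarrow> u \<in> ?U" and loL: "lower u \<in> C \<longleftrightarrow> u \<in> ?L" for u
    by (cases u; auto simp: T_def M_def B_def)+
  have supU: "upper ` e \<subseteq> C \<longleftrightarrow> e \<subseteq> ?U" and sloL: "lower ` e \<subseteq> C \<longleftrightarrow> e \<subseteq> ?L" for e
    using upU loL by blast+
  have "card ?U = 2 * card {s \<in> X. fst s \<subseteq> ?U}"
  proof (rule card_closed_nodes[OF X])
    show "?U \<subseteq> nodes a b" using Csub by (auto simp: nodes_def T_def M_def)
    show "fst s \<subseteq> ?U" if "s \<in> X" "fst s \<inter> ?U \<noteq> {}" for s
      using that component_upper[OF C that(1)] upU supU by blast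
  qed
  then have cU: "card T + card M = 2 * card {s \<in> X. upper ` fst s \<subseteq> C}"
    using fin' by (simp only: supU card_North_Un_South)
  have "card ?L = 2 * card {s \<in> Y. fst s \<subseteq> ?L}"
  proof (rule card_closed_nodes[OF Y])
    show "?L \<subseteq> nodes b c" using Csub by (auto simp: nodes_def B_def M_def)
    show "fst s \<subseteq> ?L" if "s \<in> Y" "fst s \<inter> ?L \<noteq> {}" for s
      using that component_lower[OF C that(1)] loL sloL by blast
  qed
  then have cL: "card M + card B = 2 * card {s \<in> Y. lower ` fst s \<subseteq> C}"
    using fin' by (simp only: sloL card_North_Un_South)
  \<comment> \<open>Only an inequality: a southern arc of \<open>X\<close> and a northern arc of
    \<open>Y\<close> on the same two middle vertices give one and the same edge.\<close>
  have "card {e \<in> glued_edges X Y. e \<subseteq> C} \<le>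
      card ((\<lambda>s. upper ` fst s) ` {s \<in> X. upper ` fst s \<subseteq> C} \<union>
            (\<lambda>s. lower ` fst s) ` {s \<in> Y. lower ` fst s \<subseteq> C})"
    using finite_diagram[OF X] finite_diagram[OF Y] by (intro card_mono) (auto simp: glued_edges_def)
  also have "\<dots> \<le> card ((\<lambda>s. upper ` fst s) ` {s \<in> X. upper ` fst s \<subseteq> C}) +
            card ((\<lambda>s. lower ` fst s) ` {s \<in> Y. lower ` fst s \<subseteq> C})"
    by (rule card_Un_le)
  also have "\<dots> \<le> card {s \<in> X. upper ` fst s \<subseteq> C} + card {s \<in> Y. lower ` fst s \<subseteq> C}"
    using finite_diagram[OF X] finite_diagram[OF Y] by (intro add_mono card_image_le) auto
  finally have "card C \<le> card {s \<in> X. upper ` fst s \<subseteq> C} + card {s \<in> Y. lower ` fst s \<subseteq> C} + 1"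
    using card_graph_comp_le[OF finite_glued_edges[OF X Y] card_glued_edge[OF X Y], of C] C
    by (auto simp: components_eq)
  moreover have "card (ends C) \<noteq> 0"
    using ne fin' cardE \<open>ends C = North ` T \<union> South ` B\<close> by (simp add: card_eq_0_iff)
  moreover define k where "k = card (ends C)"
  ultimately have "k \<le> 2" "k \<noteq> 0" using cU cL cardC cardE by linarith+
  \<comment> \<open>The degree count makes the number of ends even, which excludes 1.\<close>
  moreover have "k + 2 * card M = 2 * (card {s \<in> X. upper ` fst s \<subseteq> C} + card {s \<in> Y. lower ` fst s \<subseteq> C})"
    using cU cL cardE by (simp add: k_def)
  then have "even (k + 2 * card M)" by simp
  then have "k \<noteq> 1" by auto
  ultimately have "k = 2" by linarith
  then show ?thesis by (simp add: k_def)
qed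

lemma ends_subset_nodes:
  assumes "X \<in> diagrams m a b" "Y \<in> diagrams m b c" "C \<in> components X Y"
  shows "ends C \<subseteq> nodes a c"
proof
  fix u assume u: "u \<in> ends C"
  have "C \<subseteq> Top ` {1..a} \<union> Mid ` {1..b} \<union> Bot ` {1..c}"
    using graph_comps_subset[of C "glued_edges X Y"] assms(3)
    unfolding components_eq Union_glued_edges[OF assms(1,2)] .
  then show "u \<in> nodes a c" using u by (cases u) (auto simp: nodes_def)
qed

text \<open>Components are disjoint and cover the outer nodes, and \<open>card_ends\<close> says
  that each component reaching the outside does so in exactly two nodes.\<close>

lemma compose_in_diagrams:
  assumes m: "0 < m" and X: "X \<in> diagrams m a b" and Y: "Y \<in> diagrams m b c"
  shows "compose m X Y \<in> diagrams m a c"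
proof -
  have "\<exists>!s. s \<in> compose m X Y \<and> u \<in> fst s" if u: "u \<in> nodes a c" for u
  proof -
    have "\<exists>C\<in>components X Y. u \<in> ends C"
    proof (cases u)
      case (North i)
      then have "Top i \<in> \<Union>(glued_edges X Y)"
        using u by (auto simp: Union_glued_edges[OF X Y] nodes_def)
      from graph_comps_cover[OF this] show ?thesis
        by (auto simp: components_eq North)
    next
      case (South i)
      then have "Bot i \<in> \<Union>(glued_edges X Y)"
        using u by (auto simp: Union_glued_edges[OF X Y] nodes_def)
      from graph_comps_cover[OF this] show ?thesis
        by (auto simp: components_eq South)
    qed
    then obtain C where C: "C \<in> components X Y" "u \<in> ends C" by blast
    show ?thesis
    proof (rule ex1I[of _ "(ends C, comp_label m X Y C)"])
      show "(ends C, comp_label m X Y C) \<in> compose m X Y \<and> u \<in> fst (ends C, comp_label m X Y C)"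
        using C by (auto simp: compose_def)
      fix s assume "s \<in> compose m X Y \<and> u \<in> fst s"
      then obtain C' where "C' \<in> components X Y" "u \<in> ends C'" "s = (ends C', comp_label m X Y C')"
        by (force simp: compose_def)
      then show "s = (ends C, comp_label m X Y C)" using ends_inj C by metis
    qed
  qed
  moreover have "fst s \<subseteq> nodes a c \<and> card (fst s) = 2 \<and> snd s < m" if "s \<in> compose m X Y" for s
    using that card_ends[OF X Y] ends_subset_nodes[OF X Y] m
    unfolding compose_def comp_label_def by clarsimp
  ultimately show ?thesis
    unfolding diagrams_def by (simp add: case_prod_unfold)
qed

lemma sum_over_blocks:
  assumes "finite K" "finite A" "\<And>s. s \<in> A \<Longrightarrow> \<exists>!C. C \<in> K \<and> Q s C"
  shows "(\<Sum>C\<in>K. \<Sum>s | s \<in> A \<and> Q s C. f s) = (\<Sum>s\<in>A. f s :: 'b :: comm_monoid_add)"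
proof -
  have "(\<Sum>C\<in>K. \<Sum>s | s \<in> A \<and> Q s C. f s) = (\<Sum>s\<in>A. \<Sum>C | C \<in> K \<and> Q s C. f s)"
    by (rule sum.swap_restrict[OF assms(1,2)])
  also have "\<dots> = (\<Sum>s\<in>A. f s)"
  proof (rule sum.cong[OF refl])
    fix s assume "s \<in> A"
    from assms(3)[OF this] obtain C where C: "C \<in> K" "Q s C"
      and unique: "\<And>C'. C' \<in> K \<and> Q s C' \<Longrightarrow> C' = C" by (elim ex1E) blast
    have "{C. C \<in> K \<and> Q s C} = {C}" using C unique by blast
    then show "(\<Sum>C | C \<in> K \<and> Q s C. f s) = f s" by simp
  qed
  finally show ?thesis .
qed

lemma sum_over_components:
  assumes X: "X \<in> diagrams m a b" and Y: "Y \<in> diagrams m b c"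
  shows "(\<Sum>C\<in>components X Y. (\<Sum>s | s \<in> X \<and> upper ` fst s \<subseteq> C. snd s) +
      (\<Sum>s | s \<in> Y \<and> lower ` fst s \<subseteq> C. snd s)) = label_sum X + label_sum Y"
proof -
  have "(\<Sum>C\<in>components X Y. \<Sum>s | s \<in> X \<and> upper ` fst s \<subseteq> C. snd s) = label_sum X"
    unfolding label_sum_def
  proof (rule sum_over_blocks[OF finite_components[OF X Y] finite_diagram[OF X]])
    fix s assume s: "s \<in> X"
    obtain u where u: "u \<in> fst s" using diagrams_strand(5)[OF X s] by blast
    obtain C where C: "C \<in> components X Y" "upper ` fst s \<subseteq> C"
      using component_upper_ex[OF s diagrams_strand(5)[OF X s]] by (rule bexE)
    show "\<exists>!C. C \<in> components X Y \<and> upper ` fst s \<subseteq> C"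
    proof (rule ex1I[of _ C])
      fix C' assume "C' \<in> components X Y \<and> upper ` fst s \<subseteq> C'"
      then show "C' = C" using components_disjoint[OF _ C(1), of C' "upper u"] C(2) u by blast
    qed (use C in simp)
  qed
  moreover have "(\<Sum>C\<in>components X Y. \<Sum>s | s \<in> Y \<and> lower ` fst s \<subseteq> C. snd s) = label_sum Y"
    unfolding label_sum_def
  proof (rule sum_over_blocks[OF finite_components[OF X Y] finite_diagram[OF Y]])
    fix s assume s: "s \<in> Y"
    obtain u where u: "u \<in> fst s" using diagrams_strand(5)[OF Y s] by blast
    obtain C where C: "C \<in> components X Y" "lower ` fst s \<subseteq> C"
      using component_lower_ex[OF s diagrams_strand(5)[OF Y s]] by (rule bexE)
    show "\<exists>!C. C \<in> components X Y \<and> lower ` fst s \<subseteq> C"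
    proof (rule ex1I[of _ C])
      fix C' assume "C' \<in> components X Y \<and> lower ` fst s \<subseteq> C'"
      then show "C' = C" using components_disjoint[OF _ C(1), of C' "lower u"] C(2) u by blast
    qed (use C in simp)
  qed
  ultimately show ?thesis by (simp add: sum.distrib)
qed

text \<open>Each strand of \<open>X\<close> or \<open>Y\<close> lies in exactly one component.
  Components with ends keep their labels in the product, so the labels of the loops are all that
  gets lost.\<close>

lemma label_sum_compose_loops:
  assumes X: "X \<in> diagrams m a b" and Y: "Y \<in> diagrams m b c"
  shows "(label_sum (compose m X Y) +
      (\<Sum>C | C \<in> components X Y \<and> ends C = {}. comp_label m X Y C)) mod m
    = (label_sum X + label_sum Y) mod m"
proof -
  let ?A = "{C \<in> components X Y. ends C \<noteq> {}}" and ?L = "{C \<in> components X Y. ends C = {}}"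
  have fin: "finite (components X Y)" by (rule finite_components[OF X Y])
  have "compose m X Y = (\<lambda>C. (ends C, comp_label m X Y C)) ` ?A"
    by (auto simp: compose_def)
  moreover have "inj_on (\<lambda>C. (ends C, comp_label m X Y C)) ?A"
    by (rule inj_onI) (use ends_inj in blast)
  ultimately have "label_sum (compose m X Y) = (\<Sum>C\<in>?A. comp_label m X Y C)"
    by (simp add: label_sum_def sum.reindex)
  then have "label_sum (compose m X Y) + (\<Sum>C\<in>?L. comp_label m X Y C) =
      (\<Sum>C\<in>?A \<union> ?L. comp_label m X Y C)"
    using fin by (subst sum.union_disjoint) auto
  also have "?A \<union> ?L = components X Y" by blast
  finally show ?thesis
    unfolding sum_over_components[OF X Y, symmetric]
    by (simp add: comp_label_def mod_sum_eq)
qed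

text \<open>A nonzero coefficient forces every removed loop to have a label divisible by p. The lost
  labels therefore vanish modulo p, though not in general modulo m; this is why label sums are later
  compared modulo p.\<close>

lemma label_sum_compose_mod:
  assumes X: "X \<in> diagrams m a b" and Y: "Y \<in> diagrams m b c"
    and p: "p dvd m" and nz: "loop_coeff m p \<delta> X Y \<noteq> 0"
  shows "label_sum (compose m X Y) mod p = (label_sum X + label_sum Y) mod p"
proof -
  have "p dvd comp_label m X Y C" if "C \<in> {C \<in> components X Y. ends C = {}}" for C
    using nz that finite_components[OF X Y] by (auto simp: loop_coeff_def split: if_splits)
  then have "p dvd (\<Sum>C | C \<in> components X Y \<and> ends C = {}. comp_label m X Y C)" (is "p dvd ?L")
    by (intro dvd_sum) auto
  then have "label_sum (compose m X Y) mod p = (label_sum (compose m X Y) + ?L) mod p"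
    by (auto elim!: dvdE)
  also have "\<dots> = (label_sum (compose m X Y) + ?L) mod m mod p"
    by (rule mod_mod_cancel[OF p, symmetric])
  also have "\<dots> = (label_sum X + label_sum Y) mod p"
    unfolding label_sum_compose_loops[OF X Y] by (rule mod_mod_cancel[OF p])
  finally show ?thesis .
qed

section \<open>Concatenation with a group element\<close>

definition relabel :: "(nat \<Rightarrow> nat) \<Rightarrow> node \<Rightarrow> node" where
  "relabel \<pi> u = (case u of North i \<Rightarrow> North i | South j \<Rightarrow> South (\<pi> j))"

text \<open>The right action of the group element given by \<open>\<pi>\<close> and the labels \<open>a\<close>, described without concatenation.\<close>

definition twist :: "nat \<Rightarrow> (nat \<Rightarrow> nat) \<Rightarrow> (nat \<Rightarrow> nat) \<Rightarrow> diagram \<Rightarrow> diagram" where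
  "twist m \<pi> a D =
     (\<lambda>s. (relabel \<pi> ` fst s, (snd s + (\<Sum>j | South j \<in> fst s. a j)) mod m)) ` D"

lemma relabel_simps [simp]: "relabel \<pi> (North i) = North i" "relabel \<pi> (South j) = South (\<pi> j)"
  by (simp_all add: relabel_def)

lemma relabel_eq_North [simp]: "relabel \<pi> u = North i \<longleftrightarrow> u = North i"
  by (cases u) auto

lemma relabel_relabel [simp]: "relabel \<pi> (relabel \<pi>' u) = relabel (\<pi> \<circ> \<pi>') u"
  by (cases u) auto

lemma inj_relabel: "inj \<pi> \<Longrightarrow> inj (relabel \<pi>)"
  by (rule injI, rename_tac u v, case_tac u; case_tac v) (auto dest: injD)

lemma North_in_relabel_image [simp]: "North i \<in> relabel \<pi> ` e \<longleftrightarrow> North i \<in> e"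
  by (metis (no_types, lifting) image_iff relabel_eq_North)

lemma South_in_relabel_image: "inj \<pi> \<Longrightarrow> South (\<pi> j) \<in> relabel \<pi> ` e \<longleftrightarrow> South j \<in> e"
  using inj_image_mem_iff[OF inj_relabel, of \<pi> "South j" e] by simp

lemma relabel_permutes_nodes:
  assumes "\<pi> permutes {1..b}" shows "relabel \<pi> u \<in> nodes a b \<longleftrightarrow> u \<in> nodes a b"
  using permutes_in_image[OF assms] by (cases u) (auto simp: nodes_def image_iff)

lemma surj_relabel:
  assumes "surj \<pi>" shows "surj (relabel \<pi>)"
  unfolding surj_def
proof
  fix v show "\<exists>u. v = relabel \<pi> u"
  proof (cases v)
    case (South j)
    obtain i where "\<pi> i = j" using assms by (metis surjD)
    then show ?thesis using South by (intro exI[of _ "South i"]) simp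
  qed (metis relabel_simps(1))
qed

lemma twist_in_diagrams:
  assumes m: "0 < m" and \<pi>: "\<pi> permutes {1..b}" and D: "D \<in> diagrams m n b"
  shows "twist m \<pi> a D \<in> diagrams m n b"
proof -
  have inj: "inj (relabel \<pi>)" by (rule inj_relabel[OF permutes_inj[OF \<pi>]])
  have "fst s \<subseteq> nodes n b \<and> card (fst s) = 2 \<and> snd s < m" if "s \<in> twist m \<pi> a D" for s
  proof -
    from that obtain s' where s': "s' \<in> D" "fst s = relabel \<pi> ` fst s'" "snd s < m"
      unfolding twist_def using m by auto
    have "relabel \<pi> ` fst s' \<subseteq> nodes n b"
      using diagrams_strand(1)[OF D s'(1)] relabel_permutes_nodes[OF \<pi>] by auto
    then show ?thesis
      using s' diagrams_strand(2)[OF D s'(1)] by (simp add: card_image inj_on_subset[OF inj])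
  qed
  moreover have "\<exists>!s. s \<in> twist m \<pi> a D \<and> v \<in> fst s" if "v \<in> nodes n b" for v
  proof -
    obtain u where u: "v = relabel \<pi> u"
      using surj_relabel[OF permutes_surj[OF \<pi>]] by (metis surjD)
    then have "u \<in> nodes n b" using that relabel_permutes_nodes[OF \<pi>] by metis
    from diagrams_ex1[OF D this] obtain s where s: "s \<in> D" "u \<in> fst s" by auto
    show ?thesis
    proof (rule ex1I)
      show "(relabel \<pi> ` fst s, (snd s + (\<Sum>j | South j \<in> fst s. a j)) mod m) \<in> twist m \<pi> a D \<and>
          v \<in> fst (relabel \<pi> ` fst s, (snd s + (\<Sum>j | South j \<in> fst s. a j)) mod m)"
        using s u by (auto simp: twist_def)
      fix s' assume "s' \<in> twist m \<pi> a D \<and> v \<in> fst s'"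
      then obtain r where r: "r \<in> D" "s' = (relabel \<pi> ` fst r, (snd r + (\<Sum>j | South j \<in> fst r. a j)) mod m)"
        "relabel \<pi> u \<in> relabel \<pi> ` fst r"
        unfolding twist_def u by auto
      then have "u \<in> fst r" by (simp add: inj_image_mem_iff[OF inj])
      then have "r = s" using diagrams_unique[OF D r(1) s(1) _ s(2)] by simp
      then show "s' = (relabel \<pi> ` fst s, (snd s + (\<Sum>j | South j \<in> fst s. a j)) mod m)"
        using r(2) by simp
    qed
  qed
  ultimately show ?thesis
    unfolding diagrams_def by (simp add: case_prod_unfold)
qed

lemma inj_on_twist:
  assumes "D \<in> diagrams m n b" "inj \<pi>"
  shows "inj_on (\<lambda>s. (relabel \<pi> ` fst s, (snd s + (\<Sum>j | South j \<in> fst s. a j)) mod m)) D"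
proof (rule inj_onI)
  fix s s' assume s: "s \<in> D" "s' \<in> D"
    "(relabel \<pi> ` fst s, (snd s + (\<Sum>j | South j \<in> fst s. a j)) mod m) =
     (relabel \<pi> ` fst s', (snd s' + (\<Sum>j | South j \<in> fst s'. a j)) mod m)"
  then have "fst s = fst s'" by (simp add: inj_image_eq_iff[OF inj_relabel[OF assms(2)]])
  then show "s = s'" by (rule diagrams_inj_fst[OF assms(1) s(1,2)])
qed

lemma sum_South_relabel:
  assumes "inj \<pi>"
  shows "(\<Sum>j | South j \<in> relabel \<pi> ` e. a j) = (\<Sum>j | South j \<in> e. a (\<pi> j))"
proof -
  have "{j. South j \<in> relabel \<pi> ` e} = \<pi> ` {j. South j \<in> e}"
  proof (intro equalityI subsetI)
    fix j assume "j \<in> {j. South j \<in> relabel \<pi> ` e}"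
    then obtain u where "u \<in> e" "South j = relabel \<pi> u" by auto
    then show "j \<in> \<pi> ` {j. South j \<in> e}" by (cases u) auto
  qed (auto simp: South_in_relabel_image[OF assms])
  then show ?thesis
    by (simp add: sum.reindex inj_on_subset[OF assms])
qed

text \<open>The multiplication rule of the wreath product of a cyclic group with the symmetric
  group: the second family of labels is read at the nodes to which the first permutation has moved
  the strands.\<close>

lemma twist_twist:
  assumes "inj \<pi>'"
  shows "twist m \<pi> a (twist m \<pi>' a' D) = twist m (\<pi> \<circ> \<pi>') (\<lambda>j. a' j + a (\<pi>' j)) D"
  unfolding twist_def image_image
proof (rule image_cong[OF refl])
  fix s
  have "((snd s + (\<Sum>j | South j \<in> fst s. a' j)) mod m + (\<Sum>j | South j \<in> relabel \<pi>' ` fst s. a j)) mod m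
     = (snd s + (\<Sum>j | South j \<in> fst s. a' j + a (\<pi>' j))) mod m"
    by (simp add: sum_South_relabel[OF assms] sum.distrib mod_add_left_eq add.assoc)
  then show "(relabel \<pi> ` fst (relabel \<pi>' ` fst s, (snd s + (\<Sum>j | South j \<in> fst s. a' j)) mod m),
     (snd (relabel \<pi>' ` fst s, (snd s + (\<Sum>j | South j \<in> fst s. a' j)) mod m) +
       (\<Sum>j | South j \<in> fst (relabel \<pi>' ` fst s, (snd s + (\<Sum>j | South j \<in> fst s. a' j)) mod m). a j)) mod m) =
     (relabel (\<pi> \<circ> \<pi>') ` fst s, (snd s + (\<Sum>j | South j \<in> fst s. a' j + a (\<pi>' j))) mod m)"
    by (simp add: image_image)
qed

lemma twist_trivial:
  assumes D: "D \<in> diagrams m n b"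
    and "\<And>j. j \<in> {1..b} \<Longrightarrow> \<pi> j = j" "\<And>j. j \<in> {1..b} \<Longrightarrow> m dvd a j"
  shows "twist m \<pi> a D = D"
proof -
  have "(relabel \<pi> ` fst s, (snd s + (\<Sum>j | South j \<in> fst s. a j)) mod m) = s" if s: "s \<in> D" for s
  proof -
    have sub: "fst s \<subseteq> nodes n b" by (rule diagrams_strand(1)[OF D s])
    have "relabel \<pi> u = u" if "u \<in> fst s" for u
      using that sub assms(2) by (cases u) (auto simp: nodes_def)
    then have "relabel \<pi> ` fst s = fst s" by simp
    moreover have "m dvd (\<Sum>j | South j \<in> fst s. a j)"
      using sub assms(3) by (intro dvd_sum) (auto simp: nodes_def)
    ultimately show ?thesis
      using diagrams_strand(3)[OF D s] by (auto elim!: dvdE)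
  qed
  then show ?thesis by (simp add: twist_def)
qed

text \<open>Every southern node lies on exactly one strand. The set \<open>A\<close> is left general
  because it is later the set of southern ends of a single component.\<close>

lemma sum_over_strands_South:
  fixes a :: "nat \<Rightarrow> nat"
  assumes D: "D \<in> diagrams m n b" and A: "A \<subseteq> {1..b}"
  shows "(\<Sum>s\<in>D. \<Sum>j | South j \<in> fst s \<and> j \<in> A. a j) = (\<Sum>j\<in>A. a j)"
proof -
  have "sum a (\<Union>s\<in>D. {j. South j \<in> fst s \<and> j \<in> A}) = (\<Sum>s\<in>D. \<Sum>j | South j \<in> fst s \<and> j \<in> A. a j)"
  proof (rule sum.UNION_disjoint)
    show "\<forall>s\<in>D. \<forall>s'\<in>D. s \<noteq> s' \<longrightarrow>
      {j. South j \<in> fst s \<and> j \<in> A} \<inter> {j. South j \<in> fst s' \<and> j \<in> A} = {}"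
      using diagrams_unique[OF D] by (metis (no_types, lifting) disjoint_iff mem_Collect_eq)
  qed (use finite_diagram[OF D] finite_subset[OF A] in auto)
  moreover have "(\<Union>s\<in>D. {j. South j \<in> fst s \<and> j \<in> A}) = A"
  proof (intro equalityI subsetI)
    fix j assume j: "j \<in> A"
    then have "South j \<in> nodes n b" using A by (auto simp: nodes_def)
    from diagrams_ex1[OF D this] obtain s where "s \<in> D" "South j \<in> fst s" by auto
    then show "j \<in> (\<Union>s\<in>D. {j. South j \<in> fst s \<and> j \<in> A})" using j by auto
  qed auto
  ultimately show ?thesis by simp
qed

lemma label_sum_twist:
  assumes D: "D \<in> diagrams m n b" and \<pi>: "inj \<pi>"
  shows "label_sum (twist m \<pi> a D) mod m = (label_sum D + (\<Sum>j\<in>{1..b}. a j)) mod m"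
proof -
  have "label_sum (twist m \<pi> a D) = (\<Sum>s\<in>D. (snd s + (\<Sum>j | South j \<in> fst s. a j)) mod m)"
    unfolding label_sum_def twist_def by (simp add: sum.reindex[OF inj_on_twist[OF D \<pi>]])
  then have "label_sum (twist m \<pi> a D) mod m = (\<Sum>s\<in>D. snd s + (\<Sum>j | South j \<in> fst s. a j)) mod m"
    by (simp add: mod_sum_eq)
  also have "(\<Sum>s\<in>D. snd s + (\<Sum>j | South j \<in> fst s. a j)) =
      label_sum D + (\<Sum>s\<in>D. \<Sum>j | South j \<in> fst s \<and> j \<in> {1..b}. a j)"
  proof -
    have "{j. South j \<in> fst s} = {j. South j \<in> fst s \<and> j \<in> {1..b}}" if "s \<in> D" for s
      using diagrams_strand(1)[OF D that] by (auto simp: nodes_def)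
    then show ?thesis by (simp add: sum.distrib label_sum_def)
  qed
  also have "(\<Sum>s\<in>D. \<Sum>j | South j \<in> fst s \<and> j \<in> {1..b}. a j) = (\<Sum>j\<in>{1..b}. a j)"
    by (rule sum_over_strands_South[OF D order.refl])
  finally show ?thesis .
qed

text \<open>The counterpart of \<open>relabel\<close> on the glued graph. It fixes the top and
  middle rows, and so the edges that come from the upper diagram.\<close>

definition move_bot :: "(nat \<Rightarrow> nat) \<Rightarrow> vertex \<Rightarrow> vertex" where
  "move_bot \<pi> u = (case u of Bot j \<Rightarrow> Bot (\<pi> j) | _ \<Rightarrow> u)"

lemma move_bot_simps [simp]:
  "move_bot \<pi> (Top i) = Top i" "move_bot \<pi> (Mid i) = Mid i" "move_bot \<pi> (Bot i) = Bot (\<pi> i)"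
  by (simp_all add: move_bot_def)

lemma move_bot_upper [simp]: "move_bot \<pi> (upper u) = upper u"
  by (cases u) auto

lemma lower_relabel [simp]: "lower (relabel \<pi> u) = move_bot \<pi> (lower u)"
  by (cases u) auto

lemma bij_move_bot: assumes "bij \<pi>" shows "bij (move_bot \<pi>)"
proof (rule bijI)
  show "inj (move_bot \<pi>)"
    using bij_is_inj[OF assms]
    by (intro injI, rename_tac u v, case_tac u; case_tac v) (auto dest: injD)
  show "surj (move_bot \<pi>)"
    unfolding surj_def
  proof
    fix v show "\<exists>u. v = move_bot \<pi> u"
    proof (cases v)
      case (Bot j)
      obtain i where "\<pi> i = j" using bij_is_surj[OF assms] by (metis surjD)
      then show ?thesis using Bot by (intro exI[of _ "Bot i"]) simp
    qed (metis move_bot_simps)+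
  qed
qed

lemma glued_edges_twist: "glued_edges X (twist m \<pi> a D) = (`) (move_bot \<pi>) ` glued_edges X D"
  by (simp add: glued_edges_def twist_def image_Un image_image)

lemma components_twist:
  "bij \<pi> \<Longrightarrow> components X (twist m \<pi> a D) = (`) (move_bot \<pi>) ` components X D"
  by (simp add: components_eq glued_edges_twist graph_comps_image bij_move_bot)

lemma ends_move_bot: assumes "bij \<pi>" shows "ends (move_bot \<pi> ` C) = relabel \<pi> ` ends C"
proof (rule Set.set_eqI)
  have inj: "inj (move_bot \<pi>)" by (rule bij_is_inj[OF bij_move_bot[OF assms]])
  fix v obtain u where u: "v = relabel \<pi> u"
    using surj_relabel[OF bij_is_surj[OF assms]] by (metis surjD)
  show "v \<in> ends (move_bot \<pi> ` C) \<longleftrightarrow> v \<in> relabel \<pi> ` ends C"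
  proof (cases u)
    case (North i)
    then show ?thesis using inj_image_mem_iff[OF inj, of "Top i" C] by (simp add: u)
  next
    case (South j)
    then show ?thesis using inj_image_mem_iff[OF inj, of "Bot j" C]
      by (simp add: u South_in_relabel_image[OF bij_is_inj[OF assms]])
  qed
qed

text \<open>The twist adds \<open>a j\<close> to the strand of \<open>D\<close> ending in southern
  node \<open>j\<close>, and that strand lies in \<open>C\<close> exactly if the bottom vertex
  \<open>j\<close> does. So the increments collected in \<open>C\<close> are those at its southern
  ends.\<close>

lemma comp_label_twist:
  assumes X: "X \<in> diagrams m n b" and D: "D \<in> diagrams m b c" and C: "C \<in> components X D"
    and \<pi>: "bij \<pi>"
  shows "comp_label m X (twist m \<pi> a D) (move_bot \<pi> ` C) =
    (comp_label m X D C + (\<Sum>j | South j \<in> ends C. a j)) mod m"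
proof -
  have inj: "inj (move_bot \<pi>)" by (rule bij_is_inj[OF bij_move_bot[OF \<pi>]])
  have up: "upper ` e \<subseteq> move_bot \<pi> ` C \<longleftrightarrow> upper ` e \<subseteq> C" for e
    using inj_image_subset_iff[OF inj, of "upper ` e" C] by (simp add: image_image)
  have lo: "lower ` relabel \<pi> ` e \<subseteq> move_bot \<pi> ` C \<longleftrightarrow> lower ` e \<subseteq> C" for e
    using inj_image_subset_iff[OF inj, of "lower ` e" C] by (simp add: image_image)
  let ?S = "{s. s \<in> D \<and> lower ` fst s \<subseteq> C}"
  let ?f = "\<lambda>s. (relabel \<pi> ` fst s, (snd s + (\<Sum>j | South j \<in> fst s. a j)) mod m)"
  have "{s. s \<in> twist m \<pi> a D \<and> lower ` fst s \<subseteq> move_bot \<pi> ` C} = ?f ` ?S"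
  proof (intro equalityI subsetI)
    fix r assume "r \<in> {s. s \<in> twist m \<pi> a D \<and> lower ` fst s \<subseteq> move_bot \<pi> ` C}"
    then obtain s where s: "s \<in> D" "r = ?f s" "lower ` relabel \<pi> ` fst s \<subseteq> move_bot \<pi> ` C"
      by (auto simp: twist_def)
    then show "r \<in> ?f ` ?S" using lo[of "fst s"] by simp
  next
    fix r assume "r \<in> ?f ` ?S"
    then obtain s where s: "s \<in> D" "r = ?f s" "lower ` fst s \<subseteq> C" by auto
    then have "lower ` relabel \<pi> ` fst s \<subseteq> move_bot \<pi> ` C" using lo[of "fst s"] by simp
    then show "r \<in> {s. s \<in> twist m \<pi> a D \<and> lower ` fst s \<subseteq> move_bot \<pi> ` C}"
      using s by (simp add: twist_def)
  qed
  then have "(\<Sum>s | s \<in> twist m \<pi> a D \<and> lower ` fst s \<subseteq> move_bot \<pi> ` C. snd s) = sum snd (?f ` ?S)"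
    by simp
  also have "\<dots> = (\<Sum>s\<in>?S. (snd s + (\<Sum>j | South j \<in> fst s. a j)) mod m)"
    by (subst sum.reindex) (auto intro: inj_on_subset[OF inj_on_twist[OF D bij_is_inj[OF \<pi>]]])
  finally have 1: "(\<Sum>s | s \<in> twist m \<pi> a D \<and> lower ` fst s \<subseteq> move_bot \<pi> ` C. snd s) =
     (\<Sum>s\<in>?S. (snd s + (\<Sum>j | South j \<in> fst s. a j)) mod m)" .
  have 2: "(\<Sum>s\<in>?S. \<Sum>j | South j \<in> fst s. a j) = (\<Sum>j | South j \<in> ends C. a j)"
  proof -
    let ?A = "{j. South j \<in> ends C}"
    have A: "?A \<subseteq> {1..c}"
    proof
      fix j assume "j \<in> ?A"
      then have "South j \<in> nodes n c" using ends_subset_nodes[OF X D C] by blast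
      then show "j \<in> {1..c}" by (auto simp: nodes_def)
    qed
    have "(\<Sum>j\<in>?A. a j) = (\<Sum>s\<in>D. \<Sum>j | South j \<in> fst s \<and> j \<in> ?A. a j)"
      by (rule sum_over_strands_South[OF D A, symmetric])
    also have "\<dots> = (\<Sum>s\<in>?S. \<Sum>j | South j \<in> fst s \<and> j \<in> ?A. a j)"
    proof (rule sum.mono_neutral_right)
      \<comment> \<open>A strand with one vertex in a component lies in it entirely, so strands
        outside \<open>?S\<close> have no bottom vertex in \<open>C\<close>.\<close>
      show "\<forall>s\<in>D - ?S. (\<Sum>j | South j \<in> fst s \<and> j \<in> ?A. a j) = 0"
      proof
        fix s assume s: "s \<in> D - ?S"
        have "{j. South j \<in> fst s \<and> j \<in> ?A} = {}"
          using component_lower[OF C, of s] s by fastforce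
        then show "(\<Sum>j | South j \<in> fst s \<and> j \<in> ?A. a j) = 0" by (simp only: sum.empty)
      qed
    qed (use finite_diagram[OF D] in auto)
    also have "\<dots> = (\<Sum>s\<in>?S. \<Sum>j | South j \<in> fst s. a j)"
    proof (rule sum.cong[OF refl])
      fix s assume "s \<in> ?S"
      then have "{j. South j \<in> fst s \<and> j \<in> ?A} = {j. South j \<in> fst s}" by force
      then show "(\<Sum>j | South j \<in> fst s \<and> j \<in> ?A. a j) = (\<Sum>j | South j \<in> fst s. a j)" by simp
    qed
    finally show ?thesis by simp
  qed
  have "(\<Sum>s\<in>?S. (snd s + (\<Sum>j | South j \<in> fst s. a j)) mod m) mod m =
      ((\<Sum>s\<in>?S. snd s) + (\<Sum>j | South j \<in> ends C. a j)) mod m"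
    by (simp add: mod_sum_eq sum.distrib 2)
  then show ?thesis
    unfolding comp_label_def up 1
    by (metis (no_types, lifting) add.assoc mod_add_left_eq mod_add_right_eq)
qed

text \<open>Twisting changes the glued graph only by \<open>move_bot\<close>, so components, ends
  and labels of the two concatenations correspond one to one.\<close>

lemma compose_twist:
  assumes X: "X \<in> diagrams m n b" and D: "D \<in> diagrams m b c" and \<pi>: "bij \<pi>"
  shows "compose m X (twist m \<pi> a D) = twist m \<pi> a (compose m X D)"
proof -
  let ?K = "{C \<in> components X D. ends C \<noteq> {}}"
  have cmp: "compose m X Y = (\<lambda>C. (ends C, comp_label m X Y C)) ` {C \<in> components X Y. ends C \<noteq> {}}" for Y
    by (auto simp: compose_def)
  have "{C \<in> components X (twist m \<pi> a D). ends C \<noteq> {}} = (`) (move_bot \<pi>) ` ?K"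
    unfolding components_twist[OF \<pi>] by (auto simp: ends_move_bot[OF \<pi>])
  then have "compose m X (twist m \<pi> a D) =
      (\<lambda>C. (relabel \<pi> ` ends C, comp_label m X (twist m \<pi> a D) (move_bot \<pi> ` C))) ` ?K"
    unfolding cmp[of "twist m \<pi> a D"] by (simp add: image_image ends_move_bot[OF \<pi>])
  also have "\<dots> = (\<lambda>C. (relabel \<pi> ` ends C, (comp_label m X D C + (\<Sum>j | South j \<in> ends C. a j)) mod m)) ` ?K"
    by (rule image_cong[OF refl]) (simp add: comp_label_twist[OF X D _ \<pi>] del: South_in_ends)
  also have "\<dots> = twist m \<pi> a (compose m X D)"
    unfolding cmp[of D] twist_def image_image by simp
  finally show ?thesis .
qed

text \<open>A closed loop has no bottom vertex, so it receives no increment from \<open>a\<close>,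
  and \<open>move_bot\<close> matches the loops on both sides.\<close>

lemma loop_coeff_twist:
  assumes X: "X \<in> diagrams m n b" and D: "D \<in> diagrams m b c" and \<pi>: "bij \<pi>"
  shows "loop_coeff m p \<delta> X (twist m \<pi> a D) = loop_coeff m p \<delta> X D"
proof -
  have inj: "inj (move_bot \<pi>)" by (rule bij_is_inj[OF bij_move_bot[OF \<pi>]])
  have *: "{C. C \<in> components X (twist m \<pi> a D) \<and> ends C = {}} =
      (`) (move_bot \<pi>) ` {C. C \<in> components X D \<and> ends C = {}}"
    unfolding components_twist[OF \<pi>] by (auto simp: ends_move_bot[OF \<pi>])
  have inj': "inj_on ((`) (move_bot \<pi>)) S" for S
    by (rule inj_onI) (simp add: inj_image_eq_iff[OF inj])
  have "comp_label m X (twist m \<pi> a D) (move_bot \<pi> ` C) = comp_label m X D C"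
    if "C \<in> components X D" "ends C = {}" for C
    using comp_label_twist[OF X D that(1) \<pi>, of a] that(2) by (simp add: comp_label_def del: South_in_ends)
  then show ?thesis
    unfolding loop_coeff_def * by (subst prod.reindex[OF inj']) (auto intro!: prod.cong)
qed

lemma idd_in_diagrams: "0 < m \<Longrightarrow> idd b \<in> diagrams m b b"
proof -
  assume m: "0 < m"
  have "\<exists>!s. s \<in> idd b \<and> u \<in> fst s" if u: "u \<in> nodes b b" for u
  proof -
    obtain i where i: "u = North i \<or> u = South i" by (cases u) auto
    show ?thesis
      by (rule ex1I[of _ "({North i, South i}, 0)"]) (use i u in \<open>auto simp: idd_def nodes_def\<close>)
  qed
  then show ?thesis
    using m by (auto simp: diagrams_def idd_def nodes_def)
qed

text \<open>Every strand of \<open>D\<close> is prolonged by the identity strands at its southern ends.\<close>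

lemma compose_idd:
  assumes m: "0 < m" and D: "D \<in> diagrams m n b"
  shows "compose m D (idd b) = D"
proof -
  define K where "K s = upper ` fst s \<union> Bot ` {j. South j \<in> fst s}" for s :: "node set \<times> nat"
  have idm: "idd b \<in> diagrams m b b" by (rule idd_in_diagrams[OF m])
  have upK: "upper u \<in> K s \<longleftrightarrow> u \<in> fst s" for u s
  proof -
    have "upper u \<notin> Bot ` {j. South j \<in> fst s}" by (cases u) auto
    then show ?thesis using inj_image_mem_iff[OF inj_upper, of u "fst s"] by (simp add: K_def)
  qed
  have botK: "Bot j \<in> K s \<longleftrightarrow> South j \<in> fst s" for j s
  proof -
    have "Bot j \<noteq> upper u" for u by (cases u) auto
    then show ?thesis by (auto simp: K_def)
  qed
  have midK: "Mid j \<in> K s \<longleftrightarrow> South j \<in> fst s" for j s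
    using upK[of "South j" s] by simp
  have topK: "Top j \<in> K s \<longleftrightarrow> North j \<in> fst s" for j s
    using upK[of "North j" s] by simp
  have endsK: "ends (K s) = fst s" for s
  proof (rule Set.set_eqI)
    fix u show "u \<in> ends (K s) \<longleftrightarrow> u \<in> fst s" by (cases u) (auto simp: botK topK)
  qed
  have comps: "components D (idd b) = K ` D"
    unfolding components_eq
  proof (rule graph_comps_eqI)
    show "C \<noteq> {}" if "C \<in> K ` D" for C
      using that diagrams_strand(5)[OF D] by (auto simp: K_def)
    show "\<Union> (K ` D) = \<Union> (glued_edges D (idd b))"
    proof (rule Set.set_eqI)
      fix v
      have N: "(\<exists>s\<in>D. u \<in> fst s) \<longleftrightarrow> u \<in> nodes n b" for u
        using Union_diagram[OF D] by blast
      have "v \<in> \<Union> (K ` D) \<longleftrightarrow> v \<in> Top ` {1..n} \<union> Mid ` {1..b} \<union> Bot ` {1..b}"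
        by (cases v) (auto simp: topK midK botK N nodes_def)
      then show "v \<in> \<Union> (K ` D) \<longleftrightarrow> v \<in> \<Union> (glued_edges D (idd b))"
        unfolding Union_glued_edges[OF D idm] .
    qed
    show "e \<subseteq> C" if e: "e \<in> glued_edges D (idd b)" and C: "C \<in> K ` D" and ne: "e \<inter> C \<noteq> {}" for e C
    proof -
      obtain s where s: "s \<in> D" "C = K s" using C by auto
      consider r where "r \<in> D" "e = upper ` fst r" | i where "e = {Mid i, Bot i}"
        using e by (auto simp: glued_edges_def idd_def)
      then show ?thesis
      proof cases
        case 1
        then obtain u where u: "u \<in> fst r" "upper u \<in> K s" using ne s by blast
        then have "u \<in> fst s" by (simp only: upK)
        with u have "r = s" using diagrams_unique[OF D 1(1) s(1)] by simp
        then show ?thesis by (simp add: 1 s K_def)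
      next
        case 2
        then show ?thesis using ne by (auto simp: s midK botK)
      qed
    qed
    show "(v, w) \<in> edge_conn (glued_edges D (idd b))" if C: "C \<in> K ` D" "v \<in> C" "w \<in> C" for C v w
    proof -
      obtain s where s: "s \<in> D" "C = K s" using C by auto
      have es: "upper ` fst s \<in> glued_edges D (idd b)" using s by (auto simp: glued_edges_def)
      \<comment> \<open>Every vertex of \<open>K s\<close> is connected to one on the copy of
        \<open>s\<close> in the upper diagram; this copy is a single edge and joins any two of
        them.\<close>
      have red: "\<exists>u\<in>fst s. (v, upper u) \<in> edge_conn (glued_edges D (idd b))" if v: "v \<in> K s" for v
      proof -
        consider u where "u \<in> fst s" "v = upper u" | j where "South j \<in> fst s" "v = Bot j"
          using v by (auto simp: K_def)
        then show ?thesis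
        proof cases
          case 1
          have "(v, upper u) \<in> edge_conn (glued_edges D (idd b))" by (simp add: 1)
          then show ?thesis using 1(1) by blast
        next
          case 2
          then have "j \<in> {1..b}" using diagrams_strand(1)[OF D s(1)] by (auto simp: nodes_def)
          then have "({North j, South j}, 0) \<in> idd b" by (auto simp: idd_def)
          then have "lower ` {North j, South j} \<in> glued_edges D (idd b)"
            unfolding glued_edges_def by (intro UnI2 image_eqI[of _ _ "({North j, South j}, 0)"]) auto
          then have "(v, upper (South j)) \<in> edge_conn (glued_edges D (idd b))"
            by (rule edge_conn_edge) (simp_all add: 2)
          then show ?thesis using 2 by blast
        qed
      qed
      from red[of v] obtain u where u: "u \<in> fst s" "(v, upper u) \<in> edge_conn (glued_edges D (idd b))"
        using C s by blast
      from red[of w] obtain u' where u': "u' \<in> fst s" "(w, upper u') \<in> edge_conn (glued_edges D (idd b))"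
        using C s by blast
      have "(upper u, upper u') \<in> edge_conn (glued_edges D (idd b))"
        by (rule edge_conn_edge[OF es]) (use u u' in auto)
      from edge_conn_trans[OF edge_conn_trans[OF u(2) this] edge_conn_sym[OF u'(2)]]
      show ?thesis .
    qed
  qed
  have lab: "comp_label m D (idd b) (K s) = snd s" if s: "s \<in> D" for s
  proof -
    have "{r. r \<in> D \<and> upper ` fst r \<subseteq> K s} = {s}"
    proof (intro equalityI subsetI)
      fix r assume r: "r \<in> {r. r \<in> D \<and> upper ` fst r \<subseteq> K s}"
      then obtain u where "u \<in> fst r" using diagrams_strand(5)[OF D] by blast
      moreover from this have "u \<in> fst s" using r upK by blast
      ultimately show "r \<in> {s}" using diagrams_unique[OF D _ s] r by simp
    qed (use s in \<open>auto simp: upK\<close>)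
    moreover have "(\<Sum>r | r \<in> idd b \<and> lower ` fst r \<subseteq> K s. snd r) = 0"
      by (rule sum.neutral) (auto simp: idd_def)
    ultimately show ?thesis
      using diagrams_strand(3)[OF D s] by (simp add: comp_label_def)
  qed
  have "compose m D (idd b) = (\<lambda>C. (ends C, comp_label m D (idd b) C)) ` {C \<in> K ` D. ends C \<noteq> {}}"
    unfolding comps[symmetric] by (auto simp: compose_def)
  also have "{C \<in> K ` D. ends C \<noteq> {}} = K ` D"
    using diagrams_strand(5)[OF D] by (auto simp: endsK)
  also have "(\<lambda>C. (ends C, comp_label m D (idd b) C)) ` K ` D = (\<lambda>s. s) ` D"
    unfolding image_image by (rule image_cong[OF refl]) (simp add: endsK lab)
  finally show ?thesis by simp
qed

text \<open>The twist commutes past the concatenation, and what remains is \<open>D\<close> on top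
  of the identity. With \<open>Ggrp_eq_twist\<close> this turns right multiplication by group
  elements into arithmetic with permutations and labels.\<close>

lemma compose_twist_idd:
  "0 < m \<Longrightarrow> D \<in> diagrams m n b \<Longrightarrow> \<pi> permutes {1..b} \<Longrightarrow>
   compose m D (twist m \<pi> a (idd b)) = twist m \<pi> a D"
  by (simp add: compose_twist[OF _ idd_in_diagrams permutes_bij] compose_idd)

section \<open>The group \<open>G(m,1,N)\<close>\<close>

lemma strand_cases:
  assumes "D \<in> diagrams m n b" "s \<in> D"
  obtains (north) i j where "fst s = {North i, North j}" "i \<noteq> j"
  | (south) i j where "fst s = {South i, South j}" "i \<noteq> j"
  | (through) i j where "fst s = {North i, South j}"
proof -
  obtain u v where uv: "fst s = {u, v}" "u \<noteq> v"
    using diagrams_strand(2)[OF assms] by (auto simp: card_2_iff)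
  show ?thesis
  proof (cases u)
    case u: (North i)
    show ?thesis by (cases v) (use uv u north through in auto)
  next
    case u: (South i)
    show ?thesis
    proof (cases v)
      case (North j)
      then show ?thesis using uv u through[of j i] by auto
    qed (use uv u south in auto)
  qed
qed

lemma Ggrp_subset_diagrams: "g \<in> Ggrp m p n \<Longrightarrow> g \<in> diagrams m n n"
  by (simp add: Ggrp_def)

lemma Ggrp_mono: "g \<in> Ggrp m p n \<Longrightarrow> g \<in> Ggrp m 1 n"
  by (simp add: Ggrp_def)

lemma idd_in_Ggrp: "0 < m \<Longrightarrow> idd n \<in> Ggrp m 1 n"
  using idd_in_diagrams[of m n] unfolding Ggrp_def through_strands_def idd_def by auto blast

lemma through_strands_twist_self:
  assumes "through_strands D = D" shows "through_strands (twist m \<pi> a D) = twist m \<pi> a D"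
proof -
  have "\<exists>i j. fst s = {North i, South j}" if st: "s \<in> twist m \<pi> a D" for s
  proof -
    obtain r where r: "r \<in> D" "s = (relabel \<pi> ` fst r, (snd r + (\<Sum>j | South j \<in> fst r. a j)) mod m)"
      using st unfolding twist_def by (elim imageE)
    then have "r \<in> through_strands D" by (simp only: assms)
    then obtain i j where "fst r = {North i, South j}" by (auto simp: through_strands_def)
    then have "fst s = {North i, South (\<pi> j)}" using r by simp
    then show ?thesis by blast
  qed
  then show ?thesis by (auto simp: through_strands_def)
qed

lemma twist_in_Ggrp:
  assumes "0 < m" "\<pi> permutes {1..n}" "g \<in> Ggrp m 1 n"
  shows "twist m \<pi> a g \<in> Ggrp m 1 n"
  using assms twist_in_diagrams[OF assms(1,2)] through_strands_twist_self
  by (simp add: Ggrp_def)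

text \<open>All strands run from north to south, so each northern node determines a southern one and
  a label. Uniqueness of the strand at a southern node makes this map injective, hence a
  permutation.\<close>

lemma Ggrp_eq_twist:
  assumes g: "g \<in> Ggrp m 1 n"
  obtains \<pi> a where "\<pi> permutes {1..n}" "g = twist m \<pi> a (idd n)"
proof -
  have gd: "g \<in> diagrams m n n" and gt: "through_strands g = g" using g by (auto simp: Ggrp_def)
  have shape: "\<exists>i j. fst s = {North i, South j}" if "s \<in> g" for s
    using that gt by (auto simp: through_strands_def)
  have "\<exists>j c. ({North i, South j}, c) \<in> g \<and> j \<in> {1..n}" if i: "i \<in> {1..n}" for i
  proof -
    have "North i \<in> nodes n n" using i by (simp add: nodes_def)
    from diagrams_ex1[OF gd this] obtain s where s: "s \<in> g" "North i \<in> fst s" by auto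
    then obtain j where j: "fst s = {North i, South j}" using shape[OF s(1)] by auto
    then have "South j \<in> nodes n n" using diagrams_strand(1)[OF gd s(1)] by simp
    then have "j \<in> {1..n}" by (auto simp: nodes_def)
    then show ?thesis using s j by (metis prod.collapse)
  qed
  then have "\<forall>i\<in>{1..n}. \<exists>j c. ({North i, South j}, c) \<in> g \<and> j \<in> {1..n}" by blast
  then obtain h where "\<forall>i\<in>{1..n}. \<exists>c. ({North i, South (h i)}, c) \<in> g \<and> h i \<in> {1..n}"
    by (rule bchoice[THEN exE])
  then obtain a where ha: "\<forall>i\<in>{1..n}. ({North i, South (h i)}, a i) \<in> g \<and> h i \<in> {1..n}"
    by (rule bchoice[THEN exE])
  define \<pi> where "\<pi> i = (if i \<in> {1..n} then h i else i)" for i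
  have mem: "({North i, South (\<pi> i)}, a i) \<in> g" if "i \<in> {1..n}" for i
    using ha that by (simp add: \<pi>_def)
  have inj: "inj_on \<pi> {1..n}"
  proof (rule inj_onI)
    fix i i' assume i: "i \<in> {1..n}" "i' \<in> {1..n}" "\<pi> i = \<pi> i'"
    have "({North i, South (\<pi> i)}, a i) = ({North i', South (\<pi> i')}, a i')"
      by (rule diagrams_unique[OF gd mem[OF i(1)] mem[OF i(2)], of "South (\<pi> i)"]) (simp_all add: i)
    then show "i = i'" by (auto simp: doubleton_eq_iff)
  qed
  have sub: "\<pi> ` {1..n} \<subseteq> {1..n}" using ha by (auto simp: \<pi>_def)
  have perm: "\<pi> permutes {1..n}"
    by (rule bij_imp_permutes)
       (use inj endo_inj_surj[OF _ sub inj] in \<open>auto simp: bij_betw_def \<pi>_def\<close>)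
  have tw: "twist m \<pi> a (idd n) = {({North i, South (\<pi> i)}, a i mod m) | i. i \<in> {1..n}}"
  proof -
    have "idd n = (\<lambda>i. ({North i, South i}, 0)) ` {1..n}" by (auto simp: idd_def)
    then have "twist m \<pi> a (idd n) = (\<lambda>i. ({North i, South (\<pi> i)}, a i mod m)) ` {1..n}"
      by (simp add: twist_def image_image)
    then show ?thesis by auto
  qed
  have am: "a i mod m = a i" if "i \<in> {1..n}" for i
    using diagrams_strand(3)[OF gd mem[OF that]] by simp
  have "g = twist m \<pi> a (idd n)"
    unfolding tw
  proof (intro equalityI subsetI)
    fix s assume s: "s \<in> g"
    then obtain i j where ij: "fst s = {North i, South j}" using shape by blast
    then have "North i \<in> nodes n n" using diagrams_strand(1)[OF gd s] by simp
    then have i: "i \<in> {1..n}" by (auto simp: nodes_def)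
    have "s = ({North i, South (\<pi> i)}, a i)"
      by (rule diagrams_unique[OF gd s mem[OF i], of "North i"]) (simp_all add: ij)
    then show "s \<in> {({North i, South (\<pi> i)}, a i mod m) | i. i \<in> {1..n}}"
      using i am by auto
  qed (use mem am in auto)
  then show ?thesis using perm that by blast
qed

lemma compose_in_Ggrp:
  assumes "0 < m" "g \<in> Ggrp m 1 n" "h \<in> Ggrp m 1 n" shows "compose m g h \<in> Ggrp m 1 n"
proof -
  obtain \<pi> a where h: "\<pi> permutes {1..n}" "h = twist m \<pi> a (idd n)" by (rule Ggrp_eq_twist[OF assms(3)])
  show ?thesis
    using twist_in_Ggrp[OF assms(1) h(1) assms(2)]
    by (simp add: h(2) compose_twist_idd[OF assms(1) Ggrp_subset_diagrams[OF assms(2)] h(1)])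
qed

lemma compose_Ggrp_in_diagrams:
  assumes "0 < m" "D \<in> diagrams m b n" "h \<in> Ggrp m 1 n" shows "compose m D h \<in> diagrams m b n"
  by (rule compose_in_diagrams[OF assms(1,2) Ggrp_subset_diagrams[OF assms(3)]])

lemma compose_Ggrp_assoc:
  assumes m: "0 < m" and D: "D \<in> diagrams m b n" and g: "g \<in> Ggrp m 1 n" and h: "h \<in> Ggrp m 1 n"
  shows "compose m (compose m D g) h = compose m D (compose m g h)"
proof -
  obtain \<pi> a where ga: "\<pi> permutes {1..n}" "g = twist m \<pi> a (idd n)" by (rule Ggrp_eq_twist[OF g])
  obtain \<pi>' a' where ha: "\<pi>' permutes {1..n}" "h = twist m \<pi>' a' (idd n)" by (rule Ggrp_eq_twist[OF h])
  have "compose m (compose m D g) h = twist m \<pi>' a' (compose m D g)"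
    unfolding ha(2) by (rule compose_twist_idd[OF m compose_Ggrp_in_diagrams[OF m D g] ha(1)])
  also have "\<dots> = compose m D (twist m \<pi>' a' g)"
    by (rule compose_twist[OF D Ggrp_subset_diagrams[OF g] permutes_bij[OF ha(1)], symmetric])
  also have "twist m \<pi>' a' g = compose m g h"
    unfolding ha(2) by (rule compose_twist_idd[OF m Ggrp_subset_diagrams[OF g] ha(1), symmetric])
  finally show ?thesis .
qed

text \<open>The instance of associativity behind the comparison of the actions. A group element at
  the bottom closes no loop, so the coefficients agree as well.\<close>

lemma compose_compose_Ggrp:
  assumes m: "0 < m" and X: "X \<in> diagrams m c b" and D: "D \<in> diagrams m b n" and g: "g \<in> Ggrp m 1 n"
  shows "compose m X (compose m D g) = compose m (compose m X D) g"
    and "loop_coeff m p \<delta> X (compose m D g) = loop_coeff m p \<delta> X D"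
proof -
  obtain \<pi> a where ga: "\<pi> permutes {1..n}" "g = twist m \<pi> a (idd n)" by (rule Ggrp_eq_twist[OF g])
  have *: "compose m D g = twist m \<pi> a D"
    unfolding ga(2) by (rule compose_twist_idd[OF m D ga(1)])
  have **: "compose m (compose m X D) g = twist m \<pi> a (compose m X D)"
    unfolding ga(2) by (rule compose_twist_idd[OF m compose_in_diagrams[OF m X D] ga(1)])
  show "compose m X (compose m D g) = compose m (compose m X D) g"
    unfolding * ** by (rule compose_twist[OF X D permutes_bij[OF ga(1)]])
  show "loop_coeff m p \<delta> X (compose m D g) = loop_coeff m p \<delta> X D"
    unfolding * by (rule loop_coeff_twist[OF X D permutes_bij[OF ga(1)]])
qed

lemma label_sum_idd [simp]: "label_sum (idd n) = 0"
  unfolding label_sum_def by (rule sum.neutral) (auto simp: idd_def)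

lemma label_sum_compose_Ggrp:
  assumes m: "0 < m" and D: "D \<in> diagrams m b n" and g: "g \<in> Ggrp m 1 n"
  shows "label_sum (compose m D g) mod m = (label_sum D + label_sum g) mod m"
proof -
  obtain \<pi> a where ga: "\<pi> permutes {1..n}" "g = twist m \<pi> a (idd n)" by (rule Ggrp_eq_twist[OF g])
  have "label_sum g mod m = (\<Sum>j\<in>{1..n}. a j) mod m"
    using label_sum_twist[OF idd_in_diagrams[OF m] permutes_inj[OF ga(1)], of a] by (simp add: ga(2))
  then have "(label_sum D + label_sum g) mod m = (label_sum D + (\<Sum>j\<in>{1..n}. a j)) mod m"
    by (rule mod_add_cong[OF refl])
  then show ?thesis
    unfolding ga(2) compose_twist_idd[OF m D ga(1)]
    by (simp add: label_sum_twist[OF D permutes_inj[OF ga(1)]])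
qed

lemma Ggrp_inverse:
  assumes m: "0 < m" and g: "g \<in> Ggrp m 1 n"
  obtains h where "h \<in> Ggrp m 1 n" "compose m g h = idd n" "compose m h g = idd n"
proof -
  obtain \<pi> a where ga: "\<pi> permutes {1..n}" "g = twist m \<pi> a (idd n)" by (rule Ggrp_eq_twist[OF g])
  let ?\<kappa> = "inv_into UNIV \<pi>"
  have \<kappa>: "?\<kappa> permutes {1..n}" by (rule permutes_inv[OF ga(1)])
  \<comment> \<open>Multiplication by \<open>m - 1\<close> is negation modulo m without leaving the
    natural numbers; the index goes back along the permutation to the strand whose label is
    cancelled.\<close>
  let ?b = "\<lambda>j. (m - 1) * a (?\<kappa> j)"
  let ?h = "twist m ?\<kappa> ?b (idd n)"
  have h: "?h \<in> Ggrp m 1 n" by (rule twist_in_Ggrp[OF m \<kappa> idd_in_Ggrp[OF m]])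
  have ida: "idd n \<in> diagrams m n n" by (rule idd_in_diagrams[OF m])
  have kp: "?\<kappa> (\<pi> j) = j" "\<pi> (?\<kappa> j) = j" for j
    using permutes_inverses[OF ga(1)] by auto
  have dv: "x + (m - 1) * x = m * x" "(m - 1) * x + x = m * x" for x
    using m by (cases m; simp)+
  have "compose m g ?h = twist m ?\<kappa> ?b g"
    by (rule compose_twist_idd[OF m Ggrp_subset_diagrams[OF g] \<kappa>])
  also have "\<dots> = twist m (?\<kappa> \<circ> \<pi>) (\<lambda>j. a j + ?b (\<pi> j)) (idd n)"
    unfolding ga(2) by (rule twist_twist[OF permutes_inj[OF ga(1)]])
  also have "\<dots> = idd n"
    by (rule twist_trivial[OF ida]) (simp_all add: kp dv del: One_nat_def)
  finally have 1: "compose m g ?h = idd n" .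
  have "compose m ?h g = twist m \<pi> a ?h"
    unfolding ga(2) by (rule compose_twist_idd[OF m Ggrp_subset_diagrams[OF h] ga(1)])
  also have "\<dots> = twist m (\<pi> \<circ> ?\<kappa>) (\<lambda>j. ?b j + a (?\<kappa> j)) (idd n)"
    by (rule twist_twist[OF permutes_inj[OF \<kappa>]])
  also have "\<dots> = idd n"
    by (rule twist_trivial[OF ida]) (simp_all add: kp dv del: One_nat_def)
  finally have 2: "compose m ?h g = idd n" .
  show ?thesis using that h 1 2 by blast
qed

text \<open>The whole label is put on the first strand, which exists because \<open>n\<close> is
  positive.\<close>

lemma Ggrp_with_label:
  assumes m: "0 < m" and n: "0 < n"
  obtains g where "g \<in> Ggrp m 1 n" "label_sum g mod m = c mod m"
proof -
  let ?g = "twist m id (\<lambda>j. if j = 1 then c else 0) (idd n)"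
  have "?g \<in> Ggrp m 1 n" by (rule twist_in_Ggrp[OF m permutes_id idd_in_Ggrp[OF m]])
  moreover have "(\<Sum>j\<in>{1..n}. if j = 1 then c else 0) = c"
    using n by (simp add: sum.delta)
  then have "label_sum ?g mod m = c mod m"
    by (simp add: label_sum_twist[OF idd_in_diagrams[OF m] inj_on_id])
  ultimately show ?thesis using that by blast
qed

section \<open>Counting strands\<close>

lemma card_nodes_by_strands:
  assumes D: "D \<in> diagrams m n b" and A: "A \<subseteq> nodes n b"
  shows "card A = (\<Sum>s\<in>D. card (fst s \<inter> A))"
proof -
  have "A = (\<Union>s\<in>D. fst s \<inter> A)"
    using Union_diagram[OF D] A by auto
  moreover have "card (\<Union>s\<in>D. fst s \<inter> A) = (\<Sum>s\<in>D. card (fst s \<inter> A))"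
  proof (rule card_UN_disjoint)
    show "\<forall>s\<in>D. \<forall>s'\<in>D. s \<noteq> s' \<longrightarrow> (fst s \<inter> A) \<inter> (fst s' \<inter> A) = {}"
      using diagrams_unique[OF D] by (metis (no_types, lifting) disjoint_iff IntD1)
  qed (use finite_diagram[OF D] diagrams_strand(4)[OF D] in auto)
  ultimately show ?thesis by simp
qed

lemma north_arc_iff: "fst s = {North i, North j} \<Longrightarrow> s \<in> north_arcs D \<longleftrightarrow> s \<in> D"
  and south_arc_iff: "fst s = {South i, South j} \<Longrightarrow> s \<in> south_arcs D \<longleftrightarrow> s \<in> D"
  and through_strand_iff: "fst s = {North i, South j} \<Longrightarrow> s \<in> through_strands D \<longleftrightarrow> s \<in> D"
  by (auto simp: north_arcs_def south_arcs_def through_strands_def)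

lemma node_classes_disjoint:
  "fst s = {North i, North j} \<Longrightarrow> s \<notin> south_arcs D \<and> s \<notin> through_strands D"
  "fst s = {South i, South j} \<Longrightarrow> s \<notin> north_arcs D \<and> s \<notin> through_strands D"
  "fst s = {North i, South j} \<Longrightarrow> s \<notin> north_arcs D \<and> s \<notin> south_arcs D"
  by (auto simp: north_arcs_def south_arcs_def through_strands_def doubleton_eq_iff)

lemma count_north:
  assumes D: "D \<in> diagrams m n b"
  shows "n = 2 * card (north_arcs D) + card (through_strands D)"
proof -
  have fin: "finite D" by (rule finite_diagram[OF D])
  have "card (fst s \<inter> North ` {1..n}) = (if s \<in> north_arcs D then 2 else 0) + (if s \<in> through_strands D then 1 else 0)"
    if s: "s \<in> D" for s
  proof (cases rule: strand_cases[OF D s, case_names north south through])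
    case (north i j)
    then have "fst s \<inter> North ` {1..n} = {North i, North j}"
      using diagrams_strand(1)[OF D s] by (auto simp: nodes_def)
    then show ?thesis using north s by (simp add: north_arc_iff node_classes_disjoint)
  next
    case (south i j)
    then have "fst s \<inter> North ` {1..n} = {}" by auto
    then show ?thesis using south s by (simp add: node_classes_disjoint)
  next
    case (through i j)
    then have "fst s \<inter> North ` {1..n} = {North i}"
      using diagrams_strand(1)[OF D s] by (auto simp: nodes_def)
    then show ?thesis using through s by (simp add: through_strand_iff node_classes_disjoint)
  qed
  then have "card (North ` {1..n}) = (\<Sum>s\<in>D. (if s \<in> north_arcs D then 2 else 0) + (if s \<in> through_strands D then 1 else 0))"
    by (subst card_nodes_by_strands[OF D]) (auto simp: nodes_def intro!: sum.cong)
  also have "\<dots> = 2 * card (D \<inter> north_arcs D) + card (D \<inter> through_strands D)"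
    using fin by (simp add: sum.distrib flip: sum.inter_restrict)
  also have "D \<inter> north_arcs D = north_arcs D"
    by (auto simp: north_arcs_def)
  also have "D \<inter> through_strands D = through_strands D"
    by (auto simp: through_strands_def)
  finally show ?thesis by (simp add: card_image inj_on_def)
qed

lemma count_south:
  assumes D: "D \<in> diagrams m n b"
  shows "b = 2 * card (south_arcs D) + card (through_strands D)"
proof -
  have fin: "finite D" by (rule finite_diagram[OF D])
  have "card (fst s \<inter> South ` {1..b}) = (if s \<in> south_arcs D then 2 else 0) + (if s \<in> through_strands D then 1 else 0)"
    if s: "s \<in> D" for s
  proof (cases rule: strand_cases[OF D s, case_names north south through])
    case (south i j)
    then have "fst s \<inter> South ` {1..b} = {South i, South j}"
      using diagrams_strand(1)[OF D s] by (auto simp: nodes_def)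
    then show ?thesis using south s by (simp add: south_arc_iff node_classes_disjoint)
  next
    case (north i j)
    then have "fst s \<inter> South ` {1..b} = {}" by auto
    then show ?thesis using north s by (simp add: node_classes_disjoint)
  next
    case (through i j)
    then have "fst s \<inter> South ` {1..b} = {South j}"
      using diagrams_strand(1)[OF D s] by (auto simp: nodes_def)
    then show ?thesis using through s by (simp add: through_strand_iff node_classes_disjoint)
  qed
  then have "card (South ` {1..b}) = (\<Sum>s\<in>D. (if s \<in> south_arcs D then 2 else 0) + (if s \<in> through_strands D then 1 else 0))"
    by (subst card_nodes_by_strands[OF D]) (auto simp: nodes_def intro!: sum.cong)
  also have "\<dots> = 2 * card (D \<inter> south_arcs D) + card (D \<inter> through_strands D)"
    using fin by (simp add: sum.distrib flip: sum.inter_restrict)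
  also have "D \<inter> south_arcs D = south_arcs D"
    by (auto simp: south_arcs_def)
  also have "D \<inter> through_strands D = through_strands D"
    by (auto simp: through_strands_def)
  finally show ?thesis by (simp add: card_image inj_on_def)
qed

lemma finite_south_arcs: "D \<in> diagrams m n b \<Longrightarrow> finite (south_arcs D)"
  using finite_diagram by (auto simp: south_arcs_def)

text \<open>Counting nodes gives n = 2 (northern arcs) + (through-strands) and n - 2l = 2 (southern
  arcs) + (through-strands). So excess northern arcs and missing through-strands are the same
  defect. This reconciles the two cut-offs: \<open>Delta_bar\<close> tests arcs,
  \<open>M_act\<close> tests through-strands.\<close>

lemma M_basis_iff:
  assumes "2 * l \<le> n"
  shows "D \<in> M_basis m p n l \<longleftrightarrow>
    D \<in> diagrams m n (n - 2 * l) \<and> \<not> card (through_strands D) < n - 2 * l \<and> p dvd label_sum D"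
    and "D \<in> M_basis m p n l \<longleftrightarrow>
    D \<in> diagrams m n (n - 2 * l) \<and> \<not> l < card (north_arcs D) \<and> p dvd label_sum D"
proof -
  have "card (through_strands D) = n - 2 * l \<longleftrightarrow> card (north_arcs D) = l"
    "card (north_arcs D) \<ge> l" "card (through_strands D) \<le> n - 2 * l"
    if "D \<in> diagrams m n (n - 2 * l)"
    using assms count_north[OF that] count_south[OF that] by linarith+
  then show "D \<in> M_basis m p n l \<longleftrightarrow>
    D \<in> diagrams m n (n - 2 * l) \<and> \<not> card (through_strands D) < n - 2 * l \<and> p dvd label_sum D"
    and "D \<in> M_basis m p n l \<longleftrightarrow>
    D \<in> diagrams m n (n - 2 * l) \<and> \<not> l < card (north_arcs D) \<and> p dvd label_sum D"
    unfolding M_basis_def by (simp; linarith)+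
qed

lemma M_basis_diagram: "D \<in> M_basis m p n l \<Longrightarrow> D \<in> diagrams m n (n - 2 * l)"
  by (simp add: M_basis_def)

lemma M_basis_south_arcs: "D \<in> M_basis m p n l \<Longrightarrow> south_arcs D = {}"
  using count_south[of D m n "n - 2 * l"] finite_south_arcs[of D m n "n - 2 * l"]
  by (auto simp: M_basis_def)

lemma north_arcs_twist:
  assumes D: "D \<in> diagrams m n b" shows "north_arcs (twist m \<pi> a D) = north_arcs D"
proof -
  have im: "relabel \<pi> ` e \<subseteq> range North \<longleftrightarrow> e \<subseteq> range North" for e
  proof -
    have "relabel \<pi> u \<in> range North \<longleftrightarrow> u \<in> range North" for u by (cases u) auto
    then show ?thesis by auto
  qed
  have fix_arc: "(relabel \<pi> ` fst s, (snd s + (\<Sum>j | South j \<in> fst s. a j)) mod m) = s"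
    if s: "s \<in> D" "fst s \<subseteq> range North" for s
  proof -
    have "relabel \<pi> ` fst s = fst s" using s(2) by force
    moreover have "{j. South j \<in> fst s} = {}" using s(2) by auto
    ultimately show ?thesis using diagrams_strand(3)[OF D s(1)] by simp
  qed
  show ?thesis
  proof (intro equalityI subsetI)
    fix r assume "r \<in> north_arcs (twist m \<pi> a D)"
    then obtain s where s: "s \<in> D" "r = (relabel \<pi> ` fst s, (snd s + (\<Sum>j | South j \<in> fst s. a j)) mod m)"
      "fst s \<subseteq> range North"
      by (auto simp: north_arcs_def twist_def im)
    then have "r = s" using fix_arc by metis
    then show "r \<in> north_arcs D" using s by (simp add: north_arcs_def)
  next
    fix s assume "s \<in> north_arcs D"
    then have s: "s \<in> D" "fst s \<subseteq> range North" by (auto simp: north_arcs_def)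
    then have "s \<in> twist m \<pi> a D" unfolding twist_def
      using fix_arc[OF s, symmetric] by (rule_tac image_eqI) auto
    then show "s \<in> north_arcs (twist m \<pi> a D)" using s by (simp add: north_arcs_def)
  qed
qed

lemma north_arcs_compose_Ggrp:
  assumes m: "0 < m" and D: "D \<in> diagrams m b n" and g: "g \<in> Ggrp m 1 n"
  shows "north_arcs (compose m D g) = north_arcs D"
proof -
  obtain \<pi> a where ga: "\<pi> permutes {1..n}" "g = twist m \<pi> a (idd n)" by (rule Ggrp_eq_twist[OF g])
  show ?thesis
    unfolding ga(2) compose_twist_idd[OF m D ga(1)] by (rule north_arcs_twist[OF D])
qed

section \<open>Factorization of a diagram into a dangle and a group element\<close>

lemma dangles_subset_M_basis:
  assumes "2 * l \<le> n" "v \<in> dangles m n l" shows "v \<in> M_basis m 1 n l"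
  using assms(2) by (auto simp: M_basis_iff(2)[OF assms(1)] dangles_def)

lemma through_South:
  assumes D: "D \<in> M_basis m p n l" and j: "j \<in> {1..n - 2 * l}"
  shows "\<exists>i c. ({North i, South j}, c) \<in> D"
proof -
  note Dd = M_basis_diagram[OF D]
  have "South j \<in> nodes n (n - 2 * l)" using j by (simp add: nodes_def)
  from diagrams_ex1[OF Dd this] obtain s where s: "s \<in> D" "South j \<in> fst s" by auto
  show ?thesis
  proof (cases rule: strand_cases[OF Dd s(1), case_names north south through])
    case (north i i')
    then show ?thesis using s by auto
  next
    case (south i i')
    then have "s \<in> south_arcs D" using s south_arc_iff by blast
    then show ?thesis using M_basis_south_arcs[OF D] by simp
  next
    case (through i i')
    then have "fst s = {North i, South j}" using s by auto
    then show ?thesis using s(1) by (metis prod.collapse)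
  qed
qed

text \<open>The free lines are straightened from below: southern ends are renumbered in the order of
  the northern ends and the labels are cancelled. The inverse of the group element doing this is
  \<open>w\<close>.\<close>

lemma dangle_exists:
  assumes m: "0 < m" and ln: "2 * l \<le> n" and D: "D \<in> M_basis m 1 n l"
  shows "\<exists>v\<in>dangles m n l. \<exists>w\<in>Ggrp m 1 (n - 2 * l). compose m v w = D"
proof -
  let ?N = "n - 2 * l"
  note Dd = M_basis_diagram[OF D]
  have "\<forall>j\<in>{1..?N}. \<exists>i c. ({North i, South j}, c) \<in> D" using through_South[OF D] by blast
  then obtain f where "\<forall>j\<in>{1..?N}. \<exists>c. ({North (f j), South j}, c) \<in> D"
    by (rule bchoice[THEN exE])
  then obtain c where fc: "\<forall>j\<in>{1..?N}. ({North (f j), South j}, c j) \<in> D"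
    by (rule bchoice[THEN exE])
  have injf: "inj_on f {1..?N}"
  proof (rule inj_onI)
    fix j j' assume j: "j \<in> {1..?N}" "j' \<in> {1..?N}" "f j = f j'"
    have "({North (f j), South j}, c j) = ({North (f j'), South j'}, c j')"
      by (rule diagrams_unique[OF Dd bspec[OF fc j(1)] bspec[OF fc j(2)], of "North (f j)"]) (simp_all add: j)
    then show "j = j'" by (auto simp: doubleton_eq_iff)
  qed
  \<comment> \<open>The rank of the northern end \<open>f j\<close> among all northern ends of
    through-strands.\<close>
  define \<kappa> where "\<kappa> j = (if j \<in> {1..?N} then card {j' \<in> {1..?N}. f j' \<le> f j} else j)" for j
  have less: "\<kappa> j < \<kappa> j'" if "j \<in> {1..?N}" "j' \<in> {1..?N}" "f j < f j'" for j j'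
  proof -
    have "{i \<in> {1..?N}. f i \<le> f j} \<subset> {i \<in> {1..?N}. f i \<le> f j'}"
      using that by (intro psubsetI) (auto, metis (mono_tags, lifting) atLeastAtMost_iff mem_Collect_eq leD order.refl that(2))
    then show ?thesis using that by (simp add: \<kappa>_def psubset_card_mono)
  qed
  have sub: "\<kappa> ` {1..?N} \<subseteq> {1..?N}"
  proof
    fix k assume "k \<in> \<kappa> ` {1..?N}"
    then obtain j where j: "j \<in> {1..?N}" "k = card {j' \<in> {1..?N}. f j' \<le> f j}" by (auto simp: \<kappa>_def)
    have "k \<le> card {1..?N}" unfolding j(2) by (rule card_mono) auto
    moreover have "0 < k" unfolding j(2) using j(1) by (subst card_gt_0_iff) auto
    ultimately show "k \<in> {1..?N}" by simp
  qed
  have inj: "inj_on \<kappa> {1..?N}"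
  proof (rule inj_onI, rule ccontr)
    fix j j' assume j: "j \<in> {1..?N}" "j' \<in> {1..?N}" "\<kappa> j = \<kappa> j'" "j \<noteq> j'"
    then have "f j \<noteq> f j'" using injf by (meson inj_onD)
    then show False using less j by (metis less_irrefl linorder_neqE_nat)
  qed
  have perm: "\<kappa> permutes {1..?N}"
    by (rule bij_imp_permutes)
       (use inj endo_inj_surj[OF _ sub inj] in \<open>auto simp: bij_betw_def \<kappa>_def\<close>)
  \<comment> \<open>As \<open>c j < m\<close>, this natural number represents the negative of
    \<open>c j\<close> modulo m.\<close>
  define b where "b j = m - c j" for j
  define v where "v = twist m \<kappa> b D"
  have vd: "v \<in> diagrams m n ?N" unfolding v_def by (rule twist_in_diagrams[OF m perm Dd])
  have na: "card (north_arcs v) = l"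
    unfolding v_def north_arcs_twist[OF Dd] using D by (simp add: M_basis_def)
  then have vM: "v \<in> M_basis m 1 n l"
    using vd by (simp add: M_basis_iff(2)[OF ln])
  have thr: "\<exists>j\<in>{1..?N}. i = f j \<and> k = \<kappa> j \<and> e = 0" if "({North i, South k}, e) \<in> v" for i k e
  proof -
    from that obtain s where s: "s \<in> D" "{North i, South k} = relabel \<kappa> ` fst s"
      "e = (snd s + (\<Sum>j | South j \<in> fst s. b j)) mod m"
      by (auto simp: v_def twist_def)
    have "South k \<in> relabel \<kappa> ` fst s" using s(2) by blast
    then obtain j where j: "South j \<in> fst s" "k = \<kappa> j"
      by (auto, rename_tac u, case_tac u) auto
    have "South j \<in> nodes n ?N" using diagrams_strand(1)[OF Dd s(1)] j(1) by blast
    then have jN: "j \<in> {1..?N}" by (auto simp: nodes_def)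
    have seq: "s = ({North (f j), South j}, c j)"
      by (rule diagrams_unique[OF Dd s(1) bspec[OF fc jN], of "South j"]) (simp_all add: j)
    have "c j < m" using diagrams_strand(3)[OF Dd bspec[OF fc jN]] by simp
    then have "e = 0" using s(3) by (simp add: seq b_def)
    moreover have "i = f j" using s(2) by (auto simp: seq doubleton_eq_iff)
    ultimately show ?thesis using jN j(2) by blast
  qed
  have "v \<in> dangles m n l"
    unfolding dangles_def
  proof (intro CollectI conjI ballI allI impI)
    show "south_arcs v = {}" by (rule M_basis_south_arcs[OF vM])
    show "snd s = 0" if "s \<in> through_strands v" for s
    proof -
      from that obtain i k where "s \<in> v" "fst s = {North i, South k}" by (auto simp: through_strands_def)
      then have "({North i, South k}, snd s) \<in> v" by (metis prod.collapse)
      from thr[OF this] show ?thesis by blast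
    qed
    show "j < j'" if "({North i, South j}, 0) \<in> v \<and> ({North i', South j'}, 0) \<in> v \<and> i < i'" for i j i' j'
    proof -
      have s1: "({North i, South j}, 0) \<in> v" and s2: "({North i', South j'}, 0) \<in> v" and lt: "i < i'"
        using that by auto
      from thr[OF s1] obtain k where k: "k \<in> {1..?N}" "i = f k" "j = \<kappa> k" by blast
      from thr[OF s2] obtain k' where k': "k' \<in> {1..?N}" "i' = f k'" "j' = \<kappa> k'" by blast
      show ?thesis using less[OF k(1) k'(1)] lt by (simp add: k k')
    qed
  qed (use vd na in auto)
  moreover define w0 where "w0 = twist m \<kappa> b (idd ?N)"
  have w0: "w0 \<in> Ggrp m 1 ?N" unfolding w0_def by (rule twist_in_Ggrp[OF m perm idd_in_Ggrp[OF m]])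
  obtain w where w: "w \<in> Ggrp m 1 ?N" "compose m w0 w = idd ?N" by (rule Ggrp_inverse[OF m w0])
  have "v = compose m D w0" unfolding w0_def v_def by (rule compose_twist_idd[OF m Dd perm, symmetric])
  then have "compose m v w = D"
    using compose_Ggrp_assoc[OF m Dd w0 w(1)] by (simp add: w(2) compose_idd[OF m Dd])
  ultimately show ?thesis using w(1) by blast
qed

text \<open>An increasing permutation maps the first \<open>j\<close> numbers onto an initial
  segment, whose length is then both \<open>j\<close> and the image of \<open>j\<close>.\<close>

lemma strict_mono_permutes_id:
  fixes \<rho> :: "nat \<Rightarrow> nat"
  assumes perm: "\<rho> permutes {1..N}"
    and mono: "\<And>i j. i \<in> {1..N} \<Longrightarrow> j \<in> {1..N} \<Longrightarrow> i < j \<Longrightarrow> \<rho> i < \<rho> j"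
    and j: "j \<in> {1..N}"
  shows "\<rho> j = j"
proof -
  have "\<rho> ` {1..j} = {1..\<rho> j}"
  proof (intro equalityI subsetI)
    fix k assume "k \<in> \<rho> ` {1..j}"
    then obtain i where i: "i \<in> {1..j}" "k = \<rho> i" by auto
    then have "i \<in> {1..N}" using j by auto
    then have "k \<in> {1..N}" using permutes_in_image[OF perm] i(2) by simp
    moreover have "k \<le> \<rho> j" using i mono[OF \<open>i \<in> {1..N}\<close> j] by (cases "i = j") auto
    ultimately show "k \<in> {1..\<rho> j}" by simp
  next
    fix k assume k: "k \<in> {1..\<rho> j}"
    have "\<rho> j \<in> {1..N}" using permutes_in_image[OF perm] j by simp
    then have "k \<in> {1..N}" using k by simp
    then have "k \<in> \<rho> ` {1..N}" by (simp only: permutes_image[OF perm])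
    then obtain i where i: "i \<in> {1..N}" "k = \<rho> i" by blast
    have "i \<le> j" using mono[OF j i(1)] i k by fastforce
    then show "k \<in> \<rho> ` {1..j}" using i by auto
  qed
  moreover have "card (\<rho> ` {1..j}) = j"
    by (simp add: card_image inj_on_subset[OF permutes_inj[OF perm]])
  ultimately show ?thesis by simp
qed

text \<open>Free lines are non-crossing before and after multiplication by \<open>g\<close>, so its
  permutation is increasing; they are unlabelled before and after, so its labels vanish modulo
  m.\<close>

lemma dangle_rigid:
  assumes m: "0 < m" and ln: "2 * l \<le> n" and v: "v \<in> dangles m n l" and v': "v' \<in> dangles m n l"
    and g: "g \<in> Ggrp m 1 (n - 2 * l)" and eq: "compose m v g = v'"
  shows "g = idd (n - 2 * l)"
proof -
  let ?N = "n - 2 * l"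
  obtain \<rho> a where ga: "\<rho> permutes {1..?N}" "g = twist m \<rho> a (idd ?N)" by (rule Ggrp_eq_twist[OF g])
  have vM: "v \<in> M_basis m 1 n l" by (rule dangles_subset_M_basis[OF ln v])
  note vd = M_basis_diagram[OF vM]
  have v'eq: "v' = twist m \<rho> a v"
    unfolding eq[symmetric] ga(2) by (rule compose_twist_idd[OF m vd ga(1)])
  have "\<forall>j\<in>{1..?N}. \<exists>i. ({North i, South j}, 0) \<in> v"
  proof
    fix j assume "j \<in> {1..?N}"
    from through_South[OF vM this] obtain i c where ic: "({North i, South j}, c) \<in> v" by blast
    then have "({North i, South j}, c) \<in> through_strands v" by (auto simp: through_strands_def)
    then have "c = 0" using v by (auto simp: dangles_def)
    then show "\<exists>i. ({North i, South j}, 0) \<in> v" using ic by blast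
  qed
  then obtain f where f: "\<forall>j\<in>{1..?N}. ({North (f j), South j}, 0) \<in> v"
    by (rule bchoice[THEN exE])
  have f': "({North (f j), South (\<rho> j)}, a j mod m) \<in> v'" if "j \<in> {1..?N}" for j
    unfolding v'eq twist_def using f that by (intro image_eqI[of _ _ "({North (f j), South j}, 0)"]) auto
  have a0: "m dvd a j" if "j \<in> {1..?N}" for j
  proof -
    have "({North (f j), South (\<rho> j)}, a j mod m) \<in> through_strands v'"
      using f'[OF that] by (auto simp: through_strands_def)
    then show ?thesis using v' by (auto simp: dangles_def)
  qed
  have order: "\<And>i j i' j'. ({North i, South j}, 0) \<in> u \<Longrightarrow> ({North i', South j'}, 0) \<in> u \<Longrightarrow> i < i' \<Longrightarrow> j < j'"
    if "u \<in> dangles m n l" for u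
    using that by (auto simp: dangles_def)
  have "\<rho> j = j" if "j \<in> {1..?N}" for j
  proof (rule strict_mono_permutes_id[OF ga(1) _ that])
    fix i j assume ij: "i \<in> {1..?N}" "j \<in> {1..?N}" "i < j"
    \<comment> \<open>Non-crossing is stated as an implication from northern to southern order. The
      converse follows by trichotomy, since distinct free lines have distinct northern ends.\<close>
    have "f i < f j"
    proof (rule ccontr)
      assume "\<not> f i < f j"
      then consider "f j < f i" | "f i = f j" by linarith
      then show False
      proof cases
        case 1
        then show ?thesis using order[OF v bspec[OF f ij(2)] bspec[OF f ij(1)]] ij(3) by simp
      next
        case 2
        have "({North (f i), South i}, 0) = ({North (f j), South j}, 0 :: nat)"
          by (rule diagrams_unique[OF vd bspec[OF f ij(1)] bspec[OF f ij(2)], of "North (f i)"]) (simp_all add: 2)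
        then show ?thesis using ij(3) by (auto simp: doubleton_eq_iff)
      qed
    qed
    then show "\<rho> i < \<rho> j"
      using order[OF v', of "f i" "\<rho> i" "f j" "\<rho> j"] f'[OF ij(1)] f'[OF ij(2)] a0[OF ij(1)] a0[OF ij(2)]
      by simp
  qed
  then show ?thesis
    unfolding ga(2) using a0 by (intro twist_trivial[OF idd_in_diagrams[OF m]]) auto
qed

text \<open>Multiplying by the inverse \<open>h\<close> of \<open>w'\<close> leaves one dangle equal
  to the other times \<open>w h\<close>, and rigidity makes \<open>w h\<close> the identity.\<close>

lemma dangle_unique:
  assumes m: "0 < m" and ln: "2 * l \<le> n"
    and v: "v \<in> dangles m n l" "v' \<in> dangles m n l"
    and w: "w \<in> Ggrp m 1 (n - 2 * l)" "w' \<in> Ggrp m 1 (n - 2 * l)"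
    and eq: "compose m v w = compose m v' w'"
  shows "v = v' \<and> w = w'"
proof -
  let ?N = "n - 2 * l"
  have vd: "v \<in> diagrams m n ?N" "v' \<in> diagrams m n ?N" using v by (auto simp: dangles_def)
  obtain h where h: "h \<in> Ggrp m 1 ?N" "compose m w' h = idd ?N" "compose m h w' = idd ?N"
    by (rule Ggrp_inverse[OF m w(2)])
  have "compose m v (compose m w h) = compose m (compose m v w) h"
    by (rule compose_Ggrp_assoc[OF m vd(1) w(1) h(1), symmetric])
  also have "\<dots> = v'"
    unfolding eq compose_Ggrp_assoc[OF m vd(2) w(2) h(1)] h(2) by (rule compose_idd[OF m vd(2)])
  finally have e: "compose m v (compose m w h) = v'" .
  have wh: "compose m w h = idd ?N"
    by (rule dangle_rigid[OF m ln v compose_in_Ggrp[OF m w(1) h(1)] e])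
  have "v = v'" using e unfolding wh compose_idd[OF m vd(1)] .
  have "w = compose m w (compose m h w')"
    unfolding h(3) by (rule compose_idd[OF m Ggrp_subset_diagrams[OF w(1)], symmetric])
  also have "\<dots> = compose m (idd ?N) w'"
    unfolding wh[symmetric] by (rule compose_Ggrp_assoc[OF m Ggrp_subset_diagrams[OF w(1)] h(1) w(2), symmetric])
  \<comment> \<open>The identity on the left is rewritten as \<open>w' h\<close>, so that
    associativity and the right unit law finish the computation.\<close>
  also have "\<dots> = compose m (compose m w' h) w'" by (simp only: h(2))
  also have "\<dots> = compose m w' (compose m h w')"
    by (rule compose_Ggrp_assoc[OF m Ggrp_subset_diagrams[OF w(2)] h(1) w(2)])
  also have "\<dots> = w'"
    unfolding h(3) by (rule compose_idd[OF m Ggrp_subset_diagrams[OF w(2)]])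
  finally show ?thesis using \<open>v = v'\<close> by simp
qed

lemma dangle_split_compose:
  assumes m: "0 < m" and ln: "2 * l \<le> n" and v: "v \<in> dangles m n l" and w: "w \<in> Ggrp m 1 (n - 2 * l)"
  shows "dangle_split m n l (compose m v w) = (v, w)"
  unfolding dangle_split_def
proof (rule the_equality)
  show "case (v, w) of (v', w') \<Rightarrow> v' \<in> dangles m n l \<and> w' \<in> Ggrp m 1 (n - 2 * l) \<and>
      compose m v' w' = compose m v w" using v w by simp
  fix q assume q: "case q of (v', w') \<Rightarrow> v' \<in> dangles m n l \<and> w' \<in> Ggrp m 1 (n - 2 * l) \<and>
      compose m v' w' = compose m v w"
  then show "q = (v, w)"
    using dangle_unique[OF m ln _ v _ w] by (cases q) auto
qed

lemma dangle_splitE: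
  assumes m: "0 < m" and ln: "2 * l \<le> n" and D: "D \<in> M_basis m 1 n l"
  obtains v w where "v \<in> dangles m n l" "w \<in> Ggrp m 1 (n - 2 * l)" "compose m v w = D"
    "dangle_split m n l D = (v, w)"
proof -
  obtain v w where vw: "v \<in> dangles m n l" "w \<in> Ggrp m 1 (n - 2 * l)" "compose m v w = D"
    using dangle_exists[OF assms] by blast
  show ?thesis
    using that[OF vw] dangle_split_compose[OF m ln vw(1,2)] by (simp add: vw(3))
qed

lemma compose_Ggrp_in_M_basis:
  assumes m: "0 < m" and ln: "2 * l \<le> n" and D: "D \<in> M_basis m 1 n l" and g: "g \<in> Ggrp m 1 (n - 2 * l)"
  shows "compose m D g \<in> M_basis m 1 n l"
  using D compose_Ggrp_in_diagrams[OF m M_basis_diagram[OF D] g]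
    north_arcs_compose_Ggrp[OF m M_basis_diagram[OF D] g]
  by (simp add: M_basis_iff(2)[OF ln])

lemma dangle_split_compose_Ggrp:
  assumes m: "0 < m" and ln: "2 * l \<le> n" and D: "D \<in> M_basis m 1 n l" and g: "g \<in> Ggrp m 1 (n - 2 * l)"
    and s: "dangle_split m n l D = (v, w)"
  shows "dangle_split m n l (compose m D g) = (v, compose m w g)"
proof -
  obtain v' w' where vw: "v' \<in> dangles m n l" "w' \<in> Ggrp m 1 (n - 2 * l)" "compose m v' w' = D"
    "dangle_split m n l D = (v', w')" by (rule dangle_splitE[OF m ln D])
  have "v' = v" "w' = w" using vw(4) s by auto
  note vw = vw[unfolded this]
  have vd: "v \<in> diagrams m n (n - 2 * l)" using vw(1) by (simp add: dangles_def)
  have "compose m D g = compose m v (compose m w g)"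
    unfolding vw(3)[symmetric] by (rule compose_Ggrp_assoc[OF m vd vw(2) g])
  then show ?thesis
    using dangle_split_compose[OF m ln vw(1) compose_in_Ggrp[OF m vw(2) g]] by simp
qed

section \<open>Generators of the group\<close>

lemma compose_twist_idd_twist_idd:
  assumes "0 < m" "\<pi> permutes {1..n}" "\<pi>' permutes {1..n}"
  shows "compose m (twist m \<pi> a (idd n)) (twist m \<pi>' a' (idd n)) =
    twist m (\<pi>' \<circ> \<pi>) (\<lambda>j. a j + a' (\<pi> j)) (idd n)"
  by (simp add: compose_twist_idd[OF assms(1) twist_in_diagrams[OF assms(1,2) idd_in_diagrams[OF assms(1)]] assms(3)]
      twist_twist[OF permutes_inj[OF assms(2)]])

lemma twist_idd: "twist m \<pi> a (idd n) = (\<lambda>i. ({North i, South (\<pi> i)}, a i mod m)) ` {1..n}"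
proof -
  have "idd n = (\<lambda>i. ({North i, South i}, 0)) ` {1..n}" by (auto simp: idd_def)
  then show ?thesis by (simp add: twist_def image_image)
qed

lemma s_gen_eq_twist: "s_gen n i = twist m (transpose i (Suc i)) (\<lambda>_. 0) (idd n)"
  by (simp only: twist_idd s_gen_def setcompr_eq_image Collect_mem_eq mod_0)

lemma t_gen_eq_twist: "t_gen m n = twist m id (\<lambda>j. if j = 1 then 1 else 0) (idd n)"
proof -
  have "(if i = 1 then 1 else 0) mod m = (if i = 1 then 1 mod m else 0)" for i :: nat by simp
  then show ?thesis by (simp only: twist_idd t_gen_def setcompr_eq_image Collect_mem_eq id_apply)
qed

text \<open>Generation of G(m,1,n) in the form of an induction rule. An element is a diagonal one
  followed by a permutation; permutations are products of adjacent transpositions, diagonal elements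
  are products of conjugates of \<open>t_gen\<close>.\<close>

lemma Ggrp_induct [consumes 2, case_names one t_gen s_gen mult]:
  assumes m: "0 < m" and g: "g \<in> Ggrp m 1 n"
    and one: "P (idd n)"
    and t: "1 \<le> n \<Longrightarrow> P (t_gen m n)"
    and s: "\<And>i. 1 \<le> i \<Longrightarrow> i < n \<Longrightarrow> P (s_gen n i)"
    and mult: "\<And>g h. g \<in> Ggrp m 1 n \<Longrightarrow> h \<in> Ggrp m 1 n \<Longrightarrow> P g \<Longrightarrow> P h \<Longrightarrow> P (compose m g h)"
  shows "P g"
proof -
  let ?tw = "\<lambda>\<pi> a. twist m \<pi> a (idd n)"
  have twG: "?tw \<pi> a \<in> Ggrp m 1 n" if "\<pi> permutes {1..n}" for \<pi> a
    by (rule twist_in_Ggrp[OF m that idd_in_Ggrp[OF m]])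
  have mult': "P (?tw (\<pi>' \<circ> \<pi>) (\<lambda>j. a j + a' (\<pi> j)))"
    if "P (?tw \<pi> a)" "P (?tw \<pi>' a')" "\<pi> permutes {1..n}" "\<pi>' permutes {1..n}" for \<pi> a \<pi>' a'
    using mult[OF twG[OF that(3)] twG[OF that(4)] that(1,2)]
    by (simp add: compose_twist_idd_twist_idd[OF m that(3,4)])
  have mult0: "P (?tw (\<pi>' \<circ> \<pi>) (\<lambda>_. 0))"
    if "P (?tw \<pi> (\<lambda>_. 0))" "P (?tw \<pi>' (\<lambda>_. 0))" "\<pi> permutes {1..n}" "\<pi>' permutes {1..n}" for \<pi> \<pi>'
    using mult'[OF that] by simp
  have idP: "P (?tw id (\<lambda>_. 0))"
    using one by (simp add: twist_trivial[OF idd_in_diagrams[OF m]])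
  have tr: "transpose i j permutes {1..n}" if "i \<in> {1..n}" "j \<in> {1..n}" for i j
    by (rule permutes_swap_id[OF that])
  have less: "P (?tw (transpose i j) (\<lambda>_. 0))" if "1 \<le> i" "i < j" "j \<le> n" for i j
    using that(2,3)
  proof (induction j)
    case (Suc j)
    have sj: "P (?tw (transpose j (Suc j)) (\<lambda>_. 0))" if "1 \<le> j"
      using s[of j] Suc.prems that by (simp add: s_gen_eq_twist[of n j m])
    show ?case
    proof (cases "i = j")
      case True then show ?thesis using sj \<open>1 \<le> i\<close> by simp
    next
      case False
      then have ij: "i < j" "j \<le> n" "1 \<le> j" using Suc.prems \<open>1 \<le> i\<close> by auto
      have p: "transpose j (Suc j) permutes {1..n}" "transpose i j permutes {1..n}"
        by (intro tr; use ij \<open>1 \<le> i\<close> Suc.prems in simp)+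
      \<comment> \<open>The transposition of \<open>i\<close> and \<open>Suc j\<close> is that of
        \<open>i\<close> and \<open>j\<close> conjugated by an adjacent one.\<close>
      have "P (?tw (transpose j (Suc j) \<circ> (transpose i j \<circ> transpose j (Suc j))) (\<lambda>_. 0))"
        by (intro mult0 sj Suc.IH ij p permutes_compose)
      moreover have "transpose j (Suc j) \<circ> (transpose i j \<circ> transpose j (Suc j)) = transpose i (Suc j)"
        using ij by (auto simp: fun_eq_iff transpose_def)
      ultimately show ?thesis by simp
    qed
  qed simp
  have trans: "P (?tw (transpose i j) (\<lambda>_. 0))" if ij: "i \<in> {1..n}" "j \<in> {1..n}" for i j
  proof -
    consider "i < j" | "j < i" | "i = j" by linarith
    then show ?thesis
    proof cases
      case 1 then show ?thesis using less[of i j] ij by simp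
    next
      case 2 then show ?thesis using less[of j i] ij by (simp add: transpose_commute)
    next
      case 3 then show ?thesis using idP by simp
    qed
  qed
  have perm: "P (?tw \<pi> (\<lambda>_. 0))" if \<pi>: "\<pi> permutes {1..n}" for \<pi>
    using \<pi> finite_atLeastAtMost
  proof (induction rule: permutes_induct)
    case id show ?case by (rule idP)
  next
    case (swap a b p)
    then show ?case by (intro mult0 trans tr)
  qed
  have unit: "P (?tw id (\<lambda>i. if i = j then 1 else 0))" if j: "j \<in> {1..n}" for j
  proof -
    let ?\<tau> = "transpose 1 j"
    have n1: "1 \<in> {1..n}" using j by simp
    have pt: "?\<tau> permutes {1..n}" by (rule tr[OF n1 j])
    have P1: "P (?tw id (\<lambda>i. if i = 1 then 1 else 0))"
      using t n1 by (simp add: t_gen_eq_twist)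
    have a: "P (?tw (id \<circ> ?\<tau>) (\<lambda>i. 0 + (if ?\<tau> i = 1 then 1 else 0)))"
      by (rule mult'[OF trans[OF n1 j] P1 pt permutes_id])
    \<comment> \<open>Conjugation by the transposition of 1 and \<open>j\<close> moves the label of
      \<open>t_gen\<close> from strand 1 to strand \<open>j\<close>.\<close>
    have "P (?tw (?\<tau> \<circ> (id \<circ> ?\<tau>)) (\<lambda>i. 0 + (if ?\<tau> i = 1 then 1 else 0) + 0))"
      by (rule mult'[OF a trans[OF n1 j] permutes_compose[OF pt permutes_id] pt])
    moreover have "(?\<tau> i = 1) = (i = j)" for i
      by (auto simp: transpose_def)
    ultimately show ?thesis by simp
  qed
  have multiple: "P (?tw id (\<lambda>i. if i = j then c else 0))" if j: "j \<in> {1..n}" for j c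
  proof (induction c)
    case 0 then show ?case using idP by (simp add: id_def o_def)
  next
    case (Suc c)
    have "P (?tw (id \<circ> id) (\<lambda>i. (if i = j then c else 0) + (if id i = j then 1 else 0)))"
      by (rule mult'[OF Suc unit[OF j] permutes_id permutes_id])
    moreover have "(\<lambda>i. (if i = j then c else 0) + (if id i = j then 1 else 0)) = (\<lambda>i. if i = j then Suc c else 0)"
      by auto
    ultimately show ?case by (simp add: id_def o_def)
  qed
  have diag: "P (?tw id (\<lambda>i. if i \<in> S then a i else 0))" if "S \<subseteq> {1..n}" for S a
    using finite_subset[OF that finite_atLeastAtMost] that
  proof (induction S rule: finite_induct)
    case empty then show ?case using idP by (simp add: id_def o_def)
  next
    case (insert j S)
    have "P (?tw (id \<circ> id) (\<lambda>i. (if i \<in> S then a i else 0) + (if id i = j then a j else 0)))"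
    proof (rule mult'[OF insert.IH multiple permutes_id permutes_id])
      show "S \<subseteq> {1..n}" "j \<in> {1..n}" using insert.prems by auto
    qed
    moreover have "(\<lambda>i. (if i \<in> S then a i else 0) + (if id i = j then a j else 0)) = (\<lambda>i. if i \<in> insert j S then a i else 0)"
      using insert.hyps by auto
    ultimately show ?case by (simp add: id_def o_def)
  qed
  obtain \<pi> a where ga: "\<pi> permutes {1..n}" "g = ?tw \<pi> a" by (rule Ggrp_eq_twist[OF g])
  \<comment> \<open>Labels first, permutation second. Values of \<open>a\<close> outside
    \<open>{1..n}\<close> leave no trace in the diagram and are cut off.\<close>
  have "P (?tw (\<pi> \<circ> id) (\<lambda>i. (if i \<in> {1..n} then a i else 0) + 0))"
    by (rule mult'[OF diag[OF order.refl] perm[OF ga(1)] permutes_id ga(1)])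
  moreover have "?tw (\<pi> \<circ> id) (\<lambda>i. (if i \<in> {1..n} then a i else 0) + 0) = g"
    unfolding ga(2) twist_idd by (rule image_cong) auto
  ultimately show ?thesis by (simp add: id_def o_def)
qed

section \<open>Rotation of tableaux\<close>

lemma sigma_pow: "(sigma d ^^ t) xs = rotate (d * t) xs"
  by (induction t) (auto simp: sigma_def rotate_rotate)

lemma finite_std_tableaux [simp]: "finite (std_tableaux lam)"
proof -
  define N where "N = sum_list (map sum_list lam)"
  define R where "R = {row. set row \<subseteq> {1..N} \<and> length row \<le> Max (insert 0 (set (concat lam)))}"
  define C where "C = {U. set U \<subseteq> R \<and> length U \<le> Max (insert 0 (length ` set lam))}"
  have "finite R" unfolding R_def by (rule finite_lists_length_le) simp
  then have "finite C" unfolding C_def by (rule finite_lists_length_le)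
  then have fin: "finite {T. set T \<subseteq> C \<and> length T = length lam}" by (rule finite_lists_length_eq)
  have "std_tableaux lam \<subseteq> {T. set T \<subseteq> C \<and> length T = length lam}"
  proof (intro subsetI CollectI conjI)
    fix T assume "T \<in> std_tableaux lam"
    then have T: "map (map length) T = lam" "set (concat (concat T)) = {1..N}"
      by (auto simp: std_tableaux_def N_def)
    show "length T = length lam" using T(1) by auto
    fix U assume U: "U \<in> set T"
    have "row \<in> R" if row: "row \<in> set U" for row
    proof -
      have "set row \<subseteq> set (concat (concat T))" using U row by auto
      then have "set row \<subseteq> {1..N}" by (simp only: T(2))
      moreover have "length row \<in> set (concat lam)" unfolding T(1)[symmetric] using U row by auto
      then have "length row \<le> Max (insert 0 (set (concat lam)))" by (intro Max_ge) auto
      ultimately show ?thesis by (simp add: R_def)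
    qed
    moreover have "length U \<in> length ` set lam" unfolding T(1)[symmetric] using U by force
    then have "length U \<le> Max (insert 0 (length ` set lam))" by (intro Max_ge) auto
    ultimately show "U \<in> C" by (auto simp: C_def)
  qed
  then show ?thesis using fin by (rule finite_subset)
qed

lemma std_tableaux_length: "T \<in> std_tableaux lam \<Longrightarrow> length T = length lam"
  unfolding std_tableaux_def by auto

text \<open>Standardness is a condition on each component and on the set of all entries, and
  rotation only permutes the components; the shape is preserved by the hypothesis on
  \<open>lam\<close>.\<close>

lemma rotate_std_tableaux:
  assumes "rotate k lam = lam" "T \<in> std_tableaux lam"
  shows "rotate k T \<in> std_tableaux lam"
proof -
  define j where "j = k mod length T"
  have rot: "rotate k T = drop j T @ take j T" by (simp add: rotate_drop_take j_def)
  have T: "T = take j T @ drop j T" by simp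
  have "map (map length) (rotate k T) = rotate k (map (map length) T)"
    by (rule rotate_map[symmetric])
  then have 1: "map (map length) (rotate k T) = lam" using assms by (simp add: std_tableaux_def)
  have dis: "distinct (concat (concat (take j T)) @ concat (concat (drop j T)))"
    and set: "set (concat (concat (take j T)) @ concat (concat (drop j T))) = {1..sum_list (map sum_list lam)}"
    using assms(2) by (simp_all only: std_tableaux_def mem_Collect_eq flip: concat_append) simp_all
  have "distinct (concat (concat (rotate k T)))"
    using dis unfolding rot by (auto simp del: set_concat)
  moreover have "set (concat (concat (rotate k T))) = {1..sum_list (map sum_list lam)}"
    using set unfolding rot by (simp del: set_concat add: Un_commute)
  moreover define Q where "Q V \<longleftrightarrow> (\<forall>U\<in>set V. (\<forall>row\<in>set U. sorted_wrt (<) row) \<and>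
        (\<forall>i j. Suc i < length U \<and> j < length (U ! Suc i) \<longrightarrow> U ! i ! j < U ! Suc i ! j))" for V :: tableau
  have mem: "V \<in> std_tableaux lam \<longleftrightarrow> map (map length) V = lam \<and> distinct (concat (concat V)) \<and>
      set (concat (concat V)) = {1..sum_list (map sum_list lam)} \<and> Q V" for V
    by (simp only: std_tableaux_def mem_Collect_eq Q_def)
  have "Q (rotate k T) = Q T" by (simp add: Q_def)
  ultimately show ?thesis using assms(2) 1 unfolding mem by (simp del: set_concat)
qed

section \<open>The box of an entry, and its behaviour under rotation\<close>

lemma distinct_concat_index:
  assumes "distinct (concat xs)" "i < length xs" "j < length xs" "x \<in> set (xs ! i)" "x \<in> set (xs ! j)"
  shows "i = j"
  using assms
proof (induction xs arbitrary: i j)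
  case (Cons a xs)
  have out: "x \<notin> set (xs ! k)" if "x \<in> set a" "k < length xs" for k
  proof -
    have "x \<notin> set (concat xs)" using Cons.prems(1) that(1) by auto
    then show ?thesis unfolding set_concat using nth_mem[OF that(2)] by (meson UN_I)
  qed
  show ?case
  proof (cases i)
    case i: 0
    then show ?thesis using Cons.prems out by (cases j) auto
  next
    case i: (Suc i')
    show ?thesis
    proof (cases j)
      case 0
      then show ?thesis using Cons.prems out i by auto
    next
      case (Suc j')
      then show ?thesis using Cons.IH[of i' j'] Cons.prems i by simp
    qed
  qed
qed simp

lemma concat_map_concat: "concat (map concat xss) = concat (concat xss)"
  by (induction xss) auto

lemma distinct_concat_nth: "distinct (concat xs) \<Longrightarrow> i < length xs \<Longrightarrow> distinct (xs ! i)"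
  by (induction xs arbitrary: i) (auto simp: less_Suc_eq_0_disj)

text \<open>Makes the definite description in \<open>box_of\<close> meaningful. Distinctness of all
  entries is applied to components, rows and columns in turn.\<close>

lemma box_ex1:
  assumes "distinct (concat (concat T))" "i \<in> set (concat (concat T))"
  shows "\<exists>!b. case b of (s, r, c) \<Rightarrow> s < length T \<and> r < length (T ! s) \<and>
                   c < length (T ! s ! r) \<and> T ! s ! r ! c = i"
proof -
  have dT: "distinct (concat (map concat T))"
    using assms(1) by (simp add: concat_map_concat)
  from assms(2) obtain U row where "U \<in> set T" "row \<in> set U" "i \<in> set row" by auto
  then obtain s r c where ex: "s < length T" "r < length (T ! s)" "c < length (T ! s ! r)" "T ! s ! r ! c = i"
    by (metis in_set_conv_nth)
  show ?thesis
  proof (rule ex1I[of _ "(s, r, c)"])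
    fix b assume b: "case b of (s, r, c) \<Rightarrow> s < length T \<and> r < length (T ! s) \<and>
                   c < length (T ! s ! r) \<and> T ! s ! r ! c = i"
    obtain s' r' c' where b': "b = (s', r', c')" by (cases b)
    have ex': "s' < length T" "r' < length (T ! s')" "c' < length (T ! s' ! r')" "T ! s' ! r' ! c' = i"
      using b by (auto simp: b')
    have m1: "i \<in> set (T ! s ! r)" using nth_mem[OF ex(3)] ex(4) by simp
    have m2: "i \<in> set (T ! s' ! r')" using nth_mem[OF ex'(3)] ex'(4) by simp
    have in1: "i \<in> set (map concat T ! s)" using ex(1,2) m1 nth_mem[OF ex(2)] by auto
    have in2: "i \<in> set (map concat T ! s')" using ex'(1,2) m2 nth_mem[OF ex'(2)] by auto
    have s: "s' = s"
      by (rule distinct_concat_index[OF dT _ _ in2 in1]) (use ex ex' in auto)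
    have ds: "distinct (concat (T ! s))" using distinct_concat_nth[OF dT, of s] ex(1) by simp
    have r: "r' = r"
      using distinct_concat_index[OF ds _ ex(2) _ m1] ex'(2) m2 by (simp add: s)
    have "distinct (T ! s ! r)" by (rule distinct_concat_nth[OF ds ex(2)])
    then have "c' = c" using nth_eq_iff_index_eq[of "T ! s ! r" c' c] ex ex' by (simp add: s r)
    then show "b = (s, r, c)" by (simp add: b' s r)
  qed (use ex in simp)
qed

text \<open>Component \<open>s\<close> of the rotated tableau is component \<open>s + k\<close>
  modulo m of the original; rows and columns inside it are untouched.\<close>

lemma box_of_rotate:
  assumes T: "T \<in> std_tableaux lam" and i: "i \<in> {1..sum_list (map sum_list lam)}"
  shows "(tcomp (rotate k T) i + k) mod length lam = tcomp T i"
    and "tcomp (rotate k T) i < length lam"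
    and "trow (rotate k T) i = trow T i" "tcol (rotate k T) i = tcol T i"
proof -
  let ?B = "\<lambda>T b. case b of (s, r, c) \<Rightarrow> s < length T \<and> r < length (T ! s) \<and>
                   c < length (T ! s ! r) \<and> T ! s ! r ! c = i"
  let ?R = "rotate k T"
  have dT: "distinct (concat (concat T))" and sT: "set (concat (concat T)) = {1..sum_list (map sum_list lam)}"
    using T by (auto simp: std_tableaux_def)
  have exT: "\<exists>!b. ?B T b" by (rule box_ex1[OF dT]) (use i sT in simp)
  have dec: "rotate k T = drop (k mod length T) T @ take (k mod length T) T" by (rule rotate_drop_take)
  have "distinct (concat (concat (take (k mod length T) T @ drop (k mod length T) T)))"
    using dT by simp
  then have dR: "distinct (concat (concat ?R))"
    unfolding dec concat_append distinct_append by blast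
  have sR: "set (concat (concat ?R)) = set (concat (concat T))" by simp
  have exR: "\<exists>!b. ?B ?R b" by (rule box_ex1[OF dR]) (use i sT sR in simp)
  obtain s r c where box: "box_of ?R i = (s, r, c)" by (cases "box_of ?R i")
  have "?B ?R (box_of ?R i)" unfolding box_of_def by (rule theI'[OF exR])
  then have src: "s < length T" "r < length (?R ! s)" "c < length (?R ! s ! r)" "?R ! s ! r ! c = i"
    by (auto simp: box)
  have nth: "?R ! s = T ! ((k + s) mod length T)" by (rule nth_rotate[OF src(1)])
  have lt: "(k + s) mod length T < length T" proof (rule mod_less_divisor)
    have "s < length T" using src(1) by simp
    then show "0 < length T" by linarith
  qed
  have "?B T ((k + s) mod length T, r, c)" using src lt by (simp add: nth)
  then have boxT: "box_of T i = ((k + s) mod length T, r, c)"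
    unfolding box_of_def by (rule the1_equality[OF exT])
  show "(tcomp ?R i + k) mod length lam = tcomp T i" "tcomp ?R i < length lam"
    "trow ?R i = trow T i" "tcol ?R i = tcol T i"
    using src(1) std_tableaux_length[OF T]
    by (simp_all add: tcomp_def trow_def tcol_def box boxT add.commute)
qed

lemma inv_axial_rotate:
  assumes T: "T \<in> std_tableaux lam" and i: "1 \<le> i" "i < sum_list (map sum_list lam)"
  shows "inv_axial (rotate k T) i = inv_axial T i"
proof -
  let ?m = "length lam"
  have mem: "i \<in> {1..sum_list (map sum_list lam)}" "Suc i \<in> {1..sum_list (map sum_list lam)}"
    using i by auto
  note b = box_of_rotate[OF T mem(1), of k] and b' = box_of_rotate[OF T mem(2), of k]
  have "tcomp (rotate k T) i = tcomp (rotate k T) (Suc i)" if e: "tcomp T i = tcomp T (Suc i)"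
  proof -
    have "(tcomp (rotate k T) i + k) mod ?m = (tcomp (rotate k T) (Suc i) + k) mod ?m"
      using b(1) b'(1) e by simp
    \<comment> \<open>Over the integers \<open>k\<close> can be cancelled modulo \<open>?m\<close>;
      both component indices are below \<open>?m\<close>, so the congruence is an equality.\<close>
    then have "(int (tcomp (rotate k T) i) + int k) mod int ?m = (int (tcomp (rotate k T) (Suc i)) + int k) mod int ?m"
      by (metis of_nat_add of_nat_mod)
    then have "int (tcomp (rotate k T) i) mod int ?m = int (tcomp (rotate k T) (Suc i)) mod int ?m"
      by (simp add: mod_eq_dvd_iff)
    then show ?thesis using b(2) b'(2) by (simp add: zmod_int[symmetric])
  qed
  moreover have "tcomp T i = tcomp T (Suc i)" if e: "tcomp (rotate k T) i = tcomp (rotate k T) (Suc i)"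
    using b(1) b'(1) e by simp
  ultimately show ?thesis
    unfolding inv_axial_def b(3,4) b'(3,4) by auto
qed

lemma tswap_rotate: "tswap i (rotate k T) = rotate k (tswap i T)"
  by (simp add: tswap_def rotate_map)

lemma rotate_fixed_funpow: "rotate k xs = xs \<Longrightarrow> rotate (k * j) xs = xs"
  by (induction j) (auto simp flip: rotate_rotate)

lemma rotate_std_tableaux_iff:
  assumes "rotate k lam = lam"
  shows "rotate k T \<in> std_tableaux lam \<longleftrightarrow> T \<in> std_tableaux lam"
proof
  assume R: "rotate k T \<in> std_tableaux lam"
  then have len: "length T = length lam" using std_tableaux_length by fastforce
  show "T \<in> std_tableaux lam"
  proof (cases "length T = 0")
    case False
    \<comment> \<open>Repeating the rotation as often as there are components is the identity, so
      \<open>length T - 1\<close> further rotations undo the first.\<close>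
    have "rotate (k * (length T - 1)) (rotate k T) = rotate (length T * k) T"
    proof -
      have "k * (length T - 1) + k = length T * k"
        using False by (cases "length T") simp_all
      then show ?thesis by (simp only: rotate_rotate)
    qed
    then have "rotate (k * (length T - 1)) (rotate k T) = T" by simp
    then show ?thesis
      using rotate_std_tableaux[OF rotate_fixed_funpow[OF assms] R] by metis
  qed (use R in simp)
qed (rule rotate_std_tableaux[OF assms])

text \<open>Rotation by \<open>k\<close> intertwines the representation with its twist by the character
  \<open>g \<mapsto> \<xi>\<^sup>k\<^sup>|\<^sup>g\<^sup>|\<close>, \<open>|g|\<close> being the label sum; this is checked on the generators.\<close>

lemma rotate_intertwines:
  fixes \<xi> :: "'k :: field_char_0"
  assumes m: "0 < m" and lam: "length lam = m" and \<xi>: "\<xi> ^ m = 1"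
    and rot: "rotate k lam = lam" and \<rho>: "Sbar_action m \<xi> lam \<rho>"
    and N: "N = sum_list (map sum_list lam)"
    and g: "g \<in> Ggrp m 1 N" and T: "T \<in> std_tableaux lam"
  shows "lin_ext (\<lambda>U. bas (rotate k U)) (\<rho> g T) = fscale (\<xi> ^ (k * label_sum g)) (\<rho> g (rotate k T))"
proof -
  let ?S = "std_tableaux lam" and ?\<Sigma> = "lin_ext (\<lambda>U. bas (rotate k U) :: tableau \<Rightarrow> 'k)"
  note \<rho>' = \<rho>[unfolded Sbar_action_def Let_def, folded N]
  have \<rho>S: "\<rho> g T \<in> span_on ?S" if "g \<in> Ggrp m 1 N" "T \<in> ?S" for g T
    using \<rho>' that by blast
  have rS: "rotate k T \<in> ?S" if "T \<in> ?S" for T by (rule rotate_std_tableaux[OF rot that])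
  have p: "\<xi> ^ a = \<xi> ^ (a mod m)" for a
  proof -
    have "\<xi> ^ a = \<xi> ^ (m * (a div m) + a mod m)" by simp
    also have "\<dots> = \<xi> ^ (a mod m)" by (simp only: power_add power_mult \<xi> power_one mult_1_left)
    finally show ?thesis .
  qed
  \<comment> \<open>Label sums are additive only modulo m, which the character does not
    notice.\<close>
  have \<xi>mod: "\<xi> ^ (k * a) = \<xi> ^ (k * b)" if ab: "a mod m = b mod m" for a b
  proof -
    have "(k * a) mod m = (k * b) mod m" by (rule mod_mult_cong[OF refl ab])
    then show ?thesis using p[of "k * a"] p[of "k * b"] by simp
  qed
  have "\<forall>T\<in>?S. ?\<Sigma> (\<rho> g T) = fscale (\<xi> ^ (k * label_sum g)) (\<rho> g (rotate k T))"
    using m g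
  proof (induction rule: Ggrp_induct)
    case one
    have "\<rho> (idd N) T = bas T" if "T \<in> ?S" for T using \<rho>' that by blast
    then show ?case by (simp add: rS)
  next
    case t_gen
    show ?case
    proof
      fix T assume T: "T \<in> ?S"
      have t: "\<rho> (t_gen m N) T = fscale (\<xi> ^ tcomp T 1) (bas T)" if "T \<in> ?S" for T
        using \<rho>' that t_gen by blast
      have "(tcomp (rotate k T) 1 + k) mod m = tcomp T 1"
        using box_of_rotate(1)[OF T, of 1 k] t_gen by (simp add: N lam)
      then have tc: "tcomp T 1 mod m = (tcomp (rotate k T) 1 + k) mod m" by (metis mod_mod_trivial)
      have "label_sum (t_gen m N) mod m = (\<Sum>j\<in>{1..N}. if j = 1 then 1 else 0) mod m"
        unfolding t_gen_eq_twist by (subst label_sum_twist[OF idd_in_diagrams[OF m] inj_on_id]) simp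
      also have "\<dots> = 1 mod m" using t_gen by (simp add: sum.delta)
      finally have l1: "label_sum (t_gen m N) mod m = 1 mod m" .
      \<comment> \<open>Rotation lowers the component of the entry 1 by \<open>k\<close> modulo m.
        The eigenvalues of \<open>t_gen\<close> on the two tableaux thus differ by the value of the
        character on \<open>t_gen\<close>.\<close>
      have "\<xi> ^ tcomp T 1 = \<xi> ^ (tcomp (rotate k T) 1 + k)"
        using p tc by metis
      then have "\<xi> ^ (k * label_sum (t_gen m N)) * \<xi> ^ tcomp (rotate k T) 1 = \<xi> ^ tcomp T 1"
        using \<xi>mod[OF l1] by (simp add: power_add)
      then show "?\<Sigma> (\<rho> (t_gen m N) T) = fscale (\<xi> ^ (k * label_sum (t_gen m N))) (\<rho> (t_gen m N) (rotate k T))"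
        by (simp add: t[OF T] t[OF rS[OF T]] lin_ext_fscale)
    qed
  next
    case (s_gen i)
    show ?case
    proof
      fix T assume T: "T \<in> ?S"
      have s: "\<rho> (s_gen N i) T = fscale (inv_axial T i) (bas T) +
          (if tswap i T \<in> ?S then fscale (1 + inv_axial T i) (bas (tswap i T)) else 0)" if "T \<in> ?S" for T
        using \<rho>' that s_gen by blast
      \<comment> \<open>The seminormal coefficients see only coincidence of components and contents
        within one component, so \<open>s_gen\<close> commutes with rotation, in accordance with its
        label sum 0.\<close>
      have ax: "inv_axial (rotate k T) i = (inv_axial T i :: 'k)"
        by (rule inv_axial_rotate[OF T]) (use s_gen N in auto)
      have l0: "label_sum (s_gen N i) = 0"
        unfolding label_sum_def by (rule sum.neutral) (auto simp: s_gen_def)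
      have "?\<Sigma> (\<rho> (s_gen N i) T) = fscale (inv_axial T i) (bas (rotate k T)) +
          (if tswap i T \<in> ?S then fscale (1 + inv_axial T i) (bas (rotate k (tswap i T))) else 0)"
      proof (cases "tswap i T \<in> ?S")
        case True
        have "?\<Sigma> (fscale (inv_axial T i) (bas T) + fscale (1 + inv_axial T i) (bas (tswap i T))) =
            ?\<Sigma> (fscale (inv_axial T i) (bas T)) + ?\<Sigma> (fscale (1 + inv_axial T i) (bas (tswap i T)))"
          by (rule lin_ext_add[of ?S]) (use T True in \<open>auto intro!: span_on_fscale\<close>)
        then show ?thesis using True by (simp add: s[OF T] lin_ext_fscale)
      next
        case False
        then show ?thesis by (simp add: s[OF T] lin_ext_fscale)
      qed
      then show "?\<Sigma> (\<rho> (s_gen N i) T) = fscale (\<xi> ^ (k * label_sum (s_gen N i))) (\<rho> (s_gen N i) (rotate k T))"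
        by (simp add: s[OF rS[OF T]] ax l0 tswap_rotate rotate_std_tableaux_iff[OF rot])
    qed
  next
    case (mult g h)
    show ?case
    proof
      fix T assume T: "T \<in> ?S"
      have comp: "\<rho> (compose m g h) T = lin_ext (\<rho> g) (\<rho> h T)" if "T \<in> ?S" for T
        using \<rho>' that mult(1,2) by blast
      have span_r: "bas (rotate k U) \<in> span_on ?S" if "U \<in> ?S" for U using rS[OF that] by simp
      have "?\<Sigma> (\<rho> (compose m g h) T) = lin_ext (\<lambda>U. ?\<Sigma> (\<rho> g U)) (\<rho> h T)"
        unfolding comp[OF T]
        by (rule lin_ext_lin_ext[OF finite_std_tableaux \<rho>S[OF mult(2) T] finite_std_tableaux]) (rule \<rho>S[OF mult(1)])
      also have "\<dots> = lin_ext (\<lambda>U. fscale (\<xi> ^ (k * label_sum g)) (\<rho> g (rotate k U))) (\<rho> h T)"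
        by (rule lin_ext_cong[OF \<rho>S[OF mult(2) T]]) (use mult(3) in blast)
      also have "\<dots> = fscale (\<xi> ^ (k * label_sum g)) (lin_ext (\<lambda>U. lin_ext (\<rho> g) (bas (rotate k U))) (\<rho> h T))"
        by (simp add: lin_ext_eq_sum[OF finite_std_tableaux \<rho>S[OF mult(2) T]] fscale_sum mult.commute)
      also have "lin_ext (\<lambda>U. lin_ext (\<rho> g) (bas (rotate k U))) (\<rho> h T) = lin_ext (\<rho> g) (?\<Sigma> (\<rho> h T))"
        by (rule lin_ext_lin_ext[OF finite_std_tableaux \<rho>S[OF mult(2) T] finite_std_tableaux, symmetric])
           (rule span_r)
      also have "?\<Sigma> (\<rho> h T) = fscale (\<xi> ^ (k * label_sum h)) (\<rho> h (rotate k T))"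
        using mult(4) T by blast
      also have "lin_ext (\<rho> g) \<dots> = fscale (\<xi> ^ (k * label_sum h)) (\<rho> (compose m g h) (rotate k T))"
        by (simp add: lin_ext_fscale comp[OF rS[OF T]])
      finally have e: "?\<Sigma> (\<rho> (compose m g h) T) =
          fscale (\<xi> ^ (k * (label_sum g + label_sum h))) (\<rho> (compose m g h) (rotate k T))"
        by (simp add: power_add distrib_left)
      have "label_sum (compose m g h) mod m = (label_sum g + label_sum h) mod m"
        by (rule label_sum_compose_Ggrp[OF m Ggrp_subset_diagrams[OF mult(1)] mult(2)])
      from \<xi>mod[OF this] show "?\<Sigma> (\<rho> (compose m g h) T) =
          fscale (\<xi> ^ (k * label_sum (compose m g h))) (\<rho> (compose m g h) (rotate k T))"
        using e by simp
    qed
  qed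
  then show ?thesis using T by blast
qed

section \<open>The operators on the standard modules\<close>

lemma section_in_span_on: "f \<in> span_on (A \<times> B) \<Longrightarrow> (\<lambda>T. f (D, T)) \<in> span_on B"
  by (auto simp: span_on_def)

lemma tensor_section: "(\<lambda>T. tensor (bas D) x (D', T)) = (if D' = D then x else 0)"
  by (auto simp: tensor_def bas_def fun_eq_iff)

lemma tensor_bas_in_span_on: "D \<in> A \<Longrightarrow> x \<in> span_on B \<Longrightarrow> tensor (bas D) x \<in> span_on (A \<times> B)"
  by (intro tensor_in_span_on) auto

text \<open>Reduces linear statements to pure tensors. The tensors that occur are the sections of
  the given \<open>f\<close> itself, so properties of these sections, such as lying in an
  eigenspace, remain available.\<close>

lemma span_on_prod_induct:
  assumes "finite A" "finite B" "f \<in> span_on (A \<times> B)"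
    and zero: "P 0"
    and add: "\<And>g h. g \<in> span_on (A \<times> B) \<Longrightarrow> h \<in> span_on (A \<times> B) \<Longrightarrow> P g \<Longrightarrow> P h \<Longrightarrow> P (g + h)"
    and tensor: "\<And>D. D \<in> A \<Longrightarrow> P (tensor (bas D) (\<lambda>T. f (D, T)))"
  shows "P f"
proof -
  have sec: "tensor (bas D) (\<lambda>T. f (D, T)) \<in> span_on (A \<times> B)" if "D \<in> A" for D
    by (rule tensor_bas_in_span_on[OF that section_in_span_on[OF assms(3)]])
  have "P (\<Sum>D\<in>A'. tensor (bas D) (\<lambda>T. f (D, T)))" if "A' \<subseteq> A" for A'
    using finite_subset[OF that assms(1)] that
  proof (induction A' rule: finite_induct)
    case (insert D A')
    have "P (tensor (bas D) (\<lambda>T. f (D, T)) + (\<Sum>D\<in>A'. tensor (bas D) (\<lambda>T. f (D, T))))"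
      using insert by (intro add sec span_on_sum tensor) auto
    then show ?case unfolding sum.insert[OF insert(1,2)] .
  qed (simp add: zero)
  from this[OF order.refl] show ?thesis
    by (simp only: tensor_decompose[OF assms(1,2,3), symmetric])
qed

text \<open>\<sigma> leaves the dangle and hence its label sum unchanged, so the scalars multiply,
  and a power is the same operator with \<open>d\<close> replaced by \<open>d * j\<close>.\<close>

lemma sigma_Delta_pow:
  assumes "finite A" "y \<in> span_on A"
  shows "(sigma_Delta \<xi> d ^^ j) y = sigma_Delta \<xi> (d * j) y"
proof (induction j)
  case 0
  have "sigma_Delta \<xi> 0 y = lin_ext bas y"
    unfolding sigma_Delta_def by (rule lin_ext_cong[OF assms(2)]) (auto simp: sigma_def)
  then show ?case by (simp add: lin_ext_bas_id[OF assms])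
next
  case (Suc j)
  let ?g = "\<lambda>d (v, T). fscale (\<xi> ^ (d * label_sum v)) (bas (v, sigma d T))"
  have "(sigma_Delta \<xi> d ^^ Suc j) y = lin_ext (?g d) (lin_ext (?g (d * j)) y)"
    by (simp only: funpow.simps o_apply Suc) (simp only: sigma_Delta_def)
  also have "\<dots> = lin_ext (\<lambda>x. lin_ext (?g d) (?g (d * j) x)) y"
    by (rule lin_ext_lin_ext[OF assms, of "(\<lambda>(v, T). (v, sigma (d * j) T)) ` A"])
       (use assms in \<open>auto intro!: span_on_fscale bas_in_span_on image_eqI\<close>)
  also have "\<dots> = lin_ext (?g (d * Suc j)) y"
    by (rule lin_ext_cong[OF assms(2)])
       (auto simp: lin_ext_fscale sigma_def rotate_rotate power_add[symmetric] algebra_simps)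
  finally show ?case by (simp add: sigma_Delta_def)
qed

lemma sigma_tableaux_pow:
  assumes "finite A" "x \<in> span_on A"
  shows "((lin_ext (\<lambda>T. bas (sigma d T))) ^^ j) x = lin_ext (\<lambda>T. bas (rotate (d * j) T)) x"
proof (induction j)
  case 0
  then show ?case by (simp add: lin_ext_bas_id[OF assms])
next
  case (Suc j)
  have "((lin_ext (\<lambda>T. bas (sigma d T))) ^^ Suc j) x =
      lin_ext (\<lambda>T. bas (sigma d T)) (lin_ext (\<lambda>T. bas (rotate (d * j) T)) x)"
    by (simp add: Suc)
  also have "\<dots> = lin_ext (\<lambda>T. lin_ext (\<lambda>T. bas (sigma d T)) (bas (rotate (d * j) T))) x"
    by (rule lin_ext_lin_ext[OF assms, of "rotate (d * j) ` A"]) (use assms in auto)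
  finally show ?case by (simp add: sigma_def rotate_rotate add.commute)
qed

text \<open>The stabilizer enters through the invariance of \<open>lam\<close> under rotation by
  \<open>d * t\<close>; the case n = 2l adds t = 1 where it is used.\<close>

locale standard_setup =
  fixes \<xi> :: "'k :: field_char_0" and \<delta> :: "nat \<Rightarrow> 'k" and m p d n l t :: nat
    and lam :: mpart and \<rho> :: "diagram \<Rightarrow> tableau \<Rightarrow> tableau \<Rightarrow> 'k"
  assumes m: "0 < m" and p: "0 < p" and d: "0 < d" and mpd: "m = p * d"
    and \<xi>: "\<xi> ^ m = 1" and prim: "\<And>j. 0 < j \<Longrightarrow> j < m \<Longrightarrow> \<xi> ^ j \<noteq> 1"
    and ln: "2 * l \<le> n" and lam: "lam \<in> mpartitions m (n - 2 * l)"
    and tp: "t dvd p" and rot: "rotate (d * t) lam = lam"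
    and act: "Sbar_action m \<xi> lam \<rho>"
begin

declare One_nat_def [simp del]

abbreviation "N \<equiv> n - 2 * l"
abbreviation "ST \<equiv> std_tableaux lam"
abbreviation "V \<equiv> dangles m n l"
abbreviation "MB \<equiv> M_basis m p n l"
text \<open>With divisor 1 the condition on label sums disappears, so \<open>Dg\<close> contains
  \<open>V\<close> as well as \<open>MB\<close> and can carry operators for both modules.\<close>

abbreviation "Dg \<equiv> M_basis m 1 n l"
abbreviation "G \<equiv> Ggrp m 1 N"
text \<open>A primitive root of unity of order p/t; its powers are the eigenvalues of
  \<sigma>^t.\<close>

abbreviation "\<omega> \<equiv> \<xi> ^ (d * t)"
abbreviation "Balgp \<equiv> Balg m p p \<delta> n"
abbreviation "DB \<equiv> Delta_bar m p \<delta> n l lam \<rho>"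

text \<open>Moves the group part of a diagram to the tableau factor: the quotient map to the tensor
  product over the algebra of G(m,1,N), with dangles as coset representatives.\<close>

definition "Phi = lin_ext (\<lambda>(D, T). case dangle_split m n l D of (v, w) \<Rightarrow> tensor (bas v) (\<rho> w T))"

text \<open>Concatenation by one basis diagram before any tensor relation is imposed; the group part
  stays in the diagram.\<close>

definition "actX X = lin_ext (\<lambda>(D, T). if card (through_strands (compose m X D)) < N then 0
     else fscale (loop_coeff m p \<delta> X D) (bas (compose m X D, T)))"

abbreviation "Rot \<equiv> lin_ext (\<lambda>T. bas (rotate (d * t) T) :: tableau \<Rightarrow> 'k)"
abbreviation "sD \<equiv> sigma_Delta \<xi> (d * t)"

lemma t_pos: "0 < t" and q_pos: "0 < p div t" and m_eq: "d * t * (p div t) = m"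
proof -
  show t: "0 < t" using tp p by (rule dvd_pos_nat[rotated])
  obtain q where "p = t * q" using tp by (elim dvdE)
  then show "0 < p div t" "d * t * (p div t) = m" using t p mpd by auto
qed

lemma size_lam: "sum_list (map sum_list lam) = N" and length_lam: "length lam = m"
  using lam by (auto simp: mpartitions_def)

lemma \<omega>_root: "\<omega> ^ (p div t) = 1" and \<omega>_prim: "0 < j \<Longrightarrow> j < p div t \<Longrightarrow> \<omega> ^ j \<noteq> 1"
proof -
  show "\<omega> ^ (p div t) = 1" by (simp only: m_eq \<xi> flip: power_mult)
  assume j: "0 < j" "j < p div t"
  have dt: "0 < d * t" using d t_pos by simp
  have "d * t * j < d * t * (p div t)" using j dt by (intro mult_strict_left_mono)
  moreover have "0 < d * t * j" using j dt by simp
  ultimately show "\<omega> ^ j \<noteq> 1" using prim[of "d * t * j"] by (simp add: m_eq power_mult)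
qed

text \<open>Since \<open>d * t * p = m * t\<close>, powers of \<omega> with label sums as exponents
  depend only on residues modulo p, and these survive concatenation.\<close>

lemma \<omega>_pow_p: "\<omega> ^ p = 1"
proof -
  have "d * t * p = m * t" by (simp add: mpd)
  then show ?thesis by (simp only: power_mult[symmetric]) (simp only: power_mult \<xi> power_one)
qed

lemma \<omega>_mod: "\<omega> ^ a = \<omega> ^ (a mod p)"
proof -
  have "\<omega> ^ a = \<omega> ^ (p * (a div p) + a mod p)" by simp
  also have "\<dots> = (\<omega> ^ p) ^ (a div p) * \<omega> ^ (a mod p)" by (simp only: power_add power_mult)
  finally show ?thesis by (simp only: \<omega>_pow_p power_one mult_1_left)
qed

lemma \<omega>_cong: "a mod p = b mod p \<Longrightarrow> \<omega> ^ a = \<omega> ^ b"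
  by (metis \<omega>_mod)

lemma p_dvd_m: "p dvd m" by (simp add: mpd)

lemma mod_m_imp_mod_p: "a mod m = b mod m \<Longrightarrow> a mod p = b mod p"
  using p_dvd_m by (metis mod_mod_cancel)

lemma \<rho>_span: "g \<in> G \<Longrightarrow> T \<in> ST \<Longrightarrow> \<rho> g T \<in> span_on ST"
  using act unfolding Sbar_action_def Let_def size_lam by blast

lemma \<rho>_span': "g \<in> G \<Longrightarrow> x \<in> span_on ST \<Longrightarrow> lin_ext (\<rho> g) x \<in> span_on ST"
  by (rule lin_ext_in_span_on) (auto intro: \<rho>_span)

lemma \<rho>_idd: "x \<in> span_on ST \<Longrightarrow> lin_ext (\<rho> (idd N)) x = x"
proof -
  assume x: "x \<in> span_on ST"
  have "lin_ext (\<rho> (idd N)) x = lin_ext bas x"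
    by (rule lin_ext_cong[OF x]) (use act in \<open>unfold Sbar_action_def Let_def size_lam, blast\<close>)
  then show ?thesis by (simp add: lin_ext_bas_id[OF finite_std_tableaux x])
qed

lemma \<rho>_compose:
  assumes "g \<in> G" "h \<in> G" "x \<in> span_on ST"
  shows "lin_ext (\<rho> (compose m g h)) x = lin_ext (\<rho> g) (lin_ext (\<rho> h) x)"
proof -
  have "lin_ext (\<rho> (compose m g h)) x = lin_ext (\<lambda>T. lin_ext (\<rho> g) (\<rho> h T)) x"
    by (rule lin_ext_cong[OF assms(3)])
       (use act assms(1,2) in \<open>unfold Sbar_action_def Let_def size_lam, blast\<close>)
  also have "\<dots> = lin_ext (\<rho> g) (lin_ext (\<rho> h) x)"
    by (rule lin_ext_lin_ext[OF finite_std_tableaux assms(3) finite_std_tableaux, symmetric])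
       (rule \<rho>_span[OF assms(2)])
  finally show ?thesis .
qed

lemma Rot_span: "x \<in> span_on ST \<Longrightarrow> Rot x \<in> span_on ST"
  by (rule lin_ext_in_span_on) (auto intro: rotate_std_tableaux[OF rot])

lemma Rot_\<rho>:
  assumes g: "g \<in> G" and x: "x \<in> span_on ST"
  shows "Rot (lin_ext (\<rho> g) x) = fscale (\<omega> ^ label_sum g) (lin_ext (\<rho> g) (Rot x))"
proof -
  have "Rot (lin_ext (\<rho> g) x) = lin_ext (\<lambda>T. Rot (\<rho> g T)) x"
    by (rule lin_ext_lin_ext[OF finite_std_tableaux x finite_std_tableaux]) (rule \<rho>_span[OF g])
  also have "\<dots> = lin_ext (\<lambda>T. fscale (\<omega> ^ label_sum g) (\<rho> g (rotate (d * t) T))) x"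
  proof (rule lin_ext_cong[OF x])
    fix T assume "T \<in> ST"
    then show "Rot (\<rho> g T) = fscale (\<omega> ^ label_sum g) (\<rho> g (rotate (d * t) T))"
      using rotate_intertwines[OF m length_lam \<xi> rot act refl] g
      by (simp only: size_lam power_mult)
  qed
  also have "\<dots> = fscale (\<omega> ^ label_sum g) (lin_ext (\<lambda>T. lin_ext (\<rho> g) (bas (rotate (d * t) T))) x)"
    by (simp add: lin_ext_eq_sum[OF finite_std_tableaux x] fscale_sum mult.commute)
  also have "lin_ext (\<lambda>T. lin_ext (\<rho> g) (bas (rotate (d * t) T))) x = lin_ext (\<rho> g) (Rot x)"
    by (rule lin_ext_lin_ext[OF finite_std_tableaux x finite_std_tableaux, symmetric])
       (auto intro: rotate_std_tableaux[OF rot])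
  finally show ?thesis .
qed

section \<open>Splitting, concatenation and rotation as operators on one space\<close>

lemma finite_bases [simp]: "finite Dg" "finite MB" "finite V"
  by (auto intro: finite_subset[OF _ finite_diagrams[of m n N]] simp: M_basis_def dangles_def)

lemma V_Dg: "v \<in> V \<Longrightarrow> v \<in> Dg"
  by (rule dangles_subset_M_basis[OF ln])

lemma MB_Dg: "D \<in> MB \<Longrightarrow> D \<in> Dg"
  by (simp add: M_basis_def)

lemma MB_iff: "D \<in> MB \<longleftrightarrow> D \<in> Dg \<and> p dvd label_sum D"
  by (auto simp: M_basis_def)

lemma span_V_Dg: "y \<in> span_on (V \<times> ST) \<Longrightarrow> y \<in> span_on (Dg \<times> ST)"
  using V_Dg by (auto intro: span_on_mono)

lemma span_MB_Dg: "y \<in> span_on (MB \<times> ST) \<Longrightarrow> y \<in> span_on (Dg \<times> ST)"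
  using MB_Dg by (auto intro: span_on_mono)

lemma Dg_split:
  assumes "D \<in> Dg"
  obtains v w where "v \<in> V" "w \<in> G" "compose m v w = D" "dangle_split m n l D = (v, w)"
  by (rule dangle_splitE[OF m ln assms])

lemma Phi_tensor:
  assumes "dangle_split m n l D = (v, w)" "x \<in> span_on ST"
  shows "Phi (tensor (bas D) x) = tensor (bas v) (lin_ext (\<rho> w) x)"
  unfolding Phi_def lin_ext_tensor_bas[OF finite_std_tableaux assms(2)]
  by (simp add: assms(1) lin_ext_tensor[OF finite_std_tableaux assms(2)])

lemma Phi_add: "f \<in> span_on (Dg \<times> ST) \<Longrightarrow> g \<in> span_on (Dg \<times> ST) \<Longrightarrow> Phi (f + g) = Phi f + Phi g"
  unfolding Phi_def by (rule lin_ext_add[of "Dg \<times> ST"]) auto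

lemma Phi_diff: "f \<in> span_on (Dg \<times> ST) \<Longrightarrow> g \<in> span_on (Dg \<times> ST) \<Longrightarrow> Phi (f - g) = Phi f - Phi g"
  unfolding Phi_def by (rule lin_ext_diff[of "Dg \<times> ST"]) auto

lemma Phi_fscale: "Phi (fscale c f) = fscale c (Phi f)"
  unfolding Phi_def by (rule lin_ext_fscale)

lemma Phi_zero [simp]: "Phi 0 = 0"
  unfolding Phi_def by simp

lemma Phi_bas_span:
  assumes "D \<in> Dg" "T \<in> ST"
  shows "(case dangle_split m n l D of (v, w) \<Rightarrow> tensor (bas v) (\<rho> w T)) \<in> span_on (V \<times> ST)"
proof -
  obtain v w where "v \<in> V" "w \<in> G" "dangle_split m n l D = (v, w)" by (rule Dg_split[OF assms(1)])
  then show ?thesis using \<rho>_span assms(2) by (simp add: tensor_bas_in_span_on)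
qed

lemma Phi_span: "f \<in> span_on (Dg \<times> ST) \<Longrightarrow> Phi f \<in> span_on (V \<times> ST)"
  unfolding Phi_def by (erule lin_ext_in_span_on) (use Phi_bas_span in auto)

lemma compose_Dg_iff:
  assumes "X \<in> diagrams m n n" "D \<in> Dg"
  shows "compose m X D \<in> Dg \<longleftrightarrow> \<not> card (through_strands (compose m X D)) < N"
    and "compose m X D \<in> Dg \<longleftrightarrow> \<not> l < card (north_arcs (compose m X D))"
  using compose_in_diagrams[OF m assms(1) M_basis_diagram[OF assms(2)]]
  by (simp_all add: M_basis_iff(1)[OF ln] M_basis_iff(2)[OF ln, of _ m 1])
     (metis M_basis_iff[OF ln] one_dvd)+

lemma actX_bas_span:
  assumes "X \<in> diagrams m n n" "D \<in> Dg" "T \<in> ST"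
  shows "(if card (through_strands (compose m X D)) < N then 0
     else fscale (loop_coeff m p \<delta> X D) (bas (compose m X D, T))) \<in> span_on (Dg \<times> ST)"
  using compose_Dg_iff(1)[OF assms(1,2)] assms(3) by (auto intro!: span_on_fscale)

lemma actX_tensor:
  assumes "x \<in> span_on ST"
  shows "actX X (tensor (bas D) x) = (if card (through_strands (compose m X D)) < N then 0
     else fscale (loop_coeff m p \<delta> X D) (tensor (bas (compose m X D)) x))"
proof -
  have "lin_ext (\<lambda>T. bas (E, T)) x = tensor (bas E) x" for E :: diagram
    using lin_ext_tensor[OF finite_std_tableaux assms, of "bas E" bas]
    by (simp add: tensor_bas_bas lin_ext_bas_id[OF finite_std_tableaux assms])
  moreover have "lin_ext (\<lambda>T. fscale c (bas (E, T))) x = fscale c (lin_ext (\<lambda>T. bas (E, T)) x)"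
    for c and E :: diagram
    by (simp add: lin_ext_eq_sum[OF finite_std_tableaux assms] fscale_sum mult.commute)
  moreover have "lin_ext (\<lambda>T. 0 :: diagram \<times> tableau \<Rightarrow> 'k) x = 0"
    by (simp add: lin_ext_eq_sum[OF finite_std_tableaux assms])
  ultimately show ?thesis
    unfolding actX_def lin_ext_tensor_bas[OF finite_std_tableaux assms] by simp
qed

lemma actX_add: "f \<in> span_on (Dg \<times> ST) \<Longrightarrow> g \<in> span_on (Dg \<times> ST) \<Longrightarrow> actX X (f + g) = actX X f + actX X g"
  unfolding actX_def by (rule lin_ext_add[of "Dg \<times> ST"]) auto

lemma actX_diff: "f \<in> span_on (Dg \<times> ST) \<Longrightarrow> g \<in> span_on (Dg \<times> ST) \<Longrightarrow> actX X (f - g) = actX X f - actX X g"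
  unfolding actX_def by (rule lin_ext_diff[of "Dg \<times> ST"]) auto

lemma actX_fscale: "actX X (fscale c f) = fscale c (actX X f)"
  unfolding actX_def by (rule lin_ext_fscale)

lemma actX_zero [simp]: "actX X 0 = 0"
  unfolding actX_def by simp

lemma actX_span: "X \<in> diagrams m n n \<Longrightarrow> f \<in> span_on (Dg \<times> ST) \<Longrightarrow> actX X f \<in> span_on (Dg \<times> ST)"
  unfolding actX_def by (erule lin_ext_in_span_on) (use actX_bas_span in auto)

text \<open>Concatenation descends along \<open>Phi\<close>: for \<open>D = v w\<close> one has X(v
  w) = (X v) w with the same loops and northern arcs, so splitting off \<open>w\<close> before or
  after applying \<open>X\<close> gives the same vector.\<close>

lemma Phi_actX_Phi:
  assumes X: "X \<in> diagrams m n n" and f: "f \<in> span_on (Dg \<times> ST)"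
  shows "Phi (actX X (Phi f)) = Phi (actX X f)"
proof (rule span_on_prod_induct[OF _ _ f])
  show "Phi (actX X (Phi (g + h))) = Phi (actX X (g + h))"
    if "g \<in> span_on (Dg \<times> ST)" "h \<in> span_on (Dg \<times> ST)"
      "Phi (actX X (Phi g)) = Phi (actX X g)" "Phi (actX X (Phi h)) = Phi (actX X h)" for g h
    using that by (simp add: Phi_add actX_add actX_span[OF X] span_V_Dg Phi_span)
next
  fix D assume D: "D \<in> Dg"
  define x where "x = (\<lambda>T. f (D, T))"
  have x: "x \<in> span_on ST" unfolding x_def by (rule section_in_span_on[OF f])
  obtain v w where vw: "v \<in> V" "w \<in> G" "compose m v w = D" "dangle_split m n l D = (v, w)"
    by (rule Dg_split[OF D])
  note vd = M_basis_diagram[OF V_Dg[OF vw(1)]]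
  have XD: "compose m X D = compose m (compose m X v) w"
    and lc: "loop_coeff m p \<delta> X D = loop_coeff m p \<delta> X v"
    using compose_compose_Ggrp[OF m X vd vw(2)] by (auto simp: vw(3))
  have na: "north_arcs (compose m X D) = north_arcs (compose m X v)"
    unfolding XD by (rule north_arcs_compose_Ggrp[OF m compose_in_diagrams[OF m X vd] vw(2)])
  have iff: "compose m X D \<in> Dg \<longleftrightarrow> compose m X v \<in> Dg"
    using compose_Dg_iff(2)[OF X D] compose_Dg_iff(2)[OF X V_Dg[OF vw(1)]] by (simp add: na)
  show "Phi (actX X (Phi (tensor (bas D) x))) = Phi (actX X (tensor (bas D) x))"
  proof (cases "compose m X v \<in> Dg")
    case False
    then show ?thesis
      using iff compose_Dg_iff(1)[OF X D] compose_Dg_iff(1)[OF X V_Dg[OF vw(1)]]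
      by (simp add: Phi_tensor[OF vw(4) x] actX_tensor \<rho>_span'[OF vw(2)] x)
  next
    case True
    then obtain v' w' where v'w': "v' \<in> V" "w' \<in> G" "dangle_split m n l (compose m X v) = (v', w')"
      using Dg_split by metis
    have s: "dangle_split m n l (compose m X D) = (v', compose m w' w)"
      unfolding XD by (rule dangle_split_compose_Ggrp[OF m ln True vw(2) v'w'(3)])
    show ?thesis
      using iff True compose_Dg_iff(1)[OF X D] compose_Dg_iff(1)[OF X V_Dg[OF vw(1)]]
      by (simp add: Phi_tensor[OF vw(4) x] actX_tensor \<rho>_span'[OF vw(2)] x lc Phi_fscale
          Phi_tensor[OF s] Phi_tensor[OF v'w'(3)] \<rho>_compose[OF v'w'(2) vw(2) x])
  qed
next
  show "Phi (actX X (Phi 0)) = Phi (actX X 0)" by (simp only: Phi_zero actX_zero)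
qed simp_all

lemma sD_tensor:
  assumes "x \<in> span_on ST"
  shows "sD (tensor (bas D) x) = fscale (\<omega> ^ label_sum D) (tensor (bas D) (Rot x))"
proof -
  have "sD (tensor (bas D) x) = lin_ext (\<lambda>T. fscale (\<omega> ^ label_sum D) (tensor (bas D) (bas (rotate (d * t) T)))) x"
    unfolding sigma_Delta_def lin_ext_tensor_bas[OF finite_std_tableaux assms]
    by (simp add: sigma_def tensor_bas_bas power_mult)
  also have "\<dots> = fscale (\<omega> ^ label_sum D) (lin_ext (\<lambda>T. tensor (bas D) (bas (rotate (d * t) T))) x)"
    by (simp add: lin_ext_eq_sum[OF finite_std_tableaux assms] fscale_sum mult.commute)
  finally show ?thesis by (simp add: lin_ext_tensor[OF finite_std_tableaux assms])
qed

lemma sD_add: "f \<in> span_on (Dg \<times> ST) \<Longrightarrow> g \<in> span_on (Dg \<times> ST) \<Longrightarrow> sD (f + g) = sD f + sD g"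
  unfolding sigma_Delta_def by (rule lin_ext_add[of "Dg \<times> ST"]) auto

lemma sD_fscale: "sD (fscale c f) = fscale c (sD f)"
  unfolding sigma_Delta_def by (rule lin_ext_fscale)

lemma sD_zero [simp]: "sD 0 = 0"
  unfolding sigma_Delta_def by simp

lemma sD_span: "f \<in> span_on (A \<times> ST) \<Longrightarrow> sD f \<in> span_on (A \<times> ST)"
  unfolding sigma_Delta_def
  by (erule lin_ext_in_span_on) (auto intro!: span_on_fscale rotate_std_tableaux[OF rot] simp: sigma_def)

text \<open>Moving the rotation past \<open>w\<close> costs \<omega>^|w|, which is precisely the
  discrepancy between the weights \<omega>^|D| and \<omega>^|v|. This is what the scalar in \<sigma>
  is made for.\<close>

lemma Phi_sD:
  assumes f: "f \<in> span_on (Dg \<times> ST)" shows "Phi (sD f) = sD (Phi f)"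
proof (rule span_on_prod_induct[OF _ _ f])
  show "Phi (sD (g + h)) = sD (Phi (g + h))"
    if "g \<in> span_on (Dg \<times> ST)" "h \<in> span_on (Dg \<times> ST)" "Phi (sD g) = sD (Phi g)" "Phi (sD h) = sD (Phi h)" for g h
    using that by (simp add: Phi_add sD_add sD_span span_V_Dg Phi_span)
next
  fix D assume D: "D \<in> Dg"
  define x where "x = (\<lambda>T. f (D, T))"
  have x: "x \<in> span_on ST" unfolding x_def by (rule section_in_span_on[OF f])
  obtain v w where vw: "v \<in> V" "w \<in> G" "compose m v w = D" "dangle_split m n l D = (v, w)"
    by (rule Dg_split[OF D])
  have "label_sum D mod m = (label_sum v + label_sum w) mod m"
    using label_sum_compose_Ggrp[OF m M_basis_diagram[OF V_Dg[OF vw(1)]] vw(2)] by (simp add: vw(3))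
  then have "\<omega> ^ label_sum D = \<omega> ^ label_sum v * \<omega> ^ label_sum w"
    using \<omega>_cong[OF mod_m_imp_mod_p] by (metis power_add)
  then show "Phi (sD (tensor (bas D) x)) = sD (Phi (tensor (bas D) x))"
    by (simp add: sD_tensor[OF x] Phi_fscale Phi_tensor[OF vw(4)] x Rot_span
        sD_tensor[OF \<rho>_span'[OF vw(2) x]] Rot_\<rho>[OF vw(2) x] tensor_fscale)
next
  show "Phi (sD 0) = sD (Phi 0)" by (simp only: Phi_zero actX_zero sD_zero)
qed simp_all

text \<open>Either a bad loop makes the product 0, or \<open>D\<close> and \<open>X D\<close> have
  the same label sum modulo p, because that of \<open>X\<close> is a multiple of p. This is where
  the subalgebra B_{m,p,n} is used.\<close>

lemma actX_sD:
  assumes X: "X \<in> diagrams m n n" "p dvd label_sum X" and f: "f \<in> span_on (Dg \<times> ST)"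
  shows "actX X (sD f) = sD (actX X f)"
proof (rule span_on_prod_induct[OF _ _ f])
  show "actX X (sD (g + h)) = sD (actX X (g + h))"
    if "g \<in> span_on (Dg \<times> ST)" "h \<in> span_on (Dg \<times> ST)"
      "actX X (sD g) = sD (actX X g)" "actX X (sD h) = sD (actX X h)" for g h
    using that by (simp add: actX_add sD_add sD_span actX_span[OF X(1)])
next
  fix D assume D: "D \<in> Dg"
  define x where "x = (\<lambda>T. f (D, T))"
  have x: "x \<in> span_on ST" unfolding x_def by (rule section_in_span_on[OF f])
  have "loop_coeff m p \<delta> X D = 0 \<or> \<omega> ^ label_sum (compose m X D) = \<omega> ^ label_sum D"
  proof (cases "loop_coeff m p \<delta> X D = 0")
    case False
    from label_sum_compose_mod[OF X(1) M_basis_diagram[OF D] p_dvd_m this]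
    have "label_sum (compose m X D) mod p = label_sum D mod p"
      using X(2) by (auto elim!: dvdE)
    then show ?thesis using \<omega>_cong by blast
  qed simp
  then show "actX X (sD (tensor (bas D) x)) = sD (actX X (tensor (bas D) x))"
    by (auto simp: sD_tensor[OF x] actX_fscale actX_tensor x Rot_span sD_fscale mult.commute)
next
  show "actX X (sD 0) = sD (actX X 0)" by (simp only: Phi_zero actX_zero sD_zero)
qed simp_all

lemma M_act_eq: "M_act m p \<delta> N b f = lin_ext (\<lambda>X. actX X f) b"
  by (simp add: M_act_def actX_def)

abbreviation "BX \<equiv> {X \<in> diagrams m n n. p dvd label_sum X}"

lemma finite_BX [simp]: "finite BX"
  by simp

lemma carrier_Balgp: "carrier Balgp = span_on BX"
  by (simp add: Balg_def)

lemma M_act_sum: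
  assumes "b \<in> carrier Balgp"
  shows "M_act m p \<delta> N b f = (\<Sum>X\<in>BX. fscale (b X) (actX X f))"
  unfolding M_act_eq using lin_ext_eq_sum[OF finite_BX] assms carrier_Balgp by blast

lemma M_act_span:
  assumes "b \<in> carrier Balgp" "f \<in> span_on (Dg \<times> ST)"
  shows "M_act m p \<delta> N b f \<in> span_on (Dg \<times> ST)"
  unfolding M_act_sum[OF assms(1)] by (intro span_on_sum span_on_fscale actX_span) (use assms in auto)

lemma M_act_add:
  assumes "b \<in> carrier Balgp" "f \<in> span_on (Dg \<times> ST)" "g \<in> span_on (Dg \<times> ST)"
  shows "M_act m p \<delta> N b (f + g) = M_act m p \<delta> N b f + M_act m p \<delta> N b g"
  unfolding M_act_sum[OF assms(1)] sum.distrib[symmetric]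
  by (intro sum.cong refl) (simp add: actX_add assms fscale_add)

lemma M_act_fscale:
  assumes "b \<in> carrier Balgp"
  shows "M_act m p \<delta> N b (fscale c f) = fscale c (M_act m p \<delta> N b f)"
  unfolding M_act_sum[OF assms(1)] by (simp add: actX_fscale fscale_sum mult.commute)

lemma Phi_sum:
  assumes "\<And>i. i \<in> I \<Longrightarrow> f i \<in> span_on (Dg \<times> ST)"
  shows "Phi (\<Sum>i\<in>I. f i) = (\<Sum>i\<in>I. Phi (f i))"
  unfolding Phi_def by (rule lin_ext_sum[of "Dg \<times> ST"]) (use assms in auto)

lemma Phi_M_act:
  assumes "b \<in> carrier Balgp" "f \<in> span_on (Dg \<times> ST)"
  shows "Phi (M_act m p \<delta> N b f) = (\<Sum>X\<in>BX. fscale (b X) (Phi (actX X f)))"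
  unfolding M_act_sum[OF assms(1)]
  by (subst Phi_sum) (use assms(2) in \<open>auto intro!: span_on_fscale actX_span simp: Phi_fscale\<close>)

lemma Phi_M_act_Phi:
  assumes "b \<in> carrier Balgp" "f \<in> span_on (Dg \<times> ST)"
  shows "Phi (M_act m p \<delta> N b (Phi f)) = Phi (M_act m p \<delta> N b f)"
  unfolding Phi_M_act[OF assms] Phi_M_act[OF assms(1) span_V_Dg[OF Phi_span[OF assms(2)]]]
  by (intro sum.cong refl) (use assms(2) in \<open>simp add: Phi_actX_Phi\<close>)

lemma M_act_sD:
  assumes b: "b \<in> carrier Balgp" and f: "f \<in> span_on (Dg \<times> ST)"
  shows "M_act m p \<delta> N b (sD f) = sD (M_act m p \<delta> N b f)"
proof -
  have "sD (\<Sum>X\<in>BX. fscale (b X) (actX X f)) = (\<Sum>X\<in>BX. sD (fscale (b X) (actX X f)))"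
    unfolding sigma_Delta_def
    by (rule lin_ext_sum[of "Dg \<times> ST"]) (use f in \<open>auto intro!: span_on_fscale actX_span\<close>)
  then show ?thesis
    unfolding M_act_sum[OF b] by (simp add: sD_fscale actX_sD f)
qed

section \<open>The restricted module and its eigenspaces\<close>

lemma DB_simps [simp]: "vecs DB = span_on (V \<times> ST)" "vadd DB = (+)" "vscale DB = fscale"
  by (simp_all add: Delta_bar_def)

text \<open>Splitting the concatenation and letting its group part act on the tableau is exactly
  \<open>Phi\<close> applied to the plain concatenation; the two cut-offs agree by
  \<open>compose_Dg_iff\<close>.\<close>

lemma DB_act:
  assumes b: "b \<in> carrier Balgp" and y: "y \<in> span_on (V \<times> ST)"
  shows "vact DB b y = Phi (M_act m p \<delta> N b y)"
proof -
  have "lin_ext (\<lambda>(v, T). if l < card (north_arcs (compose m X v)) then 0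
         else (case dangle_split m n l (compose m X v) of (v', w) \<Rightarrow>
                 fscale (loop_coeff m p \<delta> X v) (tensor (bas v') (\<rho> w T)))) y = Phi (actX X y)"
    if X: "X \<in> BX" for X
  proof -
    let ?g = "\<lambda>(D, T). if card (through_strands (compose m X D)) < N then 0
     else fscale (loop_coeff m p \<delta> X D) (bas (compose m X D, T)) :: diagram \<times> tableau \<Rightarrow> 'k"
    have "Phi (actX X y) = lin_ext (\<lambda>z. Phi (?g z)) y"
      unfolding Phi_def actX_def
      by (rule lin_ext_lin_ext[of "V \<times> ST" y "Dg \<times> ST"])
         (use y X V_Dg actX_bas_span in auto)
    also have "\<dots> = lin_ext (\<lambda>(v, T). if l < card (north_arcs (compose m X v)) then 0
         else (case dangle_split m n l (compose m X v) of (v', w) \<Rightarrow>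
                 fscale (loop_coeff m p \<delta> X v) (tensor (bas v') (\<rho> w T)))) y"
    proof (rule lin_ext_cong[OF y])
      fix z assume "z \<in> V \<times> ST"
      then obtain v T where z: "z = (v, T)" "v \<in> V" by blast
      then have "card (through_strands (compose m X v)) < N \<longleftrightarrow> l < card (north_arcs (compose m X v))"
        using compose_Dg_iff[of X v] V_Dg X by blast
      then show "Phi (?g z) = (case z of (v, T) \<Rightarrow> if l < card (north_arcs (compose m X v)) then 0
         else (case dangle_split m n l (compose m X v) of (v', w) \<Rightarrow>
                 fscale (loop_coeff m p \<delta> X v) (tensor (bas v') (\<rho> w T))))"
        unfolding z by (simp add: Phi_fscale) (simp add: Phi_def split: prod.split)
    qed
    finally show ?thesis by (rule sym)
  qed
  then have "vact DB b y = lin_ext (\<lambda>X. Phi (actX X y)) b"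
    unfolding Delta_bar_def amod.simps
    by (intro lin_ext_cong[of b BX]) (use b carrier_Balgp in auto)
  also have "\<dots> = Phi (M_act m p \<delta> N b y)"
    unfolding Phi_M_act[OF b span_V_Dg[OF y]]
    by (rule lin_ext_eq_sum[OF finite_BX]) (use b carrier_Balgp in simp)
  finally show ?thesis .
qed

lemma mod_closed_DB: "mod_closed Balgp DB"
  unfolding mod_closed_def
proof (intro conjI ballI allI)
  show "vecs DB \<noteq> {}" using span_on_zero by (metis DB_simps(1) empty_iff)
  show "vact DB b x \<in> vecs DB" if "b \<in> carrier Balgp" "x \<in> vecs DB" for b x
    using that by (simp add: DB_act Phi_span M_act_span span_V_Dg)
qed (auto intro: span_on_add span_on_fscale)

lemma sigma_Delta_t: "y \<in> span_on (V \<times> ST) \<Longrightarrow> (sigma_Delta \<xi> d ^^ t) y = sD y"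
  by (rule sigma_Delta_pow[of "V \<times> ST"]) auto

lemma sigma_Delta_m: "y \<in> span_on (V \<times> ST) \<Longrightarrow> sigma_Delta \<xi> m y = y"
proof -
  assume y: "y \<in> span_on (V \<times> ST)"
  have "sigma_Delta \<xi> m y = lin_ext bas y"
    unfolding sigma_Delta_def
  proof (rule lin_ext_cong[OF y], clarify)
    fix v T assume "T \<in> ST"
    then have "length T = m" using std_tableaux_length length_lam by simp
    then show "fscale (\<xi> ^ (m * label_sum v)) (bas (v, sigma m T)) = (bas (v, T) :: _ \<Rightarrow> 'k)"
      by (simp add: power_mult \<xi> sigma_def)
  qed
  then show ?thesis using lin_ext_bas_id[of "V \<times> ST" y] y by simp
qed

lemma Ker_mod_eq:
  "Ker_mod \<xi> d t r DB = DB \<lparr> vecs := {y \<in> vecs DB. (sigma_Delta \<xi> d ^^ t) y = fscale (\<omega> ^ r) y} \<rparr>"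
  by (simp add: Ker_mod_def power_mult)

lemma Ker_vecs: "vecs (Ker_mod \<xi> d t r DB) = {y \<in> span_on (V \<times> ST). sD y = fscale (\<omega> ^ r) y}"
  unfolding Ker_mod_eq using sigma_Delta_t by auto

lemma Ker_simps [simp]: "vadd (Ker_mod \<xi> d t r DB) = (+)" "vscale (Ker_mod \<xi> d t r DB) = fscale"
  "vact (Ker_mod \<xi> d t r DB) = vact DB"
  by (simp_all add: Ker_mod_eq)

lemma eigenspace_decomposition:
  shows "mod_iso Balgp DB (mod_sum (p div t) (\<lambda>r. Ker_mod \<xi> d t r DB))"
    and "mod_closed Balgp (Ker_mod \<xi> d t r DB)"
proof -
  let ?A = "sigma_Delta \<xi> d ^^ t"
  have sp: "sD y \<in> span_on (V \<times> ST)" if "y \<in> span_on (V \<times> ST)" for y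
    by (rule sD_span[OF that])
  have pow: "(?A ^^ j) y = (sD ^^ j) y \<and> (sD ^^ j) y \<in> span_on (V \<times> ST)" if "y \<in> span_on (V \<times> ST)" for j y
    by (induction j) (auto simp: that sigma_Delta_t sp)
  have Aq: "(?A ^^ (p div t)) y = y" if y: "y \<in> vecs DB" for y
  proof -
    have "(?A ^^ (p div t)) y = (sD ^^ (p div t)) y" using pow y by simp
    \<comment> \<open>The exponents multiply to \<open>d * t * (p div t) = m\<close>, and rotation
      by m as well as all powers of \<open>\<xi> ^ m\<close> are trivial.\<close>
    also have "\<dots> = sigma_Delta \<xi> m y"
      using sigma_Delta_pow[where A = "V \<times> ST" and y = y and \<xi> = \<xi> and d = "d * t" and j = "p div t"] y by (simp add: m_eq)
    finally show ?thesis using sigma_Delta_m y by simp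
  qed
  have c: "sD (Phi (M_act m p \<delta> N b y)) = Phi (M_act m p \<delta> N b (sD y))"
    if "b \<in> carrier Balgp" "y \<in> span_on (V \<times> ST)" for b y
    using that by (simp add: M_act_sD Phi_sD M_act_span span_V_Dg)
  note E = mod_iso_eigenspaces[where R = Balgp and M = DB and q = "p div t" and \<omega> = \<omega> and A = ?A,
      OF q_pos \<omega>_root \<omega>_prim mod_closed_DB DB_simps(2,3)]
  show "mod_iso Balgp DB (mod_sum (p div t) (\<lambda>r. Ker_mod \<xi> d t r DB))"
    unfolding Ker_mod_eq
    by (rule E(1)) (use Aq in \<open>auto simp: sigma_Delta_t sp sD_add span_V_Dg sD_fscale span_on_add span_on_fscale
        DB_act M_act_add Phi_add M_act_span M_act_fscale Phi_fscale Phi_span c\<close>)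
  show "mod_closed Balgp (Ker_mod \<xi> d t r DB)"
    unfolding Ker_mod_eq
    by (rule E(2)) (use Aq in \<open>auto simp: sigma_Delta_t sp sD_add span_V_Dg sD_fscale span_on_add span_on_fscale
        DB_act M_act_add Phi_add M_act_span M_act_fscale Phi_fscale Phi_span c\<close>)
qed

end

section \<open>The standard modules as eigenspaces\<close>

lemma mem_coset_iff: "h \<in> f +o R \<longleftrightarrow> h - f \<in> R" for h :: "'a :: ab_group_add"
  by (rule set_minus_plus[symmetric])

lemma coset_plus:
  assumes R: "fspace.subspace R" shows "(f +o R) + (g +o R) = (f + g) +o R"
proof (intro equalityI subsetI)
  fix h assume "h \<in> (f +o R) + (g +o R)"
  then obtain a b where ab: "a - f \<in> R" "b - g \<in> R" "h = a + b"
    by (auto simp: set_plus_def mem_coset_iff)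
  have "(a - f) + (b - g) \<in> R" by (rule fspace.subspace_add[OF R ab(1,2)])
  then show "h \<in> (f + g) +o R" by (simp add: mem_coset_iff ab(3) algebra_simps)
next
  fix h assume "h \<in> (f + g) +o R"
  then have "f \<in> f +o R" "h - f \<in> g +o R"
    using fspace.subspace_0[OF R] by (simp_all add: mem_coset_iff algebra_simps)
  then have "f + (h - f) \<in> (f +o R) + (g +o R)" by (rule set_plus_intro)
  then show "h \<in> (f +o R) + (g +o R)" by simp
qed

text \<open>Shows that scaling and acting, as written in \<open>Delta\<close> with the summand
  \<open>R\<close>, send the coset of \<open>f\<close> to the coset of \<open>L f\<close>.
  Additivity is needed only in the directions of \<open>R\<close>.\<close>

lemma coset_image:
  assumes R: "fspace.subspace R"
    and L: "\<And>z. z \<in> R \<Longrightarrow> L (f + z) = L f + L z" "\<And>z. z \<in> R \<Longrightarrow> L z \<in> R"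
  shows "L ` (f +o R) + R = L f +o R"
proof (intro equalityI subsetI)
  fix h assume "h \<in> L ` (f +o R) + R"
  then obtain a b where ab: "a \<in> f +o R" "b \<in> R" "h = L a + b"
    by (auto simp: set_plus_def)
  then obtain z where z: "z \<in> R" "a = f + z" by (auto simp: elt_set_plus_def)
  have "L z + b \<in> R" by (rule fspace.subspace_add[OF R L(2)[OF z(1)] ab(2)])
  moreover have "h - L f = L z + b" by (simp add: ab(3) z(2) L(1)[OF z(1)])
  ultimately show "h \<in> L f +o R" by (simp only: mem_coset_iff)
next
  fix h assume "h \<in> L f +o R"
  then have "h - L f \<in> R" by (simp only: mem_coset_iff)
  moreover have "f \<in> f +o R" using fspace.subspace_0[OF R] by (simp add: mem_coset_iff)
  ultimately have "L f + (h - L f) \<in> L ` (f +o R) + R" by (intro set_plus_intro imageI)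
  then show "h \<in> L ` (f +o R) + R" by simp
qed

lemma coset_eq_iff:
  assumes R: "fspace.subspace R" shows "f +o R = g +o R \<longleftrightarrow> f - g \<in> R"
proof
  have "f \<in> f +o R" using fspace.subspace_0[OF R] by (simp add: mem_coset_iff)
  then show "f +o R = g +o R \<Longrightarrow> f - g \<in> R" by (simp add: mem_coset_iff)
next
  assume fg: "f - g \<in> R"
  have "h - f \<in> R \<longleftrightarrow> h - g \<in> R" for h
    using fspace.subspace_add[OF R _ fg, of "h - f"] fspace.subspace_diff[OF R _ fg, of "h - g"]
    by (auto simp: algebra_simps)
  then show "f +o R = g +o R" by (auto simp only: mem_coset_iff)
qed

context standard_setup
begin

lemma S_sub_eq: "S_sub \<xi> d lam t r = {x \<in> span_on ST. Rot x = fscale (\<omega> ^ r) x}"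
  by (auto simp: S_sub_def sigma_tableaux_pow[OF finite_std_tableaux, of _ lam] power_mult)

lemma MB_label: "D \<in> MB \<Longrightarrow> \<omega> ^ label_sum D = 1"
  using \<omega>_cong[of "label_sum D" 0] by (simp add: MB_iff)

text \<open>Label sums in \<open>MB\<close> are multiples of p, so the weights are 1 and only the
  rotation of the tableau factor is left.\<close>

lemma sD_section:
  assumes f: "f \<in> span_on (MB \<times> ST)"
  shows "(\<lambda>T. sD f (D, T)) = Rot (\<lambda>T. f (D, T))"
proof (rule span_on_prod_induct[OF _ _ f])
  show "(\<lambda>T. sD 0 (D, T)) = Rot (\<lambda>T. 0 (D, T))"
  proof -
    have "(\<lambda>T. (0 :: diagram \<times> tableau \<Rightarrow> 'k) (D, T)) = 0" by (simp add: fun_eq_iff)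
    moreover have "(\<lambda>T. sD 0 (D, T)) = 0" by (simp only: sD_zero) (simp add: fun_eq_iff)
    ultimately show ?thesis by (simp only: lin_ext_zero)
  qed
next
  fix g h :: "diagram \<times> tableau \<Rightarrow> 'k"
  assume gh: "g \<in> span_on (MB \<times> ST)" "h \<in> span_on (MB \<times> ST)"
    "(\<lambda>T. sD g (D, T)) = Rot (\<lambda>T. g (D, T))" "(\<lambda>T. sD h (D, T)) = Rot (\<lambda>T. h (D, T))"
  have "(\<lambda>T. sD (g + h) (D, T)) = (\<lambda>T. sD g (D, T)) + (\<lambda>T. sD h (D, T))"
    by (simp add: sD_add gh(1,2) span_MB_Dg fun_eq_iff)
  also have "\<dots> = Rot ((\<lambda>T. g (D, T)) + (\<lambda>T. h (D, T)))"
    unfolding gh(3,4)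
    by (rule lin_ext_add[OF finite_std_tableaux section_in_span_on[OF gh(1)] section_in_span_on[OF gh(2)], symmetric])
  also have "(\<lambda>T. g (D, T)) + (\<lambda>T. h (D, T)) = (\<lambda>T. (g + h) (D, T))"
    by (simp add: fun_eq_iff)
  finally show "(\<lambda>T. sD (g + h) (D, T)) = Rot (\<lambda>T. (g + h) (D, T))" .
next
  fix D' assume D': "D' \<in> MB"
  define x where "x = (\<lambda>T. f (D', T))"
  have x: "x \<in> span_on ST" unfolding x_def by (rule section_in_span_on[OF f])
  have "(\<lambda>T. sD (tensor (bas D') x) (D, T)) = (if D = D' then Rot x else 0)"
    by (simp only: sD_tensor[OF x] MB_label[OF D'] fscale_one tensor_section)
  then show "(\<lambda>T. sD (tensor (bas D') x) (D, T)) = Rot (\<lambda>T. tensor (bas D') x (D, T))"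
    by (simp only: tensor_section lin_ext_zero if_distrib[of Rot])
qed simp_all

abbreviation "Kr r \<equiv> Ker_mod \<xi> d t r DB"
abbreviation "Dr r \<equiv> Delta m p d \<xi> \<delta> n l lam \<rho> t r"
abbreviation "MT r \<equiv> M_tensor MB lam (S_sub \<xi> d lam t r)"

text \<open>Section by section, lying in S(\<lambda>^r) is an eigenvector condition for the
  rotation. The tensor product thus takes the same form as the kernel in the restricted module, and
  maps commuting with \<open>sD\<close> pass between the two.\<close>

lemma M_tensor_eq: "MT r = {f \<in> span_on (MB \<times> ST). sD f = fscale (\<omega> ^ r) f}"
proof -
  have "(\<forall>D. (\<lambda>T. f (D, T)) \<in> S_sub \<xi> d lam t r) \<longleftrightarrow> sD f = fscale (\<omega> ^ r) f"
    if f: "f \<in> span_on (MB \<times> ST)" for f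
  proof -
    have "(\<lambda>T. f (D, T)) \<in> S_sub \<xi> d lam t r \<longleftrightarrow>
        (\<forall>T. sD f (D, T) = fscale (\<omega> ^ r) f (D, T))" for D
      unfolding S_sub_eq using section_in_span_on[OF f, of D]
      by (simp add: sD_section[OF f, symmetric] fun_eq_iff fscale_def)
    then show ?thesis by (simp add: fun_eq_iff)
  qed
  then show ?thesis by (auto simp: M_tensor_def)
qed

lemma MT_span: "f \<in> MT r \<Longrightarrow> f \<in> span_on (MB \<times> ST)" and MT_span_Dg: "f \<in> MT r \<Longrightarrow> f \<in> span_on (Dg \<times> ST)"
  using span_MB_Dg by (auto simp: M_tensor_def)

lemma tensor_in_MT: "D \<in> MB \<Longrightarrow> x \<in> S_sub \<xi> d lam t r \<Longrightarrow> tensor (bas D) x \<in> MT r"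
proof -
  assume D: "D \<in> MB" and x: "x \<in> S_sub \<xi> d lam t r"
  have xS: "x \<in> span_on ST" "Rot x = fscale (\<omega> ^ r) x" using x by (auto simp: S_sub_eq)
  show ?thesis
    unfolding M_tensor_eq
    by (simp add: tensor_bas_in_span_on D xS sD_tensor MB_label tensor_fscale)
qed

lemma subspace_MT: "fspace.subspace (MT r)"
  unfolding fspace.subspace_def M_tensor_eq
proof (intro conjI ballI allI)
  show "0 \<in> {f \<in> span_on (MB \<times> ST). sD f = fscale (\<omega> ^ r) f}"
    by (simp only: mem_Collect_eq span_on_zero sD_zero fscale_0)
  show "f + g \<in> {f \<in> span_on (MB \<times> ST). sD f = fscale (\<omega> ^ r) f}"
    if "f \<in> {f \<in> span_on (MB \<times> ST). sD f = fscale (\<omega> ^ r) f}"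
      "g \<in> {f \<in> span_on (MB \<times> ST). sD f = fscale (\<omega> ^ r) f}" for f g
    using that by (auto simp: sD_add span_MB_Dg fscale_add intro: span_on_add)
  show "fscale c f \<in> {f \<in> span_on (MB \<times> ST). sD f = fscale (\<omega> ^ r) f}"
    if "f \<in> {f \<in> span_on (MB \<times> ST). sD f = fscale (\<omega> ^ r) f}" for c f
    using that by (auto simp: sD_fscale mult.commute intro: span_on_fscale)
qed

lemma compose_MB:
  assumes X: "X \<in> BX" and D: "D \<in> MB"
    and through: "\<not> card (through_strands (compose m X D)) < N" and lc: "loop_coeff m p \<delta> X D \<noteq> 0"
  shows "compose m X D \<in> MB"
proof -
  have Xd: "X \<in> diagrams m n n" using X by blast
  have "compose m X D \<in> Dg" using compose_Dg_iff(1)[OF Xd MB_Dg[OF D]] through by blast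
  moreover have "label_sum (compose m X D) mod p = (label_sum X + label_sum D) mod p"
    by (rule label_sum_compose_mod[OF Xd M_basis_diagram[OF D] p_dvd_m lc])
  then have "p dvd label_sum (compose m X D)"
    using X D by (simp add: MB_iff dvd_eq_mod_eq_0) (metis add_0 mod_add_eq mod_0)
  ultimately show ?thesis by (simp add: MB_iff)
qed

lemma actX_MB_span:
  assumes X: "X \<in> BX" and f: "f \<in> span_on (MB \<times> ST)"
  shows "actX X f \<in> span_on (MB \<times> ST)"
  unfolding actX_def
proof (rule lin_ext_in_span_on[OF f])
  fix z assume "z \<in> MB \<times> ST"
  then obtain D T where z: "z = (D, T)" "D \<in> MB" "T \<in> ST" by blast
  show "(case z of (D, T) \<Rightarrow> if card (through_strands (compose m X D)) < N then 0
     else fscale (loop_coeff m p \<delta> X D) (bas (compose m X D, T))) \<in> span_on (MB \<times> ST)"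
  proof (cases "card (through_strands (compose m X D)) < N \<or> loop_coeff m p \<delta> X D = 0")
    case False
    then show ?thesis using compose_MB[OF X z(2)] z by (simp add: span_on_fscale)
  qed (auto simp: z)
qed

lemma M_act_MT:
  assumes b: "b \<in> carrier Balgp" and f: "f \<in> MT r"
  shows "M_act m p \<delta> N b f \<in> MT r"
proof -
  have "M_act m p \<delta> N b f \<in> span_on (MB \<times> ST)"
    unfolding M_act_sum[OF b] by (intro span_on_sum span_on_fscale actX_MB_span MT_span[OF f])
  moreover have "sD (M_act m p \<delta> N b f) = fscale (\<omega> ^ r) (M_act m p \<delta> N b f)"
    using f by (simp add: M_act_sD[OF b MT_span_Dg[OF f], symmetric] M_act_fscale[OF b, symmetric])
      (simp add: M_tensor_eq)
  ultimately show ?thesis by (simp add: M_tensor_eq)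
qed

section \<open>The tensor relations over the algebra of G(m,p,N)\<close>

abbreviation "Rel r \<equiv> M_rel m MB (Ggrp m p N) (S_sub \<xi> d lam t r) \<rho>"

text \<open>The character \<omega>^|g| is trivial on G(m,p,N), so there the rotation commutes with
  the group and its eigenspaces are submodules.\<close>

lemma S_sub_\<rho>:
  assumes g: "g \<in> Ggrp m p N" and x: "x \<in> S_sub \<xi> d lam t r"
  shows "lin_ext (\<rho> g) x \<in> S_sub \<xi> d lam t r"
proof -
  have gG: "g \<in> G" by (rule Ggrp_mono[OF g])
  have "\<omega> ^ label_sum g = 1"
    using \<omega>_cong[of "label_sum g" 0] g by (simp add: Ggrp_def)
  then show ?thesis
    using x by (simp add: S_sub_eq \<rho>_span'[OF gG] Rot_\<rho>[OF gG] lin_ext_fscale)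
qed

lemma compose_MB_Ggrp:
  assumes D: "D \<in> MB" and g: "g \<in> Ggrp m p N" shows "compose m D g \<in> MB"
proof -
  have gG: "g \<in> G" by (rule Ggrp_mono[OF g])
  have "label_sum (compose m D g) mod p = (label_sum D + label_sum g) mod p"
    by (rule mod_m_imp_mod_p[OF label_sum_compose_Ggrp[OF m M_basis_diagram[OF D] gG]])
  then have "p dvd label_sum (compose m D g)"
    using D g by (simp add: MB_iff Ggrp_def dvd_eq_mod_eq_0) (metis add_0 mod_add_eq mod_0)
  then show ?thesis
    using compose_Ggrp_in_M_basis[OF m ln MB_Dg[OF D] gG] by (simp add: MB_iff)
qed

lemma Rel_induct [consumes 1, case_names gen]:
  assumes "z \<in> Rel r" "fspace.subspace {z. P z}"
    and "\<And>D g x. D \<in> MB \<Longrightarrow> g \<in> Ggrp m p N \<Longrightarrow> x \<in> S_sub \<xi> d lam t r \<Longrightarrow>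
       P (tensor (bas (compose m D g)) x - tensor (bas D) (lin_ext (\<rho> g) x))"
  shows "P z"
proof -
  have "{tensor (bas (compose m D g)) x - tensor (bas D) (lin_ext (\<rho> g) x) | D g x.
      D \<in> MB \<and> g \<in> Ggrp m p N \<and> x \<in> S_sub \<xi> d lam t r} \<subseteq> {z. P z}"
    using assms(3) by blast
  from fspace.span_minimal[OF this assms(2)] show ?thesis
    using assms(1) by (auto simp: M_rel_def)
qed

lemma Rel_gen: "D \<in> MB \<Longrightarrow> g \<in> Ggrp m p N \<Longrightarrow> x \<in> S_sub \<xi> d lam t r \<Longrightarrow>
   tensor (bas (compose m D g)) x - tensor (bas D) (lin_ext (\<rho> g) x) \<in> Rel r"
  unfolding M_rel_def by (rule fspace.span_base) blast

lemma subspace_Rel: "fspace.subspace (Rel r)"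
  unfolding M_rel_def by (rule fspace.subspace_span)

lemmas Rel_zero = fspace.subspace_0[OF subspace_Rel]
  and Rel_add = fspace.subspace_add[OF subspace_Rel]
  and Rel_scale = fspace.subspace_scale[OF subspace_Rel]
  and Rel_sum = fspace.subspace_sum[OF subspace_Rel]

lemma Rel_MT: "z \<in> Rel r \<Longrightarrow> z \<in> MT r"
proof (induction rule: Rel_induct)
  show "fspace.subspace {z. z \<in> MT r}" using subspace_MT by simp
  show "tensor (bas (compose m D g)) x - tensor (bas D) (lin_ext (\<rho> g) x) \<in> MT r"
    if "D \<in> MB" "g \<in> Ggrp m p N" "x \<in> S_sub \<xi> d lam t r" for D g x
    using that by (intro fspace.subspace_diff[OF subspace_MT] tensor_in_MT compose_MB_Ggrp S_sub_\<rho>)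
qed

text \<open>For \<open>D = v w\<close>, both sides of a relation have the image of \<open>v\<close>
  with \<open>w g x\<close>.\<close>

lemma Phi_Rel: "z \<in> Rel r \<Longrightarrow> Phi z = 0"
proof -
  assume z: "z \<in> Rel r"
  \<comment> \<open>Membership in \<open>MT r\<close> is carried along because additivity of
    \<open>Phi\<close> is available only for vectors supported on the finite basis.\<close>
  have "z \<in> MT r \<and> Phi z = 0"
    using z
  proof (induction rule: Rel_induct)
    show "fspace.subspace {z. z \<in> MT r \<and> Phi z = 0}"
      unfolding fspace.subspace_def
      by (auto simp del: zero_fun_apply simp: Phi_add Phi_fscale MT_span_Dg fspace.subspace_0[OF subspace_MT]
          fspace.subspace_add[OF subspace_MT] fspace.subspace_scale[OF subspace_MT])
  next
    fix D g x assume D: "D \<in> MB" and g: "g \<in> Ggrp m p N" and x: "x \<in> S_sub \<xi> d lam t r"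
    have gG: "g \<in> G" by (rule Ggrp_mono[OF g])
    have xS: "x \<in> span_on ST" using x by (simp add: S_sub_eq)
    obtain v w where vw: "v \<in> V" "w \<in> G" "compose m v w = D" "dangle_split m n l D = (v, w)"
      by (rule Dg_split[OF MB_Dg[OF D]])
    have s: "dangle_split m n l (compose m D g) = (v, compose m w g)"
      by (rule dangle_split_compose_Ggrp[OF m ln MB_Dg[OF D] gG vw(4)])
    have MT: "tensor (bas (compose m D g)) x \<in> MT r" "tensor (bas D) (lin_ext (\<rho> g) x) \<in> MT r"
      by (intro tensor_in_MT compose_MB_Ggrp S_sub_\<rho> D g x)+
    have "Phi (tensor (bas (compose m D g)) x - tensor (bas D) (lin_ext (\<rho> g) x)) =
        Phi (tensor (bas (compose m D g)) x) - Phi (tensor (bas D) (lin_ext (\<rho> g) x))"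
      by (rule Phi_diff) (use MT MT_span_Dg in blast)+
    also have "\<dots> = 0"
      by (simp only: Phi_tensor[OF s xS] Phi_tensor[OF vw(4) \<rho>_span'[OF gG xS]] \<rho>_compose[OF vw(2) gG xS] diff_self)
    finally show "tensor (bas (compose m D g)) x - tensor (bas D) (lin_ext (\<rho> g) x) \<in> MT r \<and>
        Phi (tensor (bas (compose m D g)) x - tensor (bas D) (lin_ext (\<rho> g) x)) = 0"
      using MT fspace.subspace_diff[OF subspace_MT] by blast
  qed
  then show ?thesis by blast
qed

text \<open>Because X(D g) = (X D) g with equal coefficient and cut-off, a relation at
  \<open>D\<close> becomes a multiple of the relation at \<open>X D\<close>, or 0.\<close>

lemma actX_Rel:
  assumes X: "X \<in> BX" and z: "z \<in> Rel r" shows "actX X z \<in> Rel r"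
proof -
  have Xd: "X \<in> diagrams m n n" using X by blast
  have "z \<in> MT r \<and> actX X z \<in> Rel r"
    using z
  proof (induction rule: Rel_induct)
    show "fspace.subspace {z. z \<in> MT r \<and> actX X z \<in> Rel r}"
      unfolding fspace.subspace_def
      by (auto simp del: zero_fun_apply simp: actX_add actX_fscale MT_span_Dg fspace.subspace_0[OF subspace_MT]
          fspace.subspace_add[OF subspace_MT] fspace.subspace_scale[OF subspace_MT] Rel_zero Rel_add Rel_scale)
  next
    fix D g x assume D: "D \<in> MB" and g: "g \<in> Ggrp m p N" and x: "x \<in> S_sub \<xi> d lam t r"
    have gG: "g \<in> G" by (rule Ggrp_mono[OF g])
    have xS: "x \<in> span_on ST" using x by (simp add: S_sub_eq)
    let ?z = "tensor (bas (compose m D g)) x - tensor (bas D) (lin_ext (\<rho> g) x)"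
    have MT: "tensor (bas (compose m D g)) x \<in> MT r" "tensor (bas D) (lin_ext (\<rho> g) x) \<in> MT r"
      by (intro tensor_in_MT compose_MB_Ggrp S_sub_\<rho> D g x)+
    have assoc: "compose m X (compose m D g) = compose m (compose m X D) g"
      and lc: "loop_coeff m p \<delta> X (compose m D g) = loop_coeff m p \<delta> X D"
      by (rule compose_compose_Ggrp[OF m Xd M_basis_diagram[OF D] gG])+
    have na: "north_arcs (compose m X (compose m D g)) = north_arcs (compose m X D)"
      unfolding assoc by (rule north_arcs_compose_Ggrp[OF m compose_in_diagrams[OF m Xd M_basis_diagram[OF D]] gG])
    have iff: "card (through_strands (compose m X (compose m D g))) < N \<longleftrightarrow> card (through_strands (compose m X D)) < N"
      using compose_Dg_iff[OF Xd MB_Dg[OF D]] compose_Dg_iff[OF Xd MB_Dg[OF compose_MB_Ggrp[OF D g]]] na by simp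
    have "actX X ?z = actX X (tensor (bas (compose m D g)) x) - actX X (tensor (bas D) (lin_ext (\<rho> g) x))"
      by (rule actX_diff) (use MT MT_span_Dg in blast)+
    also have "\<dots> = (if card (through_strands (compose m X D)) < N then 0 else
        fscale (loop_coeff m p \<delta> X D) (tensor (bas (compose m (compose m X D) g)) x - tensor (bas (compose m X D)) (lin_ext (\<rho> g) x)))"
      by (simp only: actX_tensor[OF xS] actX_tensor[OF \<rho>_span'[OF gG xS]] iff[unfolded assoc] lc assoc fscale_diff diff_self split: if_split) simp
    also have "\<dots> \<in> Rel r"
    proof (cases "card (through_strands (compose m X D)) < N \<or> loop_coeff m p \<delta> X D = 0")
      case True
      then show ?thesis using Rel_zero by auto
    next
      \<comment> \<open>Only with nonzero coefficient is the label sum of \<open>X D\<close> known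
        to be a multiple of p, so that the relation at \<open>X D\<close> belongs to the
        generators.\<close>
      case False
      then have "compose m X D \<in> MB" using compose_MB[OF X D] by blast
      then show ?thesis using False Rel_scale[OF Rel_gen[OF _ g x]] by simp
    qed
    finally show "?z \<in> MT r \<and> actX X ?z \<in> Rel r"
      using MT fspace.subspace_diff[OF subspace_MT] by blast
  qed
  then show ?thesis by blast
qed

lemma M_act_Rel: "b \<in> carrier Balgp \<Longrightarrow> z \<in> Rel r \<Longrightarrow> M_act m p \<delta> N b z \<in> Rel r"
  by (simp only: M_act_sum) (intro Rel_sum Rel_scale actX_Rel)

lemma Delta_simps:
  "vecs (Dr r) = {f +o Rel r | f. f \<in> MT r}"
  "vadd (Dr r) = (+)"
  "vscale (Dr r) = (\<lambda>c C. fscale c ` C + Rel r)"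
  "vact (Dr r) = (\<lambda>b C. M_act m p \<delta> N b ` C + Rel r)"
  by (simp_all add: Delta_def Let_def)

lemma coset_fscale: "fscale c ` (f +o Rel r) + Rel r = fscale c f +o Rel r"
  by (rule coset_image[OF subspace_Rel]) (simp_all add: fscale_add Rel_scale)

lemma coset_M_act:
  assumes "b \<in> carrier Balgp" "f \<in> MT r"
  shows "M_act m p \<delta> N b ` (f +o Rel r) + Rel r = M_act m p \<delta> N b f +o Rel r"
proof (rule coset_image[OF subspace_Rel])
  fix z assume z: "z \<in> Rel r"
  show "M_act m p \<delta> N b (f + z) = M_act m p \<delta> N b f + M_act m p \<delta> N b z"
    by (rule M_act_add[OF assms(1) MT_span_Dg[OF assms(2)] MT_span_Dg[OF Rel_MT[OF z]]])
  show "M_act m p \<delta> N b z \<in> Rel r" by (rule M_act_Rel[OF assms(1) z])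
qed

lemma mod_closed_Delta: "mod_closed Balgp (Dr r)"
  unfolding mod_closed_def Delta_simps
proof (intro conjI ballI allI)
  show "{f +o Rel r |f. f \<in> MT r} \<noteq> {}" using fspace.subspace_0[OF subspace_MT] by blast
  show "C + C' \<in> {f +o Rel r |f. f \<in> MT r}"
    if C: "C \<in> {f +o Rel r |f. f \<in> MT r}" "C' \<in> {f +o Rel r |f. f \<in> MT r}" for C C'
  proof -
    obtain f g where fg: "f \<in> MT r" "g \<in> MT r" "C = f +o Rel r" "C' = g +o Rel r" using C by blast
    show ?thesis
      using fspace.subspace_add[OF subspace_MT fg(1,2)] unfolding fg(3,4) coset_plus[OF subspace_Rel] by blast
  qed
  show "fscale c ` C + Rel r \<in> {f +o Rel r |f. f \<in> MT r}" if C: "C \<in> {f +o Rel r |f. f \<in> MT r}" for c C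
  proof -
    obtain f where f: "f \<in> MT r" "C = f +o Rel r" using C by blast
    show ?thesis
      using fspace.subspace_scale[OF subspace_MT f(1)] unfolding f(2) coset_fscale by blast
  qed
  show "M_act m p \<delta> N b ` C + Rel r \<in> {f +o Rel r |f. f \<in> MT r}"
    if b: "b \<in> carrier Balgp" and C: "C \<in> {f +o Rel r |f. f \<in> MT r}" for b C
  proof -
    obtain f where f: "f \<in> MT r" "C = f +o Rel r" using C by blast
    show ?thesis
      using M_act_MT[OF b f(1)] unfolding f(2) coset_M_act[OF b f(1)] by blast
  qed
qed

text \<open>Multiplying a dangle \<open>v\<close> by a group element of label \<open>-|v|\<close> moves it into \<open>M\<^sub>l\<close>;
  this needs a free line.\<close>

lemma relabelling_ex:
  assumes N: "0 < N" and v: "v \<in> V"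
  shows "\<exists>u u'. u \<in> G \<and> u' \<in> G \<and> compose m u u' = idd N \<and> compose m v u \<in> MB \<and>
    label_sum u' mod p = label_sum v mod p"
proof -
  note vd = M_basis_diagram[OF V_Dg[OF v]]
  \<comment> \<open>The prescribed label represents the negative of the label sum of
    \<open>v\<close> modulo m.\<close>
  obtain u where u: "u \<in> G" "label_sum u mod m = ((m - 1) * label_sum v) mod m"
    by (rule Ggrp_with_label[OF m N])
  obtain u' where u': "u' \<in> G" "compose m u u' = idd N" "compose m u' u = idd N"
    by (rule Ggrp_inverse[OF m u(1)])
  have s: "label_sum v + (m - 1) * label_sum v = m * label_sum v" using m by (cases m) simp_all
  have vu: "(label_sum v + label_sum u) mod m = 0"
    using mod_add_cong[OF refl[of "label_sum v mod m"] u(2)] by (simp add: s)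
  have "label_sum (compose m v u) mod m = 0"
    using label_sum_compose_Ggrp[OF m vd u(1)] vu by simp
  then have "p dvd label_sum (compose m v u)" using p_dvd_m by (meson dvd_eq_mod_eq_0 dvd_trans)
  then have MB: "compose m v u \<in> MB"
    using compose_Ggrp_in_M_basis[OF m ln V_Dg[OF v] u(1)] by (simp add: MB_iff)
  have "(label_sum u + label_sum u') mod m = 0"
    using label_sum_compose_Ggrp[OF m Ggrp_subset_diagrams[OF u(1)] u'(1)] by (simp add: u'(2))
  then have "(label_sum u' + (label_sum v + label_sum u)) mod m = label_sum v mod m"
    by (metis add.assoc add.commute add.right_neutral mod_add_right_eq)
  then have "label_sum u' mod m = label_sum v mod m"
    using vu by (metis add.right_neutral mod_add_right_eq)
  then have "label_sum u' mod p = label_sum v mod p" by (rule mod_m_imp_mod_p)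
  then show ?thesis using u u' MB by blast
qed

text \<open>The map goes from the kernel to the quotient, so nothing has to be defined on cosets. It
  is injective because \<open>Phi\<close> inverts \<psi> on the nose and kills the relations, and
  surjective because \<psi> inverts \<open>Phi\<close> modulo the relations.\<close>

lemma Ker_iso_Delta:
  assumes N: "0 < N"
  shows "mod_iso Balgp (Kr r) (Dr r)"
proof -
  have "\<forall>v\<in>V. \<exists>u u'. u \<in> G \<and> u' \<in> G \<and> compose m u u' = idd N \<and> compose m v u \<in> MB \<and>
    label_sum u' mod p = label_sum v mod p"
    using relabelling_ex[OF N] by blast
  then obtain u where "\<forall>v\<in>V. \<exists>u'. u v \<in> G \<and> u' \<in> G \<and> compose m (u v) u' = idd N \<and> compose m v (u v) \<in> MB \<and>
    label_sum u' mod p = label_sum v mod p"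
    by (rule bchoice[THEN exE])
  then obtain u' where uu': "\<forall>v\<in>V. u v \<in> G \<and> u' v \<in> G \<and> compose m (u v) (u' v) = idd N \<and> compose m v (u v) \<in> MB \<and>
    label_sum (u' v) mod p = label_sum v mod p"
    by (rule bchoice[THEN exE])
  then have u: "u v \<in> G" "u' v \<in> G" "compose m (u v) (u' v) = idd N" "compose m v (u v) \<in> MB"
    "label_sum (u' v) mod p = label_sum v mod p" if "v \<in> V" for v
    using that by blast+
  define \<psi> where "\<psi> = lin_ext (\<lambda>(v, T). tensor (bas (compose m v (u v))) (\<rho> (u' v) T))"
  have \<psi>_tensor: "\<psi> (tensor (bas v) x) = tensor (bas (compose m v (u v))) (lin_ext (\<rho> (u' v)) x)"
    if x: "x \<in> span_on ST" for v x
    unfolding \<psi>_def lin_ext_tensor_bas[OF finite_std_tableaux x]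
    by (simp add: lin_ext_tensor[OF finite_std_tableaux x])
  have \<psi>_add: "\<psi> (y + z) = \<psi> y + \<psi> z" if "y \<in> span_on (V \<times> ST)" "z \<in> span_on (V \<times> ST)" for y z
    unfolding \<psi>_def by (rule lin_ext_add[of "V \<times> ST"]) (use that in auto)
  have \<psi>_fscale: "\<psi> (fscale c y) = fscale c (\<psi> y)" for c y
    unfolding \<psi>_def by (rule lin_ext_fscale)
  have \<psi>_zero: "\<psi> 0 = 0"
    unfolding \<psi>_def by (rule lin_ext_zero)
  have \<psi>_span: "\<psi> y \<in> span_on (MB \<times> ST)" if "y \<in> span_on (V \<times> ST)" for y
    unfolding \<psi>_def
  proof (rule lin_ext_in_span_on[OF that])
    fix z assume "z \<in> V \<times> ST"
    then obtain v T where z: "z = (v, T)" "v \<in> V" "T \<in> ST" by blast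
    show "(case z of (v, T) \<Rightarrow> tensor (bas (compose m v (u v))) (\<rho> (u' v) T)) \<in> span_on (MB \<times> ST)"
      using tensor_bas_in_span_on[OF u(4)[OF z(2)] \<rho>_span[OF u(2)[OF z(2)] z(3)]] by (simp add: z(1))
  qed
  have Phi_\<psi>: "Phi (\<psi> y) = y" if y: "y \<in> span_on (V \<times> ST)" for y
  proof (rule span_on_prod_induct[OF _ _ y])
    show "Phi (\<psi> 0) = 0" by (simp only: \<psi>_zero Phi_zero)
    show "Phi (\<psi> (g + h)) = g + h"
      if "g \<in> span_on (V \<times> ST)" "h \<in> span_on (V \<times> ST)" "Phi (\<psi> g) = g" "Phi (\<psi> h) = h" for g h
      using that by (simp only: \<psi>_add Phi_add span_MB_Dg \<psi>_span)
    fix v assume v: "v \<in> V"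
    define x where "x = (\<lambda>T. y (v, T))"
    have x: "x \<in> span_on ST" unfolding x_def by (rule section_in_span_on[OF y])
    have s: "dangle_split m n l (compose m v (u v)) = (v, u v)"
      by (rule dangle_split_compose[OF m ln v u(1)[OF v]])
    show "Phi (\<psi> (tensor (bas v) x)) = tensor (bas v) x"
      by (simp only: \<psi>_tensor[OF x] Phi_tensor[OF s \<rho>_span'[OF u(2)[OF v] x]]
          \<rho>_compose[OF u(1,2)[OF v] x, symmetric] u(3)[OF v] \<rho>_idd[OF x])
  qed simp_all
  \<comment> \<open>The weight \<omega>^|v| on the dangle side reappears as the factor from moving
    the rotation past \<open>u' v\<close>, whose label agrees with that of \<open>v\<close> modulo
    p; the diagram \<open>v u\<close> itself has weight 1.\<close>
  have sD_\<psi>: "sD (\<psi> y) = \<psi> (sD y)" if y: "y \<in> span_on (V \<times> ST)" for y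
  proof (rule span_on_prod_induct[OF _ _ y])
    show "sD (\<psi> 0) = \<psi> (sD 0)" by (simp only: \<psi>_zero sD_zero)
    show "sD (\<psi> (g + h)) = \<psi> (sD (g + h))"
      if "g \<in> span_on (V \<times> ST)" "h \<in> span_on (V \<times> ST)" "sD (\<psi> g) = \<psi> (sD g)" "sD (\<psi> h) = \<psi> (sD h)" for g h
      using that by (simp only: \<psi>_add sD_add span_MB_Dg span_V_Dg \<psi>_span sD_span)
    fix v assume v: "v \<in> V"
    define x where "x = (\<lambda>T. y (v, T))"
    have x: "x \<in> span_on ST" unfolding x_def by (rule section_in_span_on[OF y])
    show "sD (\<psi> (tensor (bas v) x)) = \<psi> (sD (tensor (bas v) x))"
      by (simp only: \<psi>_tensor[OF x] \<psi>_tensor[OF Rot_span[OF x]] sD_tensor[OF x] \<psi>_fscale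
          sD_tensor[OF \<rho>_span'[OF u(2)[OF v] x]] MB_label[OF u(4)[OF v]] fscale_one
          Rot_\<rho>[OF u(2)[OF v] x] \<omega>_cong[OF u(5)[OF v]] tensor_fscale)
  qed simp_all
  have \<psi>_MT: "\<psi> y \<in> MT r" if "y \<in> vecs (Kr r)" for y
    using that by (simp add: Ker_vecs M_tensor_eq \<psi>_span sD_\<psi> \<psi>_fscale)
  have Phi_Ker: "Phi f \<in> vecs (Kr r)" if f: "f \<in> MT r" for f
    using f MT_span_Dg[OF f] by (simp add: Ker_vecs Phi_span Phi_sD[symmetric])
      (simp add: M_tensor_eq Phi_fscale)
  have gen: "tensor (bas D) x - \<psi> (Phi (tensor (bas D) x)) \<in> Rel r"
    if D: "D \<in> MB" and x: "x \<in> S_sub \<xi> d lam t r" for D x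
  proof -
    have xS: "x \<in> span_on ST" using x by (simp add: S_sub_eq)
    obtain v w where vw: "v \<in> V" "w \<in> G" "compose m v w = D" "dangle_split m n l D = (v, w)"
      by (rule Dg_split[OF MB_Dg[OF D]])
    note vd = M_basis_diagram[OF V_Dg[OF vw(1)]] and uv = u[OF vw(1)]
    note wd = Ggrp_subset_diagrams[OF vw(2)]
    \<comment> \<open>This is the element with \<open>(v u) g = D\<close>. Both diagrams have label
      sums divisible by p, so \<open>g\<close> lies in G(m,p,N) and the relation at
      \<open>v u\<close> and \<open>g\<close> applies.\<close>
    let ?g = "compose m (u' v) w"
    have gG: "?g \<in> G" by (rule compose_in_Ggrp[OF m uv(2) vw(2)])
    have ug: "compose m (u v) ?g = w"
    proof -
      have "compose m (u v) ?g = compose m (idd N) w"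
        unfolding uv(3)[symmetric] by (rule compose_Ggrp_assoc[OF m Ggrp_subset_diagrams[OF uv(1)] uv(2) vw(2), symmetric])
      also have "\<dots> = w"
      proof -
        obtain \<pi> a where "\<pi> permutes {1..N}" "w = twist m \<pi> a (idd N)" by (rule Ggrp_eq_twist[OF vw(2)])
        then show ?thesis using compose_twist_idd[OF m idd_in_diagrams[OF m]] by simp
      qed
      finally show ?thesis .
    qed
    have Dg: "compose m (compose m v (u v)) ?g = D"
      by (simp only: compose_Ggrp_assoc[OF m vd uv(1) gG] ug vw(3))
    have "label_sum D mod p = (label_sum (compose m v (u v)) + label_sum ?g) mod p"
      using mod_m_imp_mod_p[OF label_sum_compose_Ggrp[OF m M_basis_diagram[OF uv(4)] gG]] by (simp only: Dg)
    then have "p dvd label_sum ?g"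
      using D uv(4) by (simp add: MB_iff dvd_eq_mod_eq_0) (metis add_0 mod_add_left_eq)
    then have g: "?g \<in> Ggrp m p N" using gG by (simp add: Ggrp_def)
    have "\<psi> (Phi (tensor (bas D) x)) = tensor (bas (compose m v (u v))) (lin_ext (\<rho> ?g) x)"
      by (simp only: Phi_tensor[OF vw(4) xS] \<psi>_tensor[OF \<rho>_span'[OF vw(2) xS]] \<rho>_compose[OF uv(2) vw(2) xS])
    then show ?thesis using Rel_gen[OF uv(4) g x] by (simp only: Dg)
  qed
  have \<psi>_Phi: "f - \<psi> (Phi f) \<in> Rel r" if f: "f \<in> MT r" for f
  proof (rule span_on_prod_induct[OF _ _ MT_span[OF f]])
    show "0 - \<psi> (Phi 0) \<in> Rel r" using Rel_zero by (simp only: Phi_zero \<psi>_zero diff_self)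
    show "(g + h) - \<psi> (Phi (g + h)) \<in> Rel r"
      if "g \<in> span_on (MB \<times> ST)" "h \<in> span_on (MB \<times> ST)" "g - \<psi> (Phi g) \<in> Rel r" "h - \<psi> (Phi h) \<in> Rel r" for g h
    proof -
      have "(g + h) - \<psi> (Phi (g + h)) = (g - \<psi> (Phi g)) + (h - \<psi> (Phi h))"
        using that(1,2) by (simp add: Phi_add \<psi>_add Phi_span span_MB_Dg)
      then show ?thesis using Rel_add[OF that(3,4)] by (simp only:)
    qed
    show "tensor (bas D) (\<lambda>T. f (D, T)) - \<psi> (Phi (tensor (bas D) (\<lambda>T. f (D, T)))) \<in> Rel r" if "D \<in> MB" for D
      by (rule gen[OF that]) (use f in \<open>simp add: M_tensor_def\<close>)
  qed simp_all
  define \<phi> where "\<phi> y = \<psi> y +o Rel r" for y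
  have sp: "y \<in> span_on (V \<times> ST)" if "y \<in> vecs (Kr r)" for y
    using that by (simp add: Ker_vecs)
  have "bij_betw \<phi> (vecs (Kr r)) (vecs (Dr r))"
    unfolding bij_betw_def
  proof
    show "inj_on \<phi> (vecs (Kr r))"
    proof (rule inj_onI)
      fix y z assume yz: "y \<in> vecs (Kr r)" "z \<in> vecs (Kr r)" "\<phi> y = \<phi> z"
      then have "\<psi> y - \<psi> z \<in> Rel r" by (simp only: \<phi>_def coset_eq_iff[OF subspace_Rel])
      then have "Phi (\<psi> y - \<psi> z) = 0" by (rule Phi_Rel)
      then have "Phi (\<psi> y) - Phi (\<psi> z) = 0"
        using Phi_diff[OF MT_span_Dg[OF \<psi>_MT[OF yz(1)]] MT_span_Dg[OF \<psi>_MT[OF yz(2)]]] by (simp only:)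
      then show "y = z" by (simp only: Phi_\<psi>[OF sp[OF yz(1)]] Phi_\<psi>[OF sp[OF yz(2)]] right_minus_eq)
    qed
    show "\<phi> ` vecs (Kr r) = vecs (Dr r)"
    proof (intro equalityI subsetI)
      fix C assume "C \<in> \<phi> ` vecs (Kr r)"
      then show "C \<in> vecs (Dr r)" using \<psi>_MT by (auto simp: Delta_simps \<phi>_def)
    next
      fix C assume "C \<in> vecs (Dr r)"
      then obtain f where f: "f \<in> MT r" "C = f +o Rel r" by (auto simp: Delta_simps)
      have "C = \<phi> (Phi f)" unfolding f(2) \<phi>_def coset_eq_iff[OF subspace_Rel] by (rule \<psi>_Phi[OF f(1)])
      then show "C \<in> \<phi> ` vecs (Kr r)" using Phi_Ker[OF f(1)] by blast
    qed
  qed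
  \<comment> \<open>With \<open>y = Phi (\<psi> y)\<close>, concatenation descending along
    \<open>Phi\<close> gives b y = \<open>Phi\<close> of b (\<psi> y); applying \<psi> returns b
    (\<psi> y) up to relations.\<close>
  moreover have "\<phi> (vact DB b y) = M_act m p \<delta> N b ` \<phi> y + Rel r"
    if b: "b \<in> carrier Balgp" and y: "y \<in> vecs (Kr r)" for b y
  proof -
    have "vact DB b y = Phi (M_act m p \<delta> N b (Phi (\<psi> y)))"
      by (simp only: DB_act[OF b sp[OF y]] Phi_\<psi>[OF sp[OF y]])
    also have "\<dots> = Phi (M_act m p \<delta> N b (\<psi> y))"
      by (rule Phi_M_act_Phi[OF b MT_span_Dg[OF \<psi>_MT[OF y]]])
    finally have e: "vact DB b y = Phi (M_act m p \<delta> N b (\<psi> y))" .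
    have "M_act m p \<delta> N b (\<psi> y) - \<psi> (vact DB b y) \<in> Rel r"
      unfolding e by (rule \<psi>_Phi[OF M_act_MT[OF b \<psi>_MT[OF y]]])
    then have "M_act m p \<delta> N b (\<psi> y) +o Rel r = \<phi> (vact DB b y)"
      by (simp only: \<phi>_def coset_eq_iff[OF subspace_Rel])
    then show ?thesis unfolding \<phi>_def coset_M_act[OF b \<psi>_MT[OF y]] by (rule sym)
  qed
  ultimately show ?thesis
    unfolding mod_iso_def
    using eigenspace_decomposition(2)[of r] mod_closed_Delta
    by (intro conjI exI[of _ \<phi>])
       (simp_all add: Delta_simps \<phi>_def coset_plus[OF subspace_Rel] coset_fscale \<psi>_add \<psi>_fscale sp)
qed

end

section \<open>The case \<open>n = 2l\<close>\<close>

lemma lin_ext_tensor_left: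
  assumes "finite A" "y \<in> span_on A"
  shows "lin_ext (\<lambda>v. tensor (h v) x) y = tensor (lin_ext h y) x"
  unfolding fun_eq_iff
  by (auto simp: tensor_def lin_ext_apply[OF assms] sum_distrib_right mult.assoc)

lemma tensor_sum_left: "tensor (\<Sum>i\<in>I. f i) x = (\<Sum>i\<in>I. tensor (f i) x)"
  by (rule ext) (simp add: tensor_def sum_fun_apply sum_distrib_right case_prod_unfold)

lemma tensor_add_left: "tensor (f + g) x = tensor f x + tensor g x"
  by (auto simp: tensor_def fun_eq_iff algebra_simps)

lemma tensor_fscale_left: "tensor (fscale c f) x = fscale c (tensor f x)"
  by (auto simp: tensor_def fscale_def fun_eq_iff algebra_simps)

lemma empty_mpartition:
  assumes "lam \<in> mpartitions m 0" shows "lam = replicate m []"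
proof -
  have "\<mu> = []" if "\<mu> \<in> set lam" for \<mu>
  proof (cases \<mu>)
    case (Cons a as)
    have "sum_list \<mu> = 0" "0 \<notin> set \<mu>" using assms that by (auto simp: mpartitions_def)
    then show ?thesis using Cons by simp
  qed
  moreover have "length lam = m" using assms by (simp add: mpartitions_def)
  ultimately show ?thesis by (intro replicate_eqI) auto
qed

lemma std_tableaux_empty: "std_tableaux (replicate m []) = {replicate m []}"
proof (intro equalityI subsetI)
  fix T :: tableau assume "T \<in> std_tableaux (replicate m [])"
  then have eq: "map (map length) T = replicate m []" by (simp add: std_tableaux_def)
  have "U = []" if "U \<in> set T" for U
  proof -
    have "map length U \<in> set (map (map length) T)" using that by simp
    then show ?thesis unfolding eq by (auto split: if_splits)
  qed
  moreover have "length T = m" using arg_cong[OF eq, of length] by simp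
  ultimately show "T \<in> {replicate m []}" by (auto intro: replicate_eqI)
next
  fix T :: tableau assume "T \<in> {replicate m []}"
  then show "T \<in> std_tableaux (replicate m [])"
    by (auto simp: std_tableaux_def sum_list_replicate concat_replicate_trivial)
qed

context standard_setup
begin

text \<open>For t = 1 the root \<omega> = \<xi>^d has order exactly p, so its powers separate
  residues modulo p.\<close>

lemma \<omega>_inj:
  assumes "t = 1" "\<omega> ^ a = \<omega> ^ b" shows "a mod p = b mod p"
proof -
  have nz: "\<omega> \<noteq> 0" using \<omega>_pow_p p by (metis power_0_left less_irrefl zero_neq_one)
  have "\<not> i < j" if "i < p" "j < p" "\<omega> ^ i = \<omega> ^ j" for i j
  proof
    assume ij: "i < j"
    have "\<omega> ^ i * \<omega> ^ (j - i) = \<omega> ^ j"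
      unfolding power_add[symmetric] using ij by simp
    then have "\<omega> ^ i * \<omega> ^ (j - i) = \<omega> ^ i * 1" by (simp only: that(3) mult_1_right)
    then have "\<omega> ^ (j - i) = 1" by (simp only: mult_left_cancel[OF power_not_zero[OF nz]])
    moreover have "0 < j - i" "j - i < p div t" using ij that(2) assms(1) by auto
    ultimately show False using \<omega>_prim by blast
  qed
  moreover have "\<omega> ^ (a mod p) = \<omega> ^ (b mod p)" using assms(2) \<omega>_mod by metis
  ultimately show ?thesis using p by (metis mod_less_divisor linorder_neqE_nat)
qed

text \<open>There is a single tableau, fixed by rotation, so tensoring with it identifies the span
  of dangles with the restricted module. On this \<sigma> is diagonal with eigenvalue \<omega>^|v|
  at \<open>v\<close>, and its eigenspaces are cut out by label sums modulo p.\<close>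

lemma Delta_empty_iso_Ker:
  assumes N0: "N = 0" and t1: "t = 1"
  shows "mod_iso Balgp (Delta_empty m p \<delta> n l r) (Kr r)"
proof -
  let ?D = "Delta_empty m p \<delta> n l r"
  let ?Vr = "{v \<in> V. label_sum v mod p = r mod p}"
  define T0 :: tableau where "T0 = replicate m []"
  have ST: "ST = {T0}"
    using empty_mpartition[of lam m] lam std_tableaux_empty by (simp add: N0 T0_def)
  have T0: "bas T0 \<in> (span_on ST :: (tableau \<Rightarrow> 'k) set)" by (simp add: ST)
  have rT0: "rotate (d * t) T0 = T0" using rotate_std_tableaux[OF rot, of T0] by (simp add: ST)
  \<comment> \<open>Without southern nodes there are no through-strands, so the conditions on free
    lines are vacuous and concatenation never leaves the dangles.\<close>
  have inV: "D \<in> V" if D: "D \<in> diagrams m n N" for D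
  proof -
    have "card (through_strands D) = 0" "card (south_arcs D) = 0"
      using count_south[OF D] N0 by linarith+
    moreover have "finite (through_strands D)"
      using finite_diagram[OF D] by (simp add: through_strands_def)
    ultimately have e: "through_strands D = {}" "south_arcs D = {}"
      using finite_south_arcs[OF D] by auto
    have "card (north_arcs D) = l" using count_north[OF D] e(1) N0 ln by simp
    moreover have "({North i, South j}, c) \<notin> D" for i j c
      using e(1) by (auto simp: through_strands_def)
    ultimately show ?thesis using D e by (simp add: dangles_def)
  qed
  have split: "dangle_split m n l v = (v, idd N)" if v: "v \<in> V" for v
    using dangle_split_compose[OF m ln v idd_in_Ggrp[OF m]]
    by (simp only: compose_idd[OF m M_basis_diagram[OF V_Dg[OF v]]])
  have span: "tensor y (bas T0) \<in> span_on (V \<times> ST)" if "y \<in> span_on V" for y :: "diagram \<Rightarrow> 'k"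
    by (rule tensor_in_span_on[OF that T0])
  have expand: "tensor y (bas T0) = lin_ext (\<lambda>v. tensor (bas v) (bas T0)) y" if y: "y \<in> span_on V" for y :: "diagram \<Rightarrow> 'k"
    by (simp add: lin_ext_tensor_left[OF finite_bases(3) y] lin_ext_bas_id[OF finite_bases(3) y])
  have Phi_id: "Phi (tensor y (bas T0)) = tensor y (bas T0)" if y: "y \<in> span_on V" for y :: "diagram \<Rightarrow> 'k"
  proof -
    have "Phi (lin_ext (\<lambda>v. tensor (bas v) (bas T0)) y) = lin_ext (\<lambda>v. Phi (tensor (bas v) (bas T0))) y"
      unfolding Phi_def
      by (rule lin_ext_lin_ext[OF finite_bases(3) y, of "V \<times> ST"]) (auto intro!: tensor_bas_in_span_on T0)
    also have "\<dots> = lin_ext (\<lambda>v. tensor (bas v) (bas T0)) y"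
      by (rule lin_ext_cong[OF y]) (simp only: Phi_tensor[OF split T0] \<rho>_idd[OF T0])
    finally show ?thesis by (simp only: expand[OF y])
  qed
  define e where "e X = lin_ext (\<lambda>v. fscale (loop_coeff m p \<delta> X v) (bas (compose m X v)) :: diagram \<Rightarrow> 'k)" for X
  have e_span: "e X y \<in> span_on ?Vr" if X: "X \<in> BX" and y: "y \<in> span_on ?Vr" for X y
    unfolding e_def
  proof (rule lin_ext_in_span_on[OF y])
    fix v assume v: "v \<in> ?Vr"
    then have vd: "v \<in> diagrams m n N" by (simp add: dangles_def)
    have Xd: "X \<in> diagrams m n n" using X by blast
    show "fscale (loop_coeff m p \<delta> X v) (bas (compose m X v)) \<in> span_on ?Vr"
    proof (cases "loop_coeff m p \<delta> X v = 0")
      case False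
      have "label_sum (compose m X v) mod p = (label_sum X + label_sum v) mod p"
        by (rule label_sum_compose_mod[OF Xd vd p_dvd_m False])
      also have "\<dots> = r mod p" using X v by (auto elim!: dvdE)
      finally show ?thesis
        using inV[OF compose_in_diagrams[OF m Xd vd]] by (intro span_on_fscale) simp
    qed simp
  qed
  have Vr_V: "y \<in> span_on V" if "y \<in> span_on ?Vr" for y :: "diagram \<Rightarrow> 'k"
    using that by (rule span_on_mono) blast
  have actX_e: "actX X (tensor y (bas T0)) = tensor (e X y) (bas T0)" if y: "y \<in> span_on V" for X y
  proof -
    have "actX X (lin_ext (\<lambda>v. tensor (bas v) (bas T0)) y) = lin_ext (\<lambda>v. actX X (tensor (bas v) (bas T0))) y"
      unfolding actX_def
      by (rule lin_ext_lin_ext[OF finite_bases(3) y, of "V \<times> ST"]) (auto intro!: tensor_bas_in_span_on T0)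
    also have "\<dots> = lin_ext (\<lambda>v. tensor (fscale (loop_coeff m p \<delta> X v) (bas (compose m X v))) (bas T0)) y"
      by (simp add: actX_tensor[OF T0] N0 tensor_fscale_left)
    also have "\<dots> = tensor (e X y) (bas T0)"
      unfolding e_def by (rule lin_ext_tensor_left[OF finite_bases(3) y])
    finally show ?thesis by (simp only: expand[OF y])
  qed
  have D_simps: "vecs ?D = span_on ?Vr" "vadd ?D = (+)" "vscale ?D = fscale"
    "vact ?D = (\<lambda>b y. lin_ext (\<lambda>X. e X y) b)"
    by (simp_all add: Delta_empty_def e_def)
  have E_sum: "lin_ext (\<lambda>X. e X y) b = (\<Sum>X\<in>BX. fscale (b X) (e X y))" if "b \<in> carrier Balgp" for b y
    by (rule lin_ext_eq_sum[OF finite_BX]) (use that carrier_Balgp in blast)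
  have E_span: "lin_ext (\<lambda>X. e X y) b \<in> span_on ?Vr" if "b \<in> carrier Balgp" "y \<in> span_on ?Vr" for b y
    unfolding E_sum[OF that(1)] by (intro span_on_sum span_on_fscale e_span that(2))
  have closed: "mod_closed Balgp ?D"
    unfolding mod_closed_def D_simps
  proof (intro conjI ballI allI)
    have "(0 :: diagram \<Rightarrow> 'k) \<in> span_on ?Vr" by (rule span_on_zero)
    then show "(span_on ?Vr :: (diagram \<Rightarrow> 'k) set) \<noteq> {}" by blast
  qed (auto intro: span_on_add span_on_fscale E_span)
  have sD_at: "sD z (v, T) = \<omega> ^ label_sum v * z (v, T)" if z: "z \<in> span_on (V \<times> ST)" for z v T
  proof -
    have "sD z = lin_ext (\<lambda>u. fscale (\<omega> ^ label_sum (fst u)) (bas u)) z"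
      unfolding sigma_Delta_def
      by (rule lin_ext_cong[OF z]) (auto simp: ST sigma_def rT0 power_mult)
    then have "sD z (v, T) = (\<Sum>u\<in>V \<times> ST. z u * fscale (\<omega> ^ label_sum (fst u)) (bas u) (v, T))"
      using lin_ext_apply[of "V \<times> ST" z] z by simp
    also have "\<dots> = (\<Sum>u\<in>V \<times> ST. if u = (v, T) then \<omega> ^ label_sum v * z (v, T) else 0)"
      by (rule sum.cong) (auto simp: fscale_def bas_def)
    also have "\<dots> = \<omega> ^ label_sum v * z (v, T)"
      using span_onD[OF z, of "(v, T)"] by (simp add: sum.delta)
    finally show ?thesis .
  qed
  have K: "z \<in> vecs (Kr r) \<longleftrightarrow>
      z \<in> span_on (V \<times> ST) \<and> (\<forall>v T. z (v, T) \<noteq> 0 \<longrightarrow> label_sum v mod p = r mod p)" for z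
  proof -
    have "sD z = fscale (\<omega> ^ r) z \<longleftrightarrow> (\<forall>v T. z (v, T) \<noteq> 0 \<longrightarrow> \<omega> ^ label_sum v = \<omega> ^ r)"
      if "z \<in> span_on (V \<times> ST)"
      by (auto simp: fun_eq_iff sD_at[OF that] fscale_def)
    then show ?thesis unfolding Ker_vecs using \<omega>_inj[OF t1] \<omega>_cong by blast
  qed
  let ?\<phi> = "\<lambda>y. tensor y (bas T0)"
  have "bij_betw ?\<phi> (vecs ?D) (vecs (Kr r))"
  proof (rule bij_betwI)
    show "?\<phi> \<in> vecs ?D \<rightarrow> vecs (Kr r)"
    proof
      fix y assume "y \<in> vecs ?D"
      then have y: "y \<in> span_on ?Vr" by (simp only: D_simps)
      have "label_sum v mod p = r mod p" if "?\<phi> y (v, T) \<noteq> 0" for v T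
        using that span_onD[OF y, of v] by (auto simp: tensor_def)
      then show "?\<phi> y \<in> vecs (Kr r)" using span[OF Vr_V[OF y]] K by blast
    qed
    show "(\<lambda>z v. z (v, T0)) \<in> vecs (Kr r) \<rightarrow> vecs ?D"
    proof
      fix z assume "z \<in> vecs (Kr r)"
      then have z: "z \<in> span_on (V \<times> ST)" "\<And>v T. z (v, T) \<noteq> 0 \<Longrightarrow> label_sum v mod p = r mod p"
        using K by blast+
      show "(\<lambda>v. z (v, T0)) \<in> vecs ?D"
        unfolding D_simps by (rule span_onI) (use z span_onD[OF z(1)] in blast)
    qed
    show "(\<lambda>v. ?\<phi> y (v, T0)) = y" for y by (simp add: tensor_def bas_def)
    show "?\<phi> (\<lambda>v. z (v, T0)) = z" if "z \<in> vecs (Kr r)" for z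
    proof (rule ext)
      fix u :: "diagram \<times> tableau" obtain v T where u: "u = (v, T)" by (cases u)
      have z: "z \<in> span_on (V \<times> ST)" using that K by blast
      show "?\<phi> (\<lambda>v. z (v, T0)) u = z u"
        using span_onD[OF z, of "(v, T)"] by (simp add: u tensor_def bas_def ST)
    qed
  qed
  moreover have "?\<phi> (lin_ext (\<lambda>X. e X y) b) = vact DB b (?\<phi> y)"
    if b: "b \<in> carrier Balgp" and y: "y \<in> span_on ?Vr" for b y
  proof -
    have "?\<phi> (lin_ext (\<lambda>X. e X y) b) = (\<Sum>X\<in>BX. fscale (b X) (?\<phi> (e X y)))"
      unfolding E_sum[OF b] by (simp only: tensor_sum_left tensor_fscale_left)
    also have "\<dots> = M_act m p \<delta> N b (?\<phi> y)"
      unfolding M_act_sum[OF b] by (simp only: actX_e[OF Vr_V[OF y]])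
    finally have eq: "?\<phi> (lin_ext (\<lambda>X. e X y) b) = M_act m p \<delta> N b (?\<phi> y)" .
    show ?thesis
      unfolding DB_act[OF b span[OF Vr_V[OF y]]] eq[symmetric]
      by (rule Phi_id[OF Vr_V[OF E_span[OF b y]], symmetric])
  qed
  ultimately show ?thesis
    unfolding mod_iso_def using closed eigenspace_decomposition(2)[of r]
    by (intro conjI exI[of _ ?\<phi>]) (simp_all add: D_simps tensor_add_left tensor_fscale_left)
qed

end

text \<open>The stabilizer is listed by representatives below \<open>p\<close>. For
  \<open>t = p\<close> the generator is represented by 0, but then rotation by \<open>d * t\<close>
  is a full turn.\<close>

lemma rotate_fixed_of_stab:
  assumes "0 < p" "t dvd p" "length lam = p * d" "stab p d lam = {(t * j) mod p | j. True}"
  shows "rotate (d * t) lam = lam"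
proof (cases "t = p")
  case False
  have "(t * 1) mod p \<in> stab p d lam" unfolding assms(4) by blast
  moreover have "t < p" using False dvd_imp_le[OF assms(2,1)] by simp
  ultimately show ?thesis by (simp add: stab_def sigma_pow)
qed (simp add: assms(3) mult.commute)

text \<open>If everything fixes \<open>lam\<close>, then 1 is a multiple of \<open>t\<close> modulo
  \<open>p\<close>; as \<open>t\<close> divides \<open>p\<close>, it divides 1.\<close>

lemma stab_generator_eq_one:
  assumes "0 < p" "t dvd p" "rotate d lam = lam" "stab p d lam = {(t * j) mod p | j. True}"
  shows "t = 1"
proof -
  have "(sigma d ^^ j) lam = lam" for j
    using rotate_fixed_funpow[OF assms(3)] by (simp add: sigma_pow)
  then have "1 mod p \<in> stab p d lam" using assms(1) by (simp add: stab_def)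
  then obtain j where "1 mod p = (t * j) mod p" unfolding assms(4) by blast
  moreover have "t dvd (t * j) mod p" using assms(2) by (simp add: dvd_mod)
  ultimately have "t dvd 1 mod p" by simp
  then have "t dvd 1" by (simp only: dvd_mod_iff[OF assms(2)])
  then show ?thesis by simp
qed

theorem theorem3p4p1:
  fixes \<xi> :: "'k :: {alg_closed_field, field_char_0}"
    and \<delta> :: "nat \<Rightarrow> 'k"
    and m p d n l t :: nat
    and lam :: mpart
    and \<rho> :: "diagram \<Rightarrow> tableau \<Rightarrow> tableau \<Rightarrow> 'k"
  assumes "0 < m" "0 < p" "0 < d" "0 < n" "m = p * d"
    and "\<xi> ^ m = 1" "\<And>j. 0 < j \<Longrightarrow> j < m \<Longrightarrow> \<xi> ^ j \<noteq> 1"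
    and "2 * l \<le> n" "lam \<in> mpartitions m (n - 2 * l)"
    and "t dvd p" "stab p d lam = {(t * j) mod p | j. True}"
    and "Sbar_action m \<xi> lam \<rho>"
  shows "(2 * l < n \<longrightarrow>
           mod_iso (Balg m p p \<delta> n) (Delta_bar m p \<delta> n l lam \<rho>)
             (mod_sum (p div t) (\<lambda>r. Delta m p d \<xi> \<delta> n l lam \<rho> t r)) \<and>
           (\<forall>r < p div t. mod_iso (Balg m p p \<delta> n) (Delta m p d \<xi> \<delta> n l lam \<rho> t r)
             (Ker_mod \<xi> d t r (Delta_bar m p \<delta> n l lam \<rho>)))) \<and>
         (n = 2 * l \<longrightarrow>
           mod_iso (Balg m p p \<delta> n) (Delta_bar m p \<delta> n l lam \<rho>)
             (mod_sum (p div t) (\<lambda>r. Delta_empty m p \<delta> n l r)) \<and>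
           (\<forall>r < p div t. mod_iso (Balg m p p \<delta> n) (Delta_empty m p \<delta> n l r)
             (Ker_mod \<xi> d t r (Delta_bar m p \<delta> n l lam \<rho>))))"
proof -
  have lam: "length lam = p * d" using assms(5,9) by (simp add: mpartitions_def)
  have rot: "rotate (d * t) lam = lam"
    by (rule rotate_fixed_of_stab[OF assms(2,10) lam assms(11)])
  interpret standard_setup \<xi> \<delta> m p d n l t lam \<rho>
    by unfold_locales (use assms rot in auto)
  let ?D = "\<lambda>r. Delta m p d \<xi> \<delta> n l lam \<rho> t r" and ?E = "\<lambda>r. Delta_empty m p \<delta> n l r"
  have "mod_iso Balgp DB (mod_sum (p div t) ?D) \<and>
      (\<forall>r < p div t. mod_iso Balgp (?D r) (Ker_mod \<xi> d t r DB))" if "2 * l < n"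
  proof -
    have N: "0 < n - 2 * l" using that by simp
    show ?thesis
      using mod_iso_trans[OF eigenspace_decomposition(1) mod_iso_mod_sum[OF Ker_iso_Delta[OF N]]]
        mod_iso_sym[OF Ker_iso_Delta[OF N]] by blast
  qed
  moreover have "mod_iso Balgp DB (mod_sum (p div t) ?E) \<and>
      (\<forall>r < p div t. mod_iso Balgp (?E r) (Ker_mod \<xi> d t r DB))" if "n = 2 * l"
  proof -
    have N: "n - 2 * l = 0" using that by simp
    \<comment> \<open>All components of the empty multipartition agree, so it is fixed by every
      rotation and its stabilizer is the whole cyclic group.\<close>
    have "lam = replicate m []" using empty_mpartition assms(9) N by metis
    moreover have "rotate d (replicate m x) = replicate m x" for x :: "nat list"
      by (cases "m = 0") (simp_all add: rotate_drop_take min_def flip: replicate_add)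
    ultimately have t1: "t = 1" by (intro stab_generator_eq_one[OF assms(2,10) _ assms(11)]) simp
    show ?thesis
      using mod_iso_trans[OF eigenspace_decomposition(1)
          mod_iso_mod_sum[OF mod_iso_sym[OF Delta_empty_iso_Ker[OF N t1]]]]
        Delta_empty_iso_Ker[OF N t1] by blast
  qed
  ultimately show ?thesis by blast
qed

end
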